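(* Let $0<\beta\le1$ and $d\in\mathbb N$. For any nonempty open subset $\mathcal U\subset\mathcal S_d'(\mathbb R)$, we have $\mu_\beta^{\otimes d}(\mathcal U)>0$.
   Context: For $0<\beta\le1$, $E_\beta(z)=\sum_{n=0}^\infty \frac{z^n}{\Gamma(\beta n+1)}$. $\mathcal S(\mathbb R)$ is the real Schwartz space, $\mathcal S'(\mathbb R)$ its dual with the cylinder $\sigma$-algebra (which equals the Borel $\sigma$-algebra of both the weak and strong topologies), and $\mu_\beta$ is the unique probability measure on $\mathcal S'(\mathbb R)$ with $\int e^{i\langle\omega,\varphi\rangle}d\mu_\beta(\omega)=E_\beta(-\tfrac12\langle\varphi,\varphi\rangle)$ for $\varphi\in\mathcal S(\mathbb R)$, where $\langle\varphi,\varphi\rangle=\int\varphi^2dx$. $\mathcal S_d(\mathbb R)=\bigoplus_{k=1}^d\mathcal S(\mathbb R)$; its dual $\mathcal S_d'(\mathbb R)$ carries the strong topology (equal to the inductive limit topology) and is topologically isomorphic to the product $\mathcal S'(\mathbb R)^d$; its cylinder $\sigma$-algebra is the $d$-fold product $\sigma$-algebra, and $\mu_\beta^{\otimes d}$ is the $d$-fold product measure. *)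

theory Defs
  imports "HOL-Probability.Probability"
begin

definition mittag_leffler :: "real \<Rightarrow> complex \<Rightarrow> complex" where
  "mittag_leffler \<beta> z = (\<Sum>n. z ^ n / complex_of_real (Gamma (\<beta> * real n + 1)))"

definition schwartz_functions :: "(real \<Rightarrow> real) set" where
  "schwartz_functions =
     {f. (\<forall>n x. (deriv ^^ n) f differentiable (at x)) \<and>
         (\<forall>m n. bounded (range (\<lambda>x. x ^ m * (deriv ^^ n) f x)))}"

lemma higher_deriv_lincomb:
  fixes f g :: "real \<Rightarrow> real"
  assumes "\<And>n x. (deriv ^^ n) f differentiable (at x)"
    and "\<And>n x. (deriv ^^ n) g differentiable (at x)"
  shows "(deriv ^^ n) (\<lambda>x. a * f x + b * g x) =
           (\<lambda>x. a * (deriv ^^ n) f x + b * (deriv ^^ n) g x)"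
proof (induction n)
  case 0
  show ?case by simp
next
  case (Suc n)
  have "((\<lambda>x. a * (deriv ^^ n) f x + b * (deriv ^^ n) g x) has_real_derivative
          a * deriv ((deriv ^^ n) f) x + b * deriv ((deriv ^^ n) g) x) (at x)" for x
    by (intro DERIV_add DERIV_cmult) (simp_all add: DERIV_deriv_iff_real_differentiable assms)
  then show ?case
    using Suc by (auto intro!: DERIV_imp_deriv)
qed

lemma schwartz_functions_lincomb:
  assumes "f \<in> schwartz_functions" "g \<in> schwartz_functions"
  shows "(\<lambda>x. a * f x + b * g x) \<in> schwartz_functions"
proof -
  have f: "\<And>n x. (deriv ^^ n) f differentiable (at x)"
    and g: "\<And>n x. (deriv ^^ n) g differentiable (at x)"
    using assms by (auto simp: schwartz_functions_def)
  have "bounded (range (\<lambda>x. x ^ m * (a * (deriv ^^ n) f x + b * (deriv ^^ n) g x)))" for m n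
  proof -
    have "bounded (range (\<lambda>x. a * (x ^ m * (deriv ^^ n) f x)))"
         "bounded (range (\<lambda>x. b * (x ^ m * (deriv ^^ n) g x)))"
      using assms bounded_scaling[of "range (\<lambda>x. x ^ m * (deriv ^^ n) f x)" a]
        bounded_scaling[of "range (\<lambda>x. x ^ m * (deriv ^^ n) g x)" b]
      by (auto simp: schwartz_functions_def image_image)
    from bounded_plus_comp[OF this] show ?thesis
      by (simp add: algebra_simps)
  qed
  then show ?thesis
    using f g by (auto simp: schwartz_functions_def higher_deriv_lincomb)
qed

lemma schwartz_functions_zero: "(\<lambda>x. 0) \<in> schwartz_functions"
proof -
  have "(deriv ^^ n) (\<lambda>x::real. 0::real) = (\<lambda>x. 0)" for n
    by (induction n) auto
  then show ?thesis by (simp add: schwartz_functions_def image_constant_conv)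
qed

typedef schwartz = schwartz_functions
  morphisms schwartz_fun Schwartz
  using schwartz_functions_zero by blast

setup_lifting type_definition_schwartz

definition schwartz_seminorm :: "nat \<Rightarrow> nat \<Rightarrow> schwartz \<Rightarrow> real" where
  "schwartz_seminorm m n \<phi> = (SUP x. \<bar>x ^ m * (deriv ^^ n) (schwartz_fun \<phi>) x\<bar>)"

instantiation schwartz :: real_vector
begin

lift_definition zero_schwartz :: schwartz is "\<lambda>x. 0"
  by (rule schwartz_functions_zero)

lift_definition plus_schwartz :: "schwartz \<Rightarrow> schwartz \<Rightarrow> schwartz" is "\<lambda>f g x. f x + g x"
  using schwartz_functions_lincomb[of _ _ 1 1] by simp

lift_definition minus_schwartz :: "schwartz \<Rightarrow> schwartz \<Rightarrow> schwartz" is "\<lambda>f g x. f x - g x"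
  using schwartz_functions_lincomb[of _ _ 1 "-1"] by simp

lift_definition uminus_schwartz :: "schwartz \<Rightarrow> schwartz" is "\<lambda>f x. - f x"
  using schwartz_functions_lincomb[of _ _ "-1" 0] by simp

lift_definition scaleR_schwartz :: "real \<Rightarrow> schwartz \<Rightarrow> schwartz" is "\<lambda>c f x. c * f x"
  using schwartz_functions_lincomb[of _ _ _ 0] by simp

instance
  by standard (transfer; simp add: algebra_simps)+

end

instantiation schwartz :: topological_space
begin

definition open_schwartz :: "schwartz set \<Rightarrow> bool" where
  "open_schwartz U \<longleftrightarrow>
     (\<forall>\<phi>\<in>U. \<exists>N. \<exists>\<epsilon>>0. \<forall>\<psi>. (\<forall>m\<le>N. \<forall>n\<le>N. schwartz_seminorm m n (\<psi> - \<phi>) < \<epsilon>) \<longrightarrow> \<psi> \<in> U)"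

instance
proof
  show "open (UNIV :: schwartz set)"
    by (auto simp: open_schwartz_def intro: zero_less_one)
next
  fix S T :: "schwartz set"
  assume S: "open S" and T: "open T"
  show "open (S \<inter> T)"
    unfolding open_schwartz_def
  proof
    fix \<phi> assume "\<phi> \<in> S \<inter> T"
    then have "\<phi> \<in> S" "\<phi> \<in> T" by auto
    obtain M \<epsilon> where "\<epsilon> > 0"
      and M: "\<forall>\<psi>. (\<forall>m\<le>M. \<forall>n\<le>M. schwartz_seminorm m n (\<psi> - \<phi>) < \<epsilon>) \<longrightarrow> \<psi> \<in> S"
      using bspec[OF S[unfolded open_schwartz_def] \<open>\<phi> \<in> S\<close>] by (elim exE conjE)
    obtain N \<delta> where "\<delta> > 0"
      and N: "\<forall>\<psi>. (\<forall>m\<le>N. \<forall>n\<le>N. schwartz_seminorm m n (\<psi> - \<phi>) < \<delta>) \<longrightarrow> \<psi> \<in> T"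
      using bspec[OF T[unfolded open_schwartz_def] \<open>\<phi> \<in> T\<close>] by (elim exE conjE)
    from M N \<open>\<epsilon> > 0\<close> \<open>\<delta> > 0\<close> show "\<exists>N. \<exists>\<epsilon>>0. \<forall>\<psi>. (\<forall>m\<le>N. \<forall>n\<le>N. schwartz_seminorm m n (\<psi> - \<phi>) < \<epsilon>) \<longrightarrow> \<psi> \<in> S \<inter> T"
      by (intro exI[of _ "max M N"] exI[of _ "min \<epsilon> \<delta>"]) auto
  qed
next
  fix K :: "schwartz set set"
  assume "\<forall>S\<in>K. open S"
  then show "open (\<Union>K)"
    unfolding open_schwartz_def by (meson UnionE UnionI)
qed

end

definition dual_space :: "('a::{real_vector,topological_space} \<Rightarrow> real) set" where
  "dual_space = {\<omega>. linear \<omega> \<and> continuous_on UNIV \<omega>}"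

text \<open>Boundedness in the sense of topological vector spaces: absorbed by every
  neighbourhood of the origin.\<close>

definition tvs_bounded :: "'a::{real_vector,topological_space} set \<Rightarrow> bool" where
  "tvs_bounded B \<longleftrightarrow> (\<forall>V. open V \<longrightarrow> 0 \<in> V \<longrightarrow> (\<exists>r>0. \<forall>t\<ge>r. B \<subseteq> (*\<^sub>R) t ` V))"

definition strong_topology :: "('a::{real_vector,topological_space} \<Rightarrow> real) topology" where
  "strong_topology = topology (\<lambda>U. U \<subseteq> dual_space \<and>
     (\<forall>\<omega>\<in>U. \<exists>B. \<exists>\<epsilon>>0. tvs_bounded B \<and>
        {\<eta> \<in> dual_space. \<forall>\<phi>\<in>B. \<bar>\<eta> \<phi> - \<omega> \<phi>\<bar> < \<epsilon>} \<subseteq> U))"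

lemma tvs_bounded_Un:
  assumes "tvs_bounded B" "tvs_bounded C"
  shows "tvs_bounded (B \<union> C)"
  unfolding tvs_bounded_def
proof (intro allI impI)
  fix V :: "'a set" assume "open V" "0 \<in> V"
  with assms obtain r s where "r > 0" "s > 0"
    "\<forall>t\<ge>r. B \<subseteq> (*\<^sub>R) t ` V" "\<forall>t\<ge>s. C \<subseteq> (*\<^sub>R) t ` V"
    unfolding tvs_bounded_def by meson
  then show "\<exists>r>0. \<forall>t\<ge>r. B \<union> C \<subseteq> (*\<^sub>R) t ` V"
    by (intro exI[of _ "max r s"]) auto
qed

text \<open>The family used in the definition of \<^const>\<open>strong_topology\<close> is indeed a topology.\<close>

lemma openin_strong_topology:
  "openin strong_topology U \<longleftrightarrow> U \<subseteq> dual_space \<and>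
     (\<forall>\<omega>\<in>U. \<exists>B. \<exists>\<epsilon>>0. tvs_bounded B \<and>
        {\<eta> \<in> dual_space. \<forall>\<phi>\<in>B. \<bar>\<eta> \<phi> - \<omega> \<phi>\<bar> < \<epsilon>} \<subseteq> U)"
proof -
  let ?N = "\<lambda>(\<omega>::'a \<Rightarrow> real) B \<epsilon>. {\<eta> \<in> dual_space. \<forall>\<phi>\<in>B. \<bar>\<eta> \<phi> - \<omega> \<phi>\<bar> < \<epsilon>}"
  let ?P = "\<lambda>U. U \<subseteq> dual_space \<and> (\<forall>\<omega>\<in>U. \<exists>B. \<exists>\<epsilon>>0. tvs_bounded B \<and> ?N \<omega> B \<epsilon> \<subseteq> U)"
  have Int: "?P (S \<inter> T)" if S: "?P S" and T: "?P T" for S T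
  proof (intro conjI ballI)
    show "S \<inter> T \<subseteq> dual_space" using S by blast
    fix \<omega> assume "\<omega> \<in> S \<inter> T"
    then have "\<omega> \<in> S" "\<omega> \<in> T" by auto
    obtain B \<epsilon> where B: "\<epsilon> > 0" "tvs_bounded B" "?N \<omega> B \<epsilon> \<subseteq> S"
      using bspec[OF conjunct2[OF S] \<open>\<omega> \<in> S\<close>] by (elim exE conjE)
    obtain C \<delta> where C: "\<delta> > 0" "tvs_bounded C" "?N \<omega> C \<delta> \<subseteq> T"
      using bspec[OF conjunct2[OF T] \<open>\<omega> \<in> T\<close>] by (elim exE conjE)
    have "?N \<omega> (B \<union> C) (min \<epsilon> \<delta>) \<subseteq> ?N \<omega> B \<epsilon> \<inter> ?N \<omega> C \<delta>" by auto
    also have "\<dots> \<subseteq> S \<inter> T" using B C by (intro Int_mono)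
    finally show "\<exists>B. \<exists>\<epsilon>>0. tvs_bounded B \<and> ?N \<omega> B \<epsilon> \<subseteq> S \<inter> T"
      using B C by (intro exI[of _ "B \<union> C"] exI[of _ "min \<epsilon> \<delta>"]) (simp add: tvs_bounded_Un)
  qed
  have Un: "?P (\<Union>K)" if K: "\<forall>S\<in>K. ?P S" for K
  proof (intro conjI ballI)
    show "\<Union>K \<subseteq> dual_space" using K by blast
    fix \<omega> assume "\<omega> \<in> \<Union>K"
    then obtain S where "S \<in> K" "\<omega> \<in> S" by blast
    obtain B \<epsilon> where B: "\<epsilon> > 0" "tvs_bounded B" "?N \<omega> B \<epsilon> \<subseteq> S"
      using bspec[OF conjunct2[OF bspec[OF K \<open>S \<in> K\<close>]] \<open>\<omega> \<in> S\<close>] by (elim exE conjE)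
    have "?N \<omega> B \<epsilon> \<subseteq> \<Union>K" using B(3) \<open>S \<in> K\<close> by (rule order_trans[OF _ Union_upper])
    with B show "\<exists>B. \<exists>\<epsilon>>0. tvs_bounded B \<and> ?N \<omega> B \<epsilon> \<subseteq> \<Union>K"
      by (intro exI[of _ B] exI[of _ \<epsilon>]) simp
  qed
  have "istopology ?P"
    unfolding istopology_def
    by (rule conjI, (rule allI)+, (rule impI)+, erule (1) Int, rule allI, rule impI, erule Un)
  then show ?thesis
    unfolding strong_topology_def by (subst topology_inverse') simp_all
qed

definition cylinder_algebra :: "('a::{real_vector,topological_space} \<Rightarrow> real) measure" where
  "cylinder_algebra =
     sigma dual_space {{\<omega> \<in> dual_space. \<omega> \<phi> \<in> A} | \<phi> A. A \<in> sets borel}"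

lemma space_cylinder_algebra [simp]: "space cylinder_algebra = dual_space"
  unfolding cylinder_algebra_def by (rule space_measure_of) auto

lemma measurable_cylinder_eval: "(\<lambda>\<omega>. \<omega> \<phi>) \<in> borel_measurable cylinder_algebra"
proof (rule measurableI)
  fix A :: "real set" assume "A \<in> sets borel"
  moreover have "(\<lambda>\<omega>. \<omega> \<phi>) -` A \<inter> dual_space = {\<omega> \<in> dual_space. \<omega> \<phi> \<in> A}" by auto
  ultimately show "(\<lambda>\<omega>. \<omega> \<phi>) -` A \<inter> space cylinder_algebra \<in> sets cylinder_algebra"
    unfolding space_cylinder_algebra unfolding cylinder_algebra_def
    by (subst sets_measure_of) (auto intro!: sigma_sets.Basic)
qed simp

text \<open>This property determines \<open>\<mu>\<close> uniquely.\<close>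

definition is_mittag_leffler_measure :: "real \<Rightarrow> (schwartz \<Rightarrow> real) measure \<Rightarrow> bool" where
  "is_mittag_leffler_measure \<beta> \<mu> \<longleftrightarrow>
     prob_space \<mu> \<and> space \<mu> = dual_space \<and> sets \<mu> = sets cylinder_algebra \<and>
     (\<forall>\<phi>. (CLINT \<omega>|\<mu>. exp (\<i> * complex_of_real (\<omega> \<phi>))) =
          mittag_leffler \<beta> (complex_of_real (- (1/2) * (LINT x|lborel. (schwartz_fun \<phi> x)\<^sup>2))))"

text \<open>The direct sum of \<open>d\<close> copies of the Schwartz space is \<open>schwartz ^ 'd\<close> with \<open>d = CARD('d)\<close>, which
  carries the product topology. Its dual is identified with the \<open>d\<close>-fold product of the dual
  of \<^typ>\<open>schwartz\<close> via the following map (see \<open>bij_betw_dual_of_tuple\<close> below), and the product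
  measure is transported along it.\<close>

definition dual_of_tuple :: "('d::finite \<Rightarrow> schwartz \<Rightarrow> real) \<Rightarrow> (schwartz ^ 'd \<Rightarrow> real)" where
  "dual_of_tuple \<omega> = (\<lambda>\<phi>. \<Sum>k\<in>UNIV. \<omega> k (\<phi> $ k))"

definition product_dual_measure ::
    "(schwartz \<Rightarrow> real) measure \<Rightarrow> (schwartz ^ 'd::finite \<Rightarrow> real) measure" where
  "product_dual_measure \<mu> = distr (Pi\<^sub>M UNIV (\<lambda>_. \<mu>)) cylinder_algebra dual_of_tuple"

lemma dual_of_tuple_in_dual:
  assumes "\<And>k. \<omega> k \<in> dual_space"
  shows "dual_of_tuple \<omega> \<in> dual_space"
proof -
  have "linear (dual_of_tuple \<omega>)"
    using assms unfolding dual_of_tuple_def dual_space_def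
    by (auto intro!: linearI simp: linear_add linear_scale sum.distrib sum_distrib_left)
  moreover have "continuous_on UNIV (dual_of_tuple \<omega>)"
    unfolding dual_of_tuple_def
  proof (intro continuous_on_sum)
    fix k
    have "continuous_on UNIV (\<omega> k)" using assms by (auto simp: dual_space_def)
    then show "continuous_on UNIV (\<lambda>\<phi>. \<omega> k (\<phi> $ k))"
      by (rule continuous_on_compose2) (auto intro!: continuous_intros)
  qed
  ultimately show ?thesis by (simp add: dual_space_def)
qed

lemma dual_of_tuple_measurable:
  fixes \<mu> :: "(schwartz \<Rightarrow> real) measure"
  assumes "sets \<mu> = sets cylinder_algebra"
  shows "(dual_of_tuple :: ('d::finite \<Rightarrow> schwartz \<Rightarrow> real) \<Rightarrow> _)
           \<in> measurable (Pi\<^sub>M UNIV (\<lambda>_. \<mu>)) cylinder_algebra"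
proof -
  let ?T = "dual_of_tuple :: ('d \<Rightarrow> schwartz \<Rightarrow> real) \<Rightarrow> _"
  let ?P = "Pi\<^sub>M (UNIV :: 'd set) (\<lambda>_. \<mu>)"
  have sp: "space \<mu> = dual_space" using sets_eq_imp_space_eq[OF assms] by simp
  have ev: "(\<lambda>\<omega>. \<omega> \<phi>) \<in> borel_measurable \<mu>" for \<phi>
    using measurable_cylinder_eval[of \<phi>] measurable_cong_sets[OF assms refl] by blast
  have T: "?T \<omega> \<in> dual_space" if "\<omega> \<in> space ?P" for \<omega>
    using that by (intro dual_of_tuple_in_dual) (simp add: space_PiM sp PiE_iff)
  show ?thesis
    unfolding cylinder_algebra_def
  proof (rule measurable_measure_of)
    show "?T \<in> space ?P \<rightarrow> dual_space"
      using T by blast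
    fix Y :: "(schwartz ^ 'd \<Rightarrow> real) set"
    assume "Y \<in> {{\<omega> \<in> dual_space. \<omega> \<phi> \<in> A} |\<phi> A. A \<in> sets borel}"
    then obtain \<phi> A where Y: "Y = {\<omega> \<in> dual_space. \<omega> \<phi> \<in> A}" and A: "A \<in> sets borel" by blast
    have m: "(\<lambda>\<omega>. ?T \<omega> \<phi>) \<in> borel_measurable ?P"
      unfolding dual_of_tuple_def
      by (intro borel_measurable_sum measurable_compose[OF _ ev] measurable_component_singleton) simp
    have "?T -` Y \<inter> space ?P = (\<lambda>\<omega>. ?T \<omega> \<phi>) -` A \<inter> space ?P"
      unfolding Y using T by blast
    then show "?T -` Y \<inter> space ?P \<in> sets ?P"
      using measurable_sets[OF m A] by simp
  qed auto
qed

lemma bij_betw_dual_of_tuple: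
  "bij_betw (dual_of_tuple :: ('d::finite \<Rightarrow> schwartz \<Rightarrow> real) \<Rightarrow> _)
     (UNIV \<rightarrow> dual_space) dual_space"
proof (rule bij_betwI[where g = "\<lambda>\<eta> (k :: 'd) (\<psi> :: schwartz). \<eta> (axis k \<psi>) :: real"])
  show "dual_of_tuple \<in> ((UNIV :: 'd set) \<rightarrow> dual_space) \<rightarrow> dual_space"
    by (auto intro!: dual_of_tuple_in_dual)
  have lin: "linear (axis k :: schwartz \<Rightarrow> schwartz ^ 'd)" for k
    by (rule linearI) (auto simp: axis_def vec_eq_iff)
  have cont: "continuous_on UNIV (axis k :: schwartz \<Rightarrow> schwartz ^ 'd)" for k
    unfolding axis_def continuous_on_def
  proof (intro ballI tendsto_vec_lambda)
    fix \<psi> :: schwartz and i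
    show "((\<lambda>\<psi>. if i = k then \<psi> else 0) \<longlongrightarrow> (if i = k then \<psi> else 0)) (at \<psi> within UNIV)"
      by (cases "i = k") auto
  qed
  show "(\<lambda>\<eta> k (\<psi> :: schwartz). \<eta> (axis k \<psi>)) \<in> dual_space \<rightarrow> ((UNIV :: 'd set) \<rightarrow> dual_space)"
  proof (intro Pi_I)
    fix \<eta> :: "schwartz ^ 'd \<Rightarrow> real" and k :: 'd
    assume "\<eta> \<in> dual_space"
    then have "linear \<eta>" "continuous_on UNIV \<eta>" by (auto simp: dual_space_def)
    then show "(\<lambda>\<psi>. \<eta> (axis k \<psi>)) \<in> dual_space"
      using linear_compose[OF lin[of k], of \<eta>] continuous_on_compose2[OF _ cont[of k], of UNIV \<eta>]
      by (auto simp: dual_space_def o_def)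
  qed
next
  fix \<omega> :: "'d \<Rightarrow> schwartz \<Rightarrow> real" assume \<omega>: "\<omega> \<in> UNIV \<rightarrow> dual_space"
  show "(\<lambda>k \<psi>. dual_of_tuple \<omega> (axis k \<psi>)) = \<omega>"
  proof (intro ext)
    fix k \<psi>
    have "\<omega> j (axis k \<psi> $ j) = (if j = k then \<omega> k \<psi> else 0)" for j
      using \<omega> by (auto simp: axis_def dual_space_def Pi_iff intro!: linear_0)
    then show "dual_of_tuple \<omega> (axis k \<psi>) = \<omega> k \<psi>" by (simp add: dual_of_tuple_def)
  qed
next
  fix \<eta> :: "schwartz ^ 'd \<Rightarrow> real" assume "\<eta> \<in> dual_space"
  then have lin: "linear \<eta>" by (simp add: dual_space_def)
  show "dual_of_tuple (\<lambda>k \<psi>. \<eta> (axis k \<psi>)) = \<eta>"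
  proof (rule ext)
    fix \<phi> :: "schwartz ^ 'd"
    have "(\<Sum>k\<in>UNIV. axis k (\<phi> $ k)) = \<phi>"
      by (simp add: vec_eq_iff axis_def)
    then show "dual_of_tuple (\<lambda>k \<psi>. \<eta> (axis k \<psi>)) \<phi> = \<eta> \<phi>"
      using linear_sum[OF lin, of "\<lambda>k. axis k (\<phi> $ k)" UNIV] by (simp add: dual_of_tuple_def)
  qed
qed

end

(* By uniqueness of characteristic functionals, mu is invariant under w |-> w o T for every L^2
   isometry T of the Schwartz space S, in particular under Householder reflections. Call a point of
   S' charged if all its strong neighbourhoods have positive measure. The charged points are
   closed and invariant under reflections. If w is charged and unbounded on the L^2 unit sphere,
   rotations by tiny angles that move a little of a huge coordinate w(u) into the direction of v
   converge strongly to the translation by v, so w + v is charged for every v in S. As S is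
   strongly dense in S', every point is charged as soon as one such w exists. Almost every point is
   charged; and if almost every w were L^2-bounded, w(e_k) would tend to 0 almost surely along an
   almost orthogonal sequence of Gaussians e_k of constant norm, which would force E_beta to be
   constant.

   Strong neighbourhoods are handled by means of a countable family of measurable sets that refines
   all of them: each seminorm of S is totally bounded on balls of the next one, so on equicontinuous
   sets the strong topology is determined by countably many evaluations. This also shows that
   strongly open sets are measurable, for S' and for its finite powers. *)

theory Submission
  imports Defs
begin

section \<open>Seminorms and the dual of the Schwartz space\<close>

text \<open>The strong dual is not first countable and a strong neighbourhood imposes uncountably
  many conditions, so a countable network, whose members need not be open, takes the place of a
  base. Translation by a test function is not induced by an isometry, hence the detour through
  rotations: with \<open>R = \<omega> u\<close> large, a rotation by an angle of order
  \<open>1 / R\<close> changes \<omega> by \<open>sinner v\<close> up to an error of order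
  \<open>1 / R\<close>, uniformly on L^2-bounded sets, and bounded sets of test functions are
  L^2-bounded. Two features of the Mittag-Leffler function enter: the characteristic functional
  depends on \<phi> only through its L^2 norm, and it is not constant. The compactness expressed by
  \<open>ehrling\<close> is used twice. It yields the finite nets behind the network, and it yields
  density: up to a remainder that is small on a given bounded set, a functional is a finite
  combination of derivatives at points, and these are limits of difference quotients and of narrow
  Gaussians.\<close>

definition sderiv :: "nat \<Rightarrow> schwartz \<Rightarrow> real \<Rightarrow> real" where
  "sderiv n \<phi> = (deriv ^^ n) (schwartz_fun \<phi>)"

lemma sderiv_0: "sderiv 0 \<phi> = schwartz_fun \<phi>"
  by (simp add: sderiv_def)

lemma schwartz_fun_smooth: "(deriv ^^ n) (schwartz_fun \<phi>) differentiable (at x)"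
  using schwartz_fun[of \<phi>] by (simp add: schwartz_functions_def)

lemma has_real_derivative_sderiv [derivative_intros]:
  "(sderiv n \<phi> has_real_derivative sderiv (Suc n) \<phi> x) (at x within A)"
  by (rule has_field_derivative_at_within)
     (simp add: sderiv_def schwartz_fun_smooth DERIV_deriv_iff_real_differentiable)

lemma continuous_on_sderiv: "continuous_on A (sderiv n \<phi>)"
  using has_real_derivative_sderiv by (intro DERIV_continuous_on)

lemma borel_measurable_sderiv [measurable]: "sderiv n \<phi> \<in> borel_measurable borel"
  by (intro borel_measurable_continuous_onI continuous_on_sderiv)

lemma borel_measurable_schwartz_fun [measurable]: "schwartz_fun \<phi> \<in> borel_measurable borel"
  using borel_measurable_sderiv[of 0 \<phi>] by (simp add: sderiv_0)

lemma sderiv_add: "sderiv n (\<phi> + \<psi>) x = sderiv n \<phi> x + sderiv n \<psi> x"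
  using higher_deriv_lincomb[OF schwartz_fun_smooth schwartz_fun_smooth, of n 1 \<phi> 1 \<psi>]
  by (simp add: sderiv_def plus_schwartz.rep_eq)

lemma sderiv_diff: "sderiv n (\<phi> - \<psi>) x = sderiv n \<phi> x - sderiv n \<psi> x"
  using higher_deriv_lincomb[OF schwartz_fun_smooth schwartz_fun_smooth, of n 1 \<phi> "-1" \<psi>]
  by (simp add: sderiv_def minus_schwartz.rep_eq)

lemma sderiv_scaleR: "sderiv n (c *\<^sub>R \<phi>) x = c * sderiv n \<phi> x"
  using higher_deriv_lincomb[OF schwartz_fun_smooth schwartz_fun_smooth, of n c \<phi> 0 \<phi>]
  by (simp add: sderiv_def scaleR_schwartz.rep_eq)

lemma bdd_above_schwartz: "bdd_above (range (\<lambda>x. \<bar>x ^ m * sderiv n \<phi> x\<bar>))"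
  using schwartz_fun[of \<phi>]
  by (auto simp: schwartz_functions_def sderiv_def bounded_iff bdd_above_def image_iff)

lemma le_schwartz_seminorm: "\<bar>x ^ m * sderiv n \<phi> x\<bar> \<le> schwartz_seminorm m n \<phi>"
  unfolding schwartz_seminorm_def
  using cSUP_upper[OF UNIV_I bdd_above_schwartz[of m n \<phi>]] by (simp add: sderiv_def)

lemma schwartz_seminorm_le:
  "(\<And>x. \<bar>x ^ m * sderiv n \<phi> x\<bar> \<le> c) \<Longrightarrow> schwartz_seminorm m n \<phi> \<le> c"
  unfolding schwartz_seminorm_def by (rule cSUP_least) (auto simp: sderiv_def)

lemma schwartz_seminorm_nonneg [simp]: "0 \<le> schwartz_seminorm m n \<phi>"
  using le_schwartz_seminorm[of 0 m n \<phi>] by linarith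

lemma schwartz_seminorm_triangle:
  "schwartz_seminorm m n (\<phi> + \<psi>) \<le> schwartz_seminorm m n \<phi> + schwartz_seminorm m n \<psi>"
proof (rule schwartz_seminorm_le)
  fix x
  show "\<bar>x ^ m * sderiv n (\<phi> + \<psi>) x\<bar> \<le> schwartz_seminorm m n \<phi> + schwartz_seminorm m n \<psi>"
    using le_schwartz_seminorm[of x m n \<phi>] le_schwartz_seminorm[of x m n \<psi>]
    by (simp add: sderiv_add distrib_left)
qed

lemma schwartz_seminorm_scaleR_le:
  "schwartz_seminorm m n (c *\<^sub>R \<phi>) \<le> \<bar>c\<bar> * schwartz_seminorm m n \<phi>"
proof (rule schwartz_seminorm_le)
  fix x
  have "\<bar>c\<bar> * \<bar>x ^ m * sderiv n \<phi> x\<bar> \<le> \<bar>c\<bar> * schwartz_seminorm m n \<phi>"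
    by (intro mult_left_mono le_schwartz_seminorm) simp
  then show "\<bar>x ^ m * sderiv n (c *\<^sub>R \<phi>) x\<bar> \<le> \<bar>c\<bar> * schwartz_seminorm m n \<phi>"
    by (simp add: sderiv_scaleR abs_mult mult_ac)
qed

text \<open>Summing finitely many seminorms gives an increasing sequence that defines the same
  topology, so that openness, continuity and boundedness are each tested with a single
  index.\<close>

definition snorm :: "nat \<Rightarrow> schwartz \<Rightarrow> real" where
  "snorm N \<phi> = (\<Sum>m\<le>N. \<Sum>n\<le>N. schwartz_seminorm m n \<phi>)"

lemma snorm_nonneg [simp]: "0 \<le> snorm N \<phi>"
  by (simp add: snorm_def sum_nonneg)

lemma snorm_triangle: "snorm N (\<phi> + \<psi>) \<le> snorm N \<phi> + snorm N \<psi>"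
  unfolding snorm_def sum.distrib[symmetric] by (intro sum_mono schwartz_seminorm_triangle)

lemma snorm_scaleR_le: "snorm N (c *\<^sub>R \<phi>) \<le> \<bar>c\<bar> * snorm N \<phi>"
  unfolding snorm_def sum_distrib_left by (intro sum_mono schwartz_seminorm_scaleR_le)

lemma snorm_zero [simp]: "snorm N 0 = 0"
  using snorm_scaleR_le[of N 0 0] snorm_nonneg[of N 0] by simp

lemma snorm_scaleR: "snorm N (c *\<^sub>R \<phi>) = \<bar>c\<bar> * snorm N \<phi>"
proof (cases "c = 0")
  case False
  have "\<bar>c\<bar> * snorm N \<phi> = \<bar>c\<bar> * snorm N (inverse c *\<^sub>R c *\<^sub>R \<phi>)"
    using False by simp
  also have "\<dots> \<le> \<bar>c\<bar> * (\<bar>inverse c\<bar> * snorm N (c *\<^sub>R \<phi>))"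
    by (intro mult_left_mono snorm_scaleR_le) simp
  also have "\<dots> = snorm N (c *\<^sub>R \<phi>)"
    using False by (simp add: abs_mult[symmetric] mult.assoc[symmetric])
  finally show ?thesis using snorm_scaleR_le[of N c \<phi>] by linarith
qed simp

lemma snorm_minus_commute: "snorm N (\<phi> - \<psi>) = snorm N (\<psi> - \<phi>)"
  using snorm_scaleR[of N "-1" "\<phi> - \<psi>"] by simp

lemma snorm_triangle_diff: "snorm N (\<phi> - \<psi>) \<le> snorm N \<phi> + snorm N \<psi>"
  using snorm_triangle[of N \<phi> "- \<psi>"] snorm_scaleR[of N "-1" \<psi>] by simp

lemma snorm_triangle_sub: "snorm N \<phi> \<le> snorm N \<psi> + snorm N (\<phi> - \<psi>)"
  using snorm_triangle[of N \<psi> "\<phi> - \<psi>"] by simp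

lemma schwartz_seminorm_le_snorm:
  assumes "m \<le> N" "n \<le> N"
  shows "schwartz_seminorm m n \<phi> \<le> snorm N \<phi>"
proof -
  have "schwartz_seminorm m n \<phi> \<le> (\<Sum>n\<le>N. schwartz_seminorm m n \<phi>)"
    using assms by (intro member_le_sum) auto
  also have "\<dots> \<le> snorm N \<phi>"
    unfolding snorm_def using assms by (intro member_le_sum) (auto intro: sum_nonneg)
  finally show ?thesis .
qed

lemma abs_sderiv_le_snorm:
  assumes "m \<le> N" "n \<le> N"
  shows "\<bar>x ^ m * sderiv n \<phi> x\<bar> \<le> snorm N \<phi>"
  using le_schwartz_seminorm schwartz_seminorm_le_snorm[OF assms] by (rule order_trans)

lemma snorm_mono:
  assumes "N \<le> M"
  shows "snorm N \<phi> \<le> snorm M \<phi>"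
proof -
  have "snorm N \<phi> \<le> (\<Sum>m\<le>N. \<Sum>n\<le>M. schwartz_seminorm m n \<phi>)"
    unfolding snorm_def using assms by (intro sum_mono sum_mono2) auto
  also have "\<dots> \<le> snorm M \<phi>"
    unfolding snorm_def using assms by (intro sum_mono2) (auto intro: sum_nonneg)
  finally show ?thesis .
qed

lemma open_schwartz_snorm:
  "open U \<longleftrightarrow> (\<forall>\<phi>\<in>U. \<exists>N. \<exists>\<epsilon>>0. \<forall>\<psi>. snorm N (\<psi> - \<phi>) < \<epsilon> \<longrightarrow> \<psi> \<in> U)"
  unfolding open_schwartz_def
proof (rule ball_cong[OF refl], rule ex_cong1, rule iffI)
  fix \<phi> N
  assume "\<exists>\<epsilon>>0. \<forall>\<psi>. (\<forall>m\<le>N. \<forall>n\<le>N. schwartz_seminorm m n (\<psi> - \<phi>) < \<epsilon>) \<longrightarrow> \<psi> \<in> U"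
  then show "\<exists>\<epsilon>>0. \<forall>\<psi>. snorm N (\<psi> - \<phi>) < \<epsilon> \<longrightarrow> \<psi> \<in> U"
    using schwartz_seminorm_le_snorm by (meson order_le_less_trans)
next
  fix \<phi> N
  assume "\<exists>\<epsilon>>0. \<forall>\<psi>. snorm N (\<psi> - \<phi>) < \<epsilon> \<longrightarrow> \<psi> \<in> U"
  then obtain \<epsilon> where \<epsilon>: "\<epsilon> > 0" "\<And>\<psi>. snorm N (\<psi> - \<phi>) < \<epsilon> \<Longrightarrow> \<psi> \<in> U" by blast
  \<comment> \<open>The number of pairs \<open>(m, n)\<close> in the sum: if each seminorm is below
    \<open>\<epsilon> / K\<close>, their sum is below \<epsilon>.\<close>
  define K where "K = real ((N + 1) * (N + 1))"
  have K: "K > 0" unfolding K_def of_nat_0_less_iff by simp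
  have sum_K: "(\<Sum>m\<le>N. \<Sum>n\<le>N. d) = K * d" for d by (simp add: K_def algebra_simps)
  let ?\<delta> = "\<epsilon> / K"
  have "\<psi> \<in> U" if "\<forall>m\<le>N. \<forall>n\<le>N. schwartz_seminorm m n (\<psi> - \<phi>) < ?\<delta>" for \<psi>
  proof (rule \<epsilon>)
    have "snorm N (\<psi> - \<phi>) < (\<Sum>m\<le>N. \<Sum>n\<le>N. ?\<delta>)"
      unfolding snorm_def using that by (intro sum_strict_mono) auto
    also have "\<dots> = K * ?\<delta>" by (rule sum_K)
    also have "\<dots> = \<epsilon>" using K by simp
    finally show "snorm N (\<psi> - \<phi>) < \<epsilon>" .
  qed
  moreover have "?\<delta> > 0" using \<epsilon> K by simp
  ultimately show "\<exists>\<epsilon>>0. \<forall>\<psi>. (\<forall>m\<le>N. \<forall>n\<le>N. schwartz_seminorm m n (\<psi> - \<phi>) < \<epsilon>) \<longrightarrow> \<psi> \<in> U"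
    by blast
qed

lemma open_snorm_ball: "open {\<psi>. snorm N (\<psi> - \<phi>) < r}"
  unfolding open_schwartz_snorm
proof
  fix \<theta> assume "\<theta> \<in> {\<psi>. snorm N (\<psi> - \<phi>) < r}"
  moreover have "snorm N (\<psi> - \<phi>) \<le> snorm N (\<psi> - \<theta>) + snorm N (\<theta> - \<phi>)" for \<psi>
    using snorm_triangle[of N "\<psi> - \<theta>" "\<theta> - \<phi>"] by simp
  ultimately show "\<exists>N'. \<exists>\<epsilon>>0. \<forall>\<psi>. snorm N' (\<psi> - \<theta>) < \<epsilon> \<longrightarrow> \<psi> \<in> {\<psi>. snorm N (\<psi> - \<phi>) < r}"
    by (intro exI[of _ N] exI[of _ "r - snorm N (\<theta> - \<phi>)"]) (auto, smt (verit))
qed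

section \<open>Continuous functionals and bounded sets in terms of \<open>snorm\<close>\<close>

lemma dual_space_linear: "\<omega> \<in> dual_space \<Longrightarrow> linear \<omega>"
  by (simp add: dual_space_def)

lemma dual_space_snormI:
  assumes "linear \<omega>" and bound: "\<And>\<phi>. \<bar>\<omega> \<phi>\<bar> \<le> C * snorm N \<phi>"
  shows "\<omega> \<in> dual_space"
proof -
  have "continuous_on UNIV \<omega>"
    unfolding continuous_on_open_vimage[OF open_UNIV]
  proof (intro allI impI)
    fix S :: "real set" assume S: "open S"
    show "open (\<omega> -` S \<inter> UNIV)"
      unfolding open_schwartz_snorm
    proof
      fix \<phi> assume "\<phi> \<in> \<omega> -` S \<inter> UNIV"
      then obtain e where e: "e > 0" "ball (\<omega> \<phi>) e \<subseteq> S"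
        using S by (auto simp: open_contains_ball)
      have "\<psi> \<in> \<omega> -` S" if *: "snorm N (\<psi> - \<phi>) < e / (\<bar>C\<bar> + 1)" for \<psi>
      proof -
        have "\<bar>\<omega> \<psi> - \<omega> \<phi>\<bar> = \<bar>\<omega> (\<psi> - \<phi>)\<bar>" using assms(1) by (simp add: linear_diff)
        also have "\<dots> \<le> C * snorm N (\<psi> - \<phi>)" by (rule bound)
        also have "\<dots> \<le> (\<bar>C\<bar> + 1) * snorm N (\<psi> - \<phi>)"
          by (intro mult_right_mono) auto
        also have "\<dots> < e" using * by (simp add: pos_less_divide_eq mult.commute)
        finally show ?thesis using e by (auto simp: dist_real_def subset_iff)
      qed
      then show "\<exists>N. \<exists>\<epsilon>>0. \<forall>\<psi>. snorm N (\<psi> - \<phi>) < \<epsilon> \<longrightarrow> \<psi> \<in> \<omega> -` S \<inter> UNIV"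
        using e by (intro exI[of _ N] exI[of _ "e / (\<bar>C\<bar> + 1)"]) auto
    qed
  qed
  with assms show ?thesis by (simp add: dual_space_def)
qed

lemma dual_space_snormE:
  assumes "\<omega> \<in> dual_space"
  obtains N C where "C > 0" "\<And>\<phi>. \<bar>\<omega> \<phi>\<bar> \<le> C * snorm N \<phi>"
proof -
  have lin: "linear \<omega>" and cont: "continuous_on UNIV \<omega>" using assms by (auto simp: dual_space_def)
  have "open (\<omega> -` {-1<..<1})" by (rule open_vimage[OF open_greaterThanLessThan cont])
  moreover have "0 \<in> \<omega> -` {-1<..<1}" using lin by (simp add: linear_0)
  ultimately obtain N \<epsilon> where \<epsilon>: "\<epsilon> > 0" "\<And>\<psi>. snorm N \<psi> < \<epsilon> \<Longrightarrow> \<bar>\<omega> \<psi>\<bar> < 1"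
    using bspec[OF iffD1[OF open_schwartz_snorm] \<open>0 \<in> \<omega> -` {-1<..<1}\<close>]
    by (auto simp: abs_less_iff)
  have "\<bar>\<omega> \<phi>\<bar> \<le> inverse \<epsilon> * snorm N \<phi>" for \<phi>
  proof -
    \<comment> \<open>The slack \<delta> keeps the scaling factor well defined when
      \<open>snorm N \<phi>\<close> is 0.\<close>
    have "\<epsilon> * \<bar>\<omega> \<phi>\<bar> \<le> snorm N \<phi> + \<delta>" if "\<delta> > 0" for \<delta>
    proof -
      let ?a = "snorm N \<phi> + \<delta>"
      have a: "?a > 0" using that snorm_nonneg[of N \<phi>] by linarith
      have "snorm N ((\<epsilon> / ?a) *\<^sub>R \<phi>) = \<epsilon> * (snorm N \<phi> / ?a)"
        using a \<epsilon> by (simp add: snorm_scaleR)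
      also have "\<dots> < \<epsilon> * 1"
        using a that by (intro mult_strict_left_mono \<epsilon>) (simp add: divide_less_eq)
      finally have "\<bar>\<omega> ((\<epsilon> / ?a) *\<^sub>R \<phi>)\<bar> < 1" by (intro \<epsilon>) simp
      then show ?thesis using a \<epsilon> lin by (simp add: linear_scale abs_mult field_simps)
    qed
    then have "\<epsilon> * \<bar>\<omega> \<phi>\<bar> \<le> snorm N \<phi>" by (rule field_le_epsilon)
    then show ?thesis using \<epsilon> by (simp add: field_simps)
  qed
  then show thesis using \<epsilon> that[of "inverse \<epsilon>" N] by simp
qed

lemma dual_space_lincomb:
  assumes "\<omega> \<in> dual_space" "\<eta> \<in> (dual_space :: ('a::{real_vector,topological_space} \<Rightarrow> real) set)"
  shows "(\<lambda>\<phi>. a * \<omega> \<phi> + b * \<eta> \<phi>) \<in> dual_space"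
  using assms unfolding dual_space_def
  by (auto intro!: linearI continuous_intros simp: linear_add linear_scale algebra_simps)

text \<open>The balls of the \<open>snorm N\<close> around 0 form a neighbourhood base there, so
  absorption by every neighbourhood amounts to a bound in each of these seminorms.\<close>

lemma tvs_bounded_snorm_iff: "tvs_bounded B \<longleftrightarrow> (\<forall>N. \<exists>k. \<forall>\<phi>\<in>B. snorm N \<phi> \<le> k)"
proof safe
  fix N assume B: "tvs_bounded B"
  have "open {\<psi>. snorm N \<psi> < 1}" using open_snorm_ball[of N 0 1] by simp
  then obtain r where r: "r > 0" "\<forall>t\<ge>r. B \<subseteq> (*\<^sub>R) t ` {\<psi>. snorm N \<psi> < 1}"
    using B unfolding tvs_bounded_def by (metis (mono_tags) mem_Collect_eq snorm_zero zero_less_one)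
  then have "B \<subseteq> (*\<^sub>R) r ` {\<psi>. snorm N \<psi> < 1}" by blast
  then have "snorm N \<phi> \<le> r" if "\<phi> \<in> B" for \<phi>
    using that r(1) by (auto simp: snorm_scaleR subset_iff image_iff)
  then show "\<exists>k. \<forall>\<phi>\<in>B. snorm N \<phi> \<le> k" by blast
next
  assume *: "\<forall>N. \<exists>k. \<forall>\<phi>\<in>B. snorm N \<phi> \<le> k"
  show "tvs_bounded B"
    unfolding tvs_bounded_def
  proof (intro allI impI)
    fix V :: "schwartz set" assume "open V" "0 \<in> V"
    then obtain N \<epsilon> where \<epsilon>: "\<epsilon> > 0" "\<And>\<psi>. snorm N \<psi> < \<epsilon> \<Longrightarrow> \<psi> \<in> V"
      using bspec[OF iffD1[OF open_schwartz_snorm] \<open>0 \<in> V\<close>] by auto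
    obtain k where k: "\<And>\<phi>. \<phi> \<in> B \<Longrightarrow> snorm N \<phi> \<le> k" using * by blast
    define r where "r = (\<bar>k\<bar> + 1) / \<epsilon>"
    have "r > 0" using \<epsilon> by (simp add: r_def)
    moreover have "B \<subseteq> (*\<^sub>R) t ` V" if "t \<ge> r" for t
    proof
      fix \<phi> assume "\<phi> \<in> B"
      have t: "t > 0" using that \<open>r > 0\<close> by simp
      have "snorm N \<phi> < \<bar>k\<bar> + 1" using k[OF \<open>\<phi> \<in> B\<close>] by linarith
      also have "\<dots> = r * \<epsilon>" using \<epsilon> by (simp add: r_def)
      also have "\<dots> \<le> t * \<epsilon>" using that \<epsilon> by (intro mult_right_mono) auto
      finally have "snorm N (inverse t *\<^sub>R \<phi>) < \<epsilon>"
        using t by (simp add: snorm_scaleR field_simps)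
      then have "inverse t *\<^sub>R \<phi> \<in> V" by (rule \<epsilon>)
      then show "\<phi> \<in> (*\<^sub>R) t ` V" using t by (intro image_eqI[of _ _ "inverse t *\<^sub>R \<phi>"]) auto
    qed
    ultimately show "\<exists>r>0. \<forall>t\<ge>r. B \<subseteq> (*\<^sub>R) t ` V" by blast
  qed
qed

lemma tvs_boundedE:
  assumes "tvs_bounded B"
  obtains k where "k > 0" "\<And>\<phi>. \<phi> \<in> B \<Longrightarrow> snorm N \<phi> \<le> k"
proof -
  obtain k where k: "\<forall>\<phi>\<in>B. snorm N \<phi> \<le> k" using assms tvs_bounded_snorm_iff by blast
  show thesis by (rule that[of "\<bar>k\<bar> + 1"]) (use k in fastforce)+
qed

section \<open>The inner product and an interpolation inequality\<close>

definition sinner :: "schwartz \<Rightarrow> schwartz \<Rightarrow> real" where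
  "sinner \<phi> \<psi> = (LINT x|lborel. schwartz_fun \<phi> x * schwartz_fun \<psi> x)"

text \<open>Adding the bounds for the weights 1 and x^2 gives an integrable majorant. This is where
  the index 2 in the L^2 estimates comes from.\<close>

lemma schwartz_fun_bound: "\<bar>schwartz_fun \<phi> x\<bar> \<le> 2 * snorm 2 \<phi> * inverse (1 + x\<^sup>2)"
proof -
  have "\<bar>x ^ 0 * sderiv 0 \<phi> x\<bar> \<le> snorm 2 \<phi>" "\<bar>x ^ 2 * sderiv 0 \<phi> x\<bar> \<le> snorm 2 \<phi>"
    by (intro abs_sderiv_le_snorm; simp)+
  then have "\<bar>schwartz_fun \<phi> x\<bar> * (1 + x\<^sup>2) \<le> 2 * snorm 2 \<phi>"
    by (simp add: sderiv_0 abs_mult algebra_simps)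
  moreover have "1 + x\<^sup>2 > 0" by (simp add: add_pos_nonneg)
  ultimately show ?thesis by (simp add: field_simps)
qed

lemma schwartz_fun_le_snorm: "\<bar>schwartz_fun \<phi> x\<bar> \<le> snorm N \<phi>"
  using abs_sderiv_le_snorm[of 0 N 0 x \<phi>] by (simp add: sderiv_0)

lemma integrable_inverse_one_plus_square: "integrable lborel (\<lambda>x::real. inverse (1 + x\<^sup>2))"
  using integrable_inverse_1_plus_square by (simp add: set_integrable_def)

lemma schwartz_mult_bound:
  "\<bar>schwartz_fun \<phi> x * schwartz_fun \<psi> x\<bar> \<le> 2 * snorm 2 \<phi> * snorm 2 \<psi> * inverse (1 + x\<^sup>2)"
proof -
  have "\<bar>schwartz_fun \<phi> x * schwartz_fun \<psi> x\<bar> \<le> (2 * snorm 2 \<phi> * inverse (1 + x\<^sup>2)) * snorm 2 \<psi>"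
    unfolding abs_mult
    by (intro mult_mono schwartz_fun_bound schwartz_fun_le_snorm) (auto simp: add_nonneg_nonneg)
  then show ?thesis by (simp add: mult_ac)
qed

lemma integrable_schwartz_mult: "integrable lborel (\<lambda>x. schwartz_fun \<phi> x * schwartz_fun \<psi> x)"
  by (rule Bochner_Integration.integrable_bound
        [OF integrable_mult_right[OF integrable_inverse_one_plus_square, of "2 * snorm 2 \<phi> * snorm 2 \<psi>"]])
     (auto simp: abs_mult intro!: AE_I2 order_trans[OF _ schwartz_mult_bound, simplified abs_mult]
        order_trans[OF schwartz_mult_bound abs_ge_self, unfolded abs_mult])

lemma sinner_commute: "sinner \<phi> \<psi> = sinner \<psi> \<phi>"
  by (simp add: sinner_def mult.commute)

lemma sinner_add_left: "sinner (\<phi> + \<theta>) \<psi> = sinner \<phi> \<psi> + sinner \<theta> \<psi>"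
  unfolding sinner_def plus_schwartz.rep_eq distrib_right
  by (intro Bochner_Integration.integral_add integrable_schwartz_mult)

lemma sinner_scaleR_left: "sinner (c *\<^sub>R \<phi>) \<psi> = c * sinner \<phi> \<psi>"
  by (simp add: sinner_def scaleR_schwartz.rep_eq mult.assoc)

lemma sinner_add_right: "sinner \<psi> (\<phi> + \<theta>) = sinner \<psi> \<phi> + sinner \<psi> \<theta>"
  using sinner_add_left by (simp add: sinner_commute)

lemma sinner_scaleR_right: "sinner \<psi> (c *\<^sub>R \<phi>) = c * sinner \<psi> \<phi>"
  using sinner_scaleR_left by (simp add: sinner_commute)

lemma sinner_diff_left: "sinner (\<phi> - \<theta>) \<psi> = sinner \<phi> \<psi> - sinner \<theta> \<psi>"
  using sinner_add_left[of \<phi> "-1 *\<^sub>R \<theta>"] sinner_scaleR_left[of "-1" \<theta>] by simp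

lemma sinner_diff_right: "sinner \<psi> (\<phi> - \<theta>) = sinner \<psi> \<phi> - sinner \<psi> \<theta>"
  using sinner_diff_left by (simp add: sinner_commute)

lemma linear_sinner: "linear (sinner \<phi>)"
  by (auto intro!: linearI simp: sinner_add_right sinner_scaleR_right)

lemmas sinner_simps = sinner_add_left sinner_add_right sinner_scaleR_left sinner_scaleR_right
  sinner_diff_left sinner_diff_right

lemma sinner_ge_0 [simp]: "0 \<le> sinner \<phi> \<phi>"
  by (simp add: sinner_def)

lemma sinner_Cauchy_Schwarz: "(sinner \<phi> \<psi>)\<^sup>2 \<le> sinner \<phi> \<phi> * sinner \<psi> \<psi>"
proof (cases "sinner \<psi> \<psi> = 0")
  case True
  have "sinner \<phi> \<psi> = 0"
  proof (rule ccontr)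
    assume *: "sinner \<phi> \<psi> \<noteq> 0"
    \<comment> \<open>If \<psi> is a null vector, the quadratic form is affine in the coefficient of
      \<psi>; this coefficient would bring it to -1.\<close>
    let ?t = "(sinner \<phi> \<phi> + 1) / (2 * sinner \<phi> \<psi>)"
    have "0 \<le> sinner (\<phi> - ?t *\<^sub>R \<psi>) (\<phi> - ?t *\<^sub>R \<psi>)" by simp
    also have "\<dots> = sinner \<phi> \<phi> - 2 * ?t * sinner \<phi> \<psi>"
      using True by (simp add: sinner_simps sinner_commute[of \<psi> \<phi>])
    also have "\<dots> = -1" using * by (simp add: field_simps)
    finally show False by simp
  qed
  then show ?thesis using True by simp
next
  case False
  then have pos: "sinner \<psi> \<psi> > 0" using sinner_ge_0[of \<psi>] by linarith
  let ?t = "sinner \<phi> \<psi> / sinner \<psi> \<psi>"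
  have "0 \<le> sinner (\<phi> - ?t *\<^sub>R \<psi>) (\<phi> - ?t *\<^sub>R \<psi>)" by simp
  also have "\<dots> = sinner \<phi> \<phi> - (sinner \<phi> \<psi>)\<^sup>2 / sinner \<psi> \<psi>"
    using pos by (simp add: sinner_simps sinner_commute[of \<psi> \<phi>] power2_eq_square field_simps)
  finally show ?thesis using pos by (simp add: field_simps)
qed

definition l2norm :: "schwartz \<Rightarrow> real" where
  "l2norm \<phi> = sqrt (sinner \<phi> \<phi>)"

lemma l2norm_nonneg [simp]: "0 \<le> l2norm \<phi>"
  by (simp add: l2norm_def)

lemma l2norm_power2: "(l2norm \<phi>)\<^sup>2 = sinner \<phi> \<phi>"
  by (simp add: l2norm_def)

lemma abs_sinner_le: "\<bar>sinner \<phi> \<psi>\<bar> \<le> l2norm \<phi> * l2norm \<psi>"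
  using real_sqrt_le_mono[OF sinner_Cauchy_Schwarz[of \<phi> \<psi>]] by (simp add: l2norm_def real_sqrt_mult)

definition l2_const :: real where
  "l2_const = sqrt (2 * (LINT x|lborel. inverse (1 + x\<^sup>2)))"

lemma l2norm_le_snorm: "l2norm \<phi> \<le> l2_const * snorm 2 \<phi>"
proof -
  have "sinner \<phi> \<phi> \<le> (LINT x|lborel. 2 * snorm 2 \<phi> * snorm 2 \<phi> * inverse (1 + x\<^sup>2))"
    unfolding sinner_def
    by (intro integral_mono integrable_schwartz_mult integrable_mult_right
          integrable_inverse_one_plus_square order_trans[OF abs_ge_self schwartz_mult_bound])
  also have "\<dots> = (2 * (LINT x|lborel. inverse (1 + x\<^sup>2))) * (snorm 2 \<phi>)\<^sup>2"
    by (simp add: power2_eq_square)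
  finally have "sqrt (sinner \<phi> \<phi>) \<le> sqrt \<dots>" by (rule real_sqrt_le_mono)
  then show ?thesis by (simp add: l2norm_def l2_const_def real_sqrt_mult)
qed

lemma sinner_in_dual: "sinner \<phi> \<in> dual_space"
proof (rule dual_space_snormI[OF linear_sinner])
  fix \<psi>
  have "\<bar>sinner \<phi> \<psi>\<bar> \<le> l2norm \<phi> * (l2_const * snorm 2 \<psi>)"
    by (rule order_trans[OF abs_sinner_le mult_left_mono[OF l2norm_le_snorm]]) simp
  then show "\<bar>sinner \<phi> \<psi>\<bar> \<le> (l2norm \<phi> * l2_const) * snorm 2 \<psi>" by (simp add: mult_ac)
qed

lemma tvs_bounded_l2normE:
  assumes "tvs_bounded B"
  obtains k where "k > 0" "\<And>\<phi>. \<phi> \<in> B \<Longrightarrow> l2norm \<phi> \<le> k"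
proof -
  obtain k where k: "k > 0" "\<And>\<phi>. \<phi> \<in> B \<Longrightarrow> snorm 2 \<phi> \<le> k"
    using tvs_boundedE[OF assms, of 2] by blast
  have c: "l2_const \<ge> 0" by (simp add: l2_const_def)
  have "l2norm \<phi> \<le> l2_const * k + 1" if "\<phi> \<in> B" for \<phi>
    using l2norm_le_snorm[of \<phi>] mult_left_mono[OF k(2)[OF that] c] by linarith
  moreover have "l2_const * k + 1 > 0" using c k by (simp add: add_nonneg_pos)
  ultimately show thesis using that by blast
qed

section \<open>Compactness of the inclusions between the seminorms\<close>

lemma sderiv_lipschitz:
  assumes "n < M"
  shows "\<bar>sderiv n \<phi> x - sderiv n \<phi> y\<bar> \<le> snorm M \<phi> * \<bar>x - y\<bar>"
proof -
  have "norm (sderiv n \<phi> x - sderiv n \<phi> y) \<le> snorm M \<phi> * norm (x - y)"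
  proof (rule field_differentiable_bound[of UNIV])
    show "(sderiv n \<phi> has_field_derivative sderiv (Suc n) \<phi> z) (at z within UNIV)" for z
      by (rule has_real_derivative_sderiv)
    show "norm (sderiv (Suc n) \<phi> z) \<le> snorm M \<phi>" for z
      using abs_sderiv_le_snorm[of 0 M "Suc n" z \<phi>] assms by simp
  qed auto
  then show ?thesis by simp
qed

text \<open>An Ehrling-type inequality; it expresses that the inclusion of \<open>snorm (Suc N)\<close> into
  \<open>snorm N\<close> is compact. Outside \<open>[- R, R]\<close> the extra weight gains a factor \<open>1 / R\<close>, inside the
  extra derivative controls the distance to a grid point.\<close>

lemma ehrling:
  fixes N :: nat
  assumes "\<epsilon> > 0"
  obtains G :: "(nat \<times> real) set" and M where "finite G" "M > 0" "\<And>n x. (n, x) \<in> G \<Longrightarrow> n \<le> N"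
    "\<And>\<phi>. snorm N \<phi> \<le> \<epsilon> * snorm (Suc N) \<phi> + M * (\<Sum>(n, x)\<in>G. \<bar>sderiv n \<phi> x\<bar>)"
proof -
  define K where "K = real ((N + 1) * (N + 1))"
  have K: "K > 0" unfolding K_def of_nat_0_less_iff by simp
  have sum_K: "(\<Sum>m\<le>N. \<Sum>n\<le>N. d) = K * d" for d by (simp add: K_def algebra_simps)
  \<comment> \<open>Beyond \<open>R\<close> the extra power of x gains at least the factor
    \<open>\<epsilon> / K\<close>, where \<open>K\<close> counts the seminorms summed in
    \<open>snorm N\<close>.\<close>
  define R where "R = max 1 (K / \<epsilon>)"
  have R: "R \<ge> 1" "R \<ge> K / \<epsilon>" by (auto simp: R_def)
  \<comment> \<open>The grid width satisfies \<open>R ^ N * h = \<epsilon> / K\<close>, so the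
    Lipschitz error multiplied by the largest weight inside \<open>[- R, R]\<close> is no worse than
    the error outside.\<close>
  define h where "h = \<epsilon> / (K * R ^ N)"
  have h: "h > 0" using assms K R by (simp add: h_def)
  define J where "J = \<lceil>R / h\<rceil>"
  define G where "G = {..N} \<times> (\<lambda>j. real_of_int j * h) ` {- J..J}"
  have fin: "finite G" by (simp add: G_def)
  define S where "S \<phi> = (\<Sum>(n, x)\<in>G. \<bar>sderiv n \<phi> x\<bar>)" for \<phi>
  have S_ge: "\<bar>sderiv n \<phi> x\<bar> \<le> S \<phi>" if "(n, x) \<in> G" for n x \<phi>
    unfolding S_def using member_le_sum[of "(n, x)" G "\<lambda>(n, x). \<bar>sderiv n \<phi> x\<bar>"] fin that by auto
  have S_nonneg: "S \<phi> \<ge> 0" for \<phi> unfolding S_def by (intro sum_nonneg) auto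
  have main: "schwartz_seminorm m n \<phi> \<le> \<epsilon> / K * snorm (Suc N) \<phi> + R ^ N * S \<phi>"
    if mn: "m \<le> N" "n \<le> N" for m n \<phi>
  proof (rule schwartz_seminorm_le)
    fix x
    let ?P = "snorm (Suc N) \<phi>"
    show "\<bar>x ^ m * sderiv n \<phi> x\<bar> \<le> \<epsilon> / K * ?P + R ^ N * S \<phi>"
    proof (cases "\<bar>x\<bar> \<ge> R")
      case True
      have "\<bar>x ^ Suc m * sderiv n \<phi> x\<bar> \<le> ?P" using mn by (intro abs_sderiv_le_snorm) auto
      then have *: "\<bar>x\<bar> * \<bar>x ^ m * sderiv n \<phi> x\<bar> \<le> ?P" by (simp add: abs_mult mult_ac)
      have "K / \<epsilon> * \<bar>x ^ m * sderiv n \<phi> x\<bar> \<le> \<bar>x\<bar> * \<bar>x ^ m * sderiv n \<phi> x\<bar>"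
        using True R by (intro mult_right_mono) auto
      with * have "K / \<epsilon> * \<bar>x ^ m * sderiv n \<phi> x\<bar> \<le> ?P" by linarith
      then have "\<bar>x ^ m * sderiv n \<phi> x\<bar> \<le> \<epsilon> / K * ?P" using K assms by (simp add: field_simps)
      moreover have "R ^ N * S \<phi> \<ge> 0" using R S_nonneg by simp
      ultimately show ?thesis by linarith
    next
      case False
      define j where "j = \<lfloor>x / h\<rfloor>"
      define y where "y = real_of_int j * h"
      have y: "y \<le> x" "x - y \<le> h"
      proof -
        have "real_of_int j \<le> x / h" "x / h \<le> real_of_int j + 1" unfolding j_def by linarith+
        with h show "y \<le> x" "x - y \<le> h" by (simp_all add: y_def field_simps)
      qed
      have "x / h \<le> R / h" "- (R / h) \<le> x / h"
        using False h by (auto simp: field_simps abs_if split: if_splits)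
      then have "j \<in> {- J..J}"
        unfolding j_def J_def by (auto simp: le_floor_iff ) linarith+
      then have "(n, y) \<in> G" using mn by (auto simp: G_def y_def)
      have "\<bar>sderiv n \<phi> x - sderiv n \<phi> y\<bar> \<le> ?P * \<bar>x - y\<bar>"
        using mn by (intro sderiv_lipschitz) simp
      also have "\<dots> \<le> ?P * h" using y by (intro mult_left_mono) auto
      finally have d: "\<bar>sderiv n \<phi> x\<bar> \<le> S \<phi> + ?P * h"
        using S_ge[OF \<open>(n, y) \<in> G\<close>, of \<phi>] by linarith
      have "\<bar>x\<bar> ^ m \<le> R ^ m" using False by (intro power_mono) auto
      also have "\<dots> \<le> R ^ N" using R mn by (intro power_increasing) auto
      finally have "\<bar>x ^ m * sderiv n \<phi> x\<bar> \<le> R ^ N * (S \<phi> + ?P * h)"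
        unfolding abs_mult power_abs using d R by (intro mult_mono) auto
      also have "\<dots> = \<epsilon> / K * ?P + R ^ N * S \<phi>"
        using R K by (simp add: h_def field_simps)
      finally show ?thesis .
    qed
  qed
  show thesis
  proof (rule that)
    show "finite G" by fact
    show "n \<le> N" if "(n, x) \<in> G" for n x using that by (auto simp: G_def)
    show "K * R ^ N > 0" using K R by simp
    show "snorm N \<phi> \<le> \<epsilon> * snorm (Suc N) \<phi> + K * R ^ N * (\<Sum>(n, x)\<in>G. \<bar>sderiv n \<phi> x\<bar>)" for \<phi>
    proof -
      have "snorm N \<phi> \<le> (\<Sum>m\<le>N. \<Sum>n\<le>N. \<epsilon> / K * snorm (Suc N) \<phi> + R ^ N * S \<phi>)"
        unfolding snorm_def[of N] by (intro sum_mono main) auto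
      also have "\<dots> = K * (\<epsilon> / K * snorm (Suc N) \<phi> + R ^ N * S \<phi>)"
        by (rule sum_K)
      also have "\<dots> = \<epsilon> * snorm (Suc N) \<phi> + K * R ^ N * S \<phi>"
        using K by (simp add: distrib_left)
      finally show ?thesis by (simp add: S_def)
    qed
  qed
qed

section \<open>A countable measurable network of the strong dual\<close>

text \<open>On a ball of \<open>snorm (Suc N)\<close>, the distance in \<open>snorm N\<close> is
  controlled, up to a small error, by finitely many derivative values, which are bounded. Rounding
  these values leaves finitely many classes, and one representative of each class forms the
  net.\<close>

lemma snorm_totally_bounded:
  fixes N :: nat and k :: real
  assumes "\<epsilon> > 0"
  obtains F where "finite F" "\<And>\<phi>. snorm (Suc N) \<phi> \<le> k \<Longrightarrow> \<exists>f\<in>F. snorm N (\<phi> - f) < \<epsilon>"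
proof -
  \<comment> \<open>Two points of the ball differ by at most \<open>2 * \<bar>k\<bar> + 2\<close> in
    \<open>snorm (Suc N)\<close>, so the first term of the Ehrling bound is at most
    \<open>\<epsilon> / 2\<close>. The mesh \<delta> below makes the second at most
    \<open>\<epsilon> / 4\<close>.\<close>
  define e where "e = \<epsilon> / (4 * (\<bar>k\<bar> + 1))"
  have e: "e > 0" using assms by (simp add: e_def)
  obtain G M where G: "finite G" "M > 0" "\<And>n x. (n, x) \<in> G \<Longrightarrow> n \<le> N"
    and E: "\<And>\<phi>. snorm N \<phi> \<le> e * snorm (Suc N) \<phi> + M * (\<Sum>(n, x)\<in>G. \<bar>sderiv n \<phi> x\<bar>)"
    using ehrling[OF e, of N] by blast
  \<comment> \<open>The summand 1 keeps the divisor in \<delta> positive also for empty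
    \<open>G\<close>.\<close>
  define a where "a = real (card G) + 1"
  have a: "a > 0" by (simp add: a_def add_nonneg_pos)
  define \<delta> where "\<delta> = \<epsilon> / (4 * M * a)"
  have \<delta>: "\<delta> > 0" using assms G a by (simp add: \<delta>_def)
  define A where "A = {\<phi>. snorm (Suc N) \<phi> \<le> k}"
  define c where "c \<phi> = restrict (\<lambda>(n, x). \<lfloor>sderiv n \<phi> x / \<delta>\<rfloor>) G" for \<phi>
  have "c ` A \<subseteq> G \<rightarrow>\<^sub>E {- \<lceil>k / \<delta>\<rceil> - 1..\<lceil>k / \<delta>\<rceil>}"
  proof (intro image_subsetI PiE_I)
    fix \<phi> g assume "\<phi> \<in> A" "g \<in> G"
    obtain n x where g: "g = (n, x)" by (cases g)
    have "\<bar>sderiv n \<phi> x\<bar> \<le> k"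
      using abs_sderiv_le_snorm[of 0 "Suc N" n x \<phi>] G(3)[of n x] \<open>g \<in> G\<close> \<open>\<phi> \<in> A\<close> g
      by (simp add: A_def)
    then have "sderiv n \<phi> x / \<delta> \<le> k / \<delta>" "- (k / \<delta>) \<le> sderiv n \<phi> x / \<delta>"
      using \<delta> by (auto simp: field_simps abs_if split: if_splits)
    then have "\<lfloor>sderiv n \<phi> x / \<delta>\<rfloor> \<in> {- \<lceil>k / \<delta>\<rceil> - 1..\<lceil>k / \<delta>\<rceil>}"
      by (auto simp: le_floor_iff) linarith+
    then show "c \<phi> g \<in> {- \<lceil>k / \<delta>\<rceil> - 1..\<lceil>k / \<delta>\<rceil>}"
      using \<open>g \<in> G\<close> by (simp add: c_def g)
  qed (simp add: c_def)
  then have fin: "finite (c ` A)"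
    by (rule finite_subset) (use G(1) in \<open>auto intro: finite_PiE\<close>)
  show thesis
  proof (rule that)
    show "finite (inv_into A c ` (c ` A))" using fin by simp
    fix \<phi> assume \<phi>: "snorm (Suc N) \<phi> \<le> k"
    then have "\<phi> \<in> A" by (simp add: A_def)
    define f where "f = inv_into A c (c \<phi>)"
    have "f \<in> A" unfolding f_def using \<open>\<phi> \<in> A\<close> by (intro inv_into_into) auto
    have "c f = c \<phi>" unfolding f_def using \<open>\<phi> \<in> A\<close> by (intro f_inv_into_f) auto
    have "\<bar>sderiv n (\<phi> - f) x\<bar> \<le> \<delta>" if "(n, x) \<in> G" for n x
    proof -
      have "\<lfloor>sderiv n f x / \<delta>\<rfloor> = \<lfloor>sderiv n \<phi> x / \<delta>\<rfloor>"
        using fun_cong[OF \<open>c f = c \<phi>\<close>, of "(n, x)"] that by (simp add: c_def)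
      then have "\<bar>sderiv n \<phi> x / \<delta> - sderiv n f x / \<delta>\<bar> \<le> 1" by linarith
      then show ?thesis
        using \<delta> by (simp add: sderiv_diff diff_divide_distrib[symmetric] abs_divide)
    qed
    then have "(\<Sum>(n, x)\<in>G. \<bar>sderiv n (\<phi> - f) x\<bar>) \<le> (\<Sum>g\<in>G. \<delta>)"
      by (intro sum_mono) auto
    then have "M * (\<Sum>(n, x)\<in>G. \<bar>sderiv n (\<phi> - f) x\<bar>) \<le> M * (card G * \<delta>)"
      using G by (intro mult_left_mono) auto
    also have "\<dots> \<le> M * (a * \<delta>)"
      using G \<delta> by (intro mult_left_mono mult_right_mono) (auto simp: a_def)
    also have "\<dots> = \<epsilon> / 4"
      using G a by (simp add: \<delta>_def)
    finally have 1: "M * (\<Sum>(n, x)\<in>G. \<bar>sderiv n (\<phi> - f) x\<bar>) \<le> \<epsilon> / 4" .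
    have "snorm (Suc N) (\<phi> - f) \<le> 2 * \<bar>k\<bar> + 2"
      using snorm_triangle_diff[of "Suc N" \<phi> f] \<open>\<phi> \<in> A\<close> \<open>f \<in> A\<close> by (auto simp: A_def)
    then have "e * snorm (Suc N) (\<phi> - f) \<le> e * (2 * \<bar>k\<bar> + 2)"
      using e by (intro mult_left_mono) auto
    also have "\<dots> = \<epsilon> / 2" by (simp add: e_def field_simps)
    finally have "snorm N (\<phi> - f) < \<epsilon>"
      using E[of "\<phi> - f"] 1 assms by linarith
    moreover have "f \<in> inv_into A c ` (c ` A)" using \<open>\<phi> \<in> A\<close> by (auto simp: f_def)
    ultimately show "\<exists>f\<in>inv_into A c ` (c ` A). snorm N (\<phi> - f) < \<epsilon>" by blast
  qed
qed

lemma schwartz_nets: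
  obtains F :: "nat \<Rightarrow> nat \<Rightarrow> nat \<Rightarrow> schwartz set" where "\<And>N k j. finite (F N k j)"
    "\<And>N k j \<phi>. snorm (Suc N) \<phi> \<le> real k \<Longrightarrow> \<exists>f\<in>F N k j. snorm N (\<phi> - f) < 1 / Suc j"
proof -
  have "\<exists>F. finite F \<and> (\<forall>\<phi>. snorm (Suc N) \<phi> \<le> real k \<longrightarrow> (\<exists>f\<in>F. snorm N (\<phi> - f) < 1 / Suc j))"
    for N k j
    using snorm_totally_bounded[of "1 / Suc j" N "real k"] by (metis of_nat_0_less_iff zero_less_Suc zero_less_divide_1_iff)
  then have "\<exists>F. \<forall>N k j. finite (F N k j) \<and>
      (\<forall>\<phi>. snorm (Suc N) \<phi> \<le> real k \<longrightarrow> (\<exists>f\<in>F N k j. snorm N (\<phi> - f) < 1 / Suc j))"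
    by metis
  then show thesis using that by blast
qed

text \<open>One number serves as order and as constant. Both bounds weaken as it grows, so these
  countably many equicontinuous sets cover the dual.\<close>

definition equicont :: "nat \<Rightarrow> (schwartz \<Rightarrow> real) set" where
  "equicont N = {\<omega> \<in> dual_space. \<forall>\<phi>. \<bar>\<omega> \<phi>\<bar> \<le> real N * snorm N \<phi>}"

lemma dual_space_equicont:
  assumes "\<omega> \<in> dual_space"
  obtains N where "\<omega> \<in> equicont N"
proof -
  obtain N C where C: "C > 0" "\<And>\<phi>. \<bar>\<omega> \<phi>\<bar> \<le> C * snorm N \<phi>"
    using dual_space_snormE[OF assms] by blast
  define M where "M = max N (nat \<lceil>C\<rceil>)"
  have M: "N \<le> M" "C \<le> real M" using C(1) by (auto simp: M_def) linarith
  have "\<bar>\<omega> \<phi>\<bar> \<le> real M * snorm M \<phi>" for \<phi>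
    by (rule order_trans[OF C(2)]) (use M C(1) snorm_mono in \<open>auto intro!: mult_mono\<close>)
  then show thesis using that[of M] assms by (simp add: equicont_def)
qed

text \<open>Testing on a countable dense set makes \<open>equicont N\<close> measurable. A
  functional known to be bounded only on \<open>D\<close> still satisfies some bound of an unknown
  order \<open>M\<close> by continuity; approximating in \<open>snorm L\<close> with
  \<open>L = max M N\<close> lets the bound on \<open>D\<close> pass to the limit.\<close>

lemma equicont_dense:
  assumes D: "\<And>\<phi> N \<epsilon>. \<epsilon> > 0 \<Longrightarrow> \<exists>f\<in>D. snorm N (\<phi> - f) < \<epsilon>"
  shows "equicont N = {\<omega> \<in> dual_space. \<forall>f\<in>D. \<bar>\<omega> f\<bar> \<le> real N * snorm N f}"
proof (intro equalityI subsetI)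
  fix \<omega> assume *: "\<omega> \<in> {\<omega> \<in> dual_space. \<forall>f\<in>D. \<bar>\<omega> f\<bar> \<le> real N * snorm N f}"
  then have lin: "linear \<omega>" by (simp add: dual_space_linear)
  obtain M where M: "\<omega> \<in> equicont M" using dual_space_equicont * by blast
  define L where "L = max M N"
  have "\<bar>\<omega> \<phi>\<bar> \<le> real N * snorm N \<phi>" for \<phi>
  proof (rule field_le_epsilon)
    fix e :: real assume e: "e > 0"
    obtain f where f: "f \<in> D" "snorm L (\<phi> - f) < e / (real M + real N + 1)"
      using D[of "e / (real M + real N + 1)" L \<phi>] e by (auto simp: add_pos_nonneg)
    have fM: "snorm M (\<phi> - f) \<le> snorm L (\<phi> - f)" "snorm N (\<phi> - f) \<le> snorm L (\<phi> - f)"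
      by (auto simp: L_def intro!: snorm_mono)
    have "\<bar>\<omega> \<phi>\<bar> \<le> \<bar>\<omega> f\<bar> + \<bar>\<omega> (\<phi> - f)\<bar>" using lin by (simp add: linear_diff)
    also have "\<bar>\<omega> (\<phi> - f)\<bar> \<le> real M * snorm L (\<phi> - f)"
      using M fM by (auto simp: equicont_def intro: order_trans[OF _ mult_left_mono])
    also have "\<bar>\<omega> f\<bar> \<le> real N * snorm N f" using * f by blast
    also have "\<dots> \<le> real N * (snorm N \<phi> + snorm L (\<phi> - f))"
      using snorm_triangle_sub[of N f \<phi>] fM snorm_minus_commute[of N f \<phi>]
      by (intro mult_left_mono) auto
    finally have "\<bar>\<omega> \<phi>\<bar> \<le> real N * snorm N \<phi> + (real M + real N) * snorm L (\<phi> - f)"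
      by (simp add: algebra_simps)
    also have "(real M + real N) * snorm L (\<phi> - f) \<le> (real M + real N + 1) * snorm L (\<phi> - f)"
      by (intro mult_right_mono) auto
    also have "\<dots> \<le> e" using f e by (simp add: pos_less_divide_eq mult.commute add_pos_nonneg)
    finally show "\<bar>\<omega> \<phi>\<bar> \<le> real N * snorm N \<phi> + e" by simp
  qed
  then show "\<omega> \<in> equicont N" using * by (simp add: equicont_def)
qed (auto simp: equicont_def)

text \<open>Inside \<open>equicont N\<close> it suffices to control a functional on a finite net of
  \<open>B\<close> for \<open>snorm N\<close>: the common bound carries closeness from the net to
  all of \<open>B\<close>. Membership in \<open>equicont N\<close> is part of each cell, so cells
  need not be open.\<close>

lemma countable_network:
  obtains \<C> where "countable \<C>" "\<C> \<subseteq> sets cylinder_algebra"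
    "\<And>\<omega> B \<epsilon>. \<lbrakk>\<omega> \<in> dual_space; tvs_bounded B; \<epsilon> > 0\<rbrakk> \<Longrightarrow>
       \<exists>C\<in>\<C>. \<omega> \<in> C \<and> C \<subseteq> {\<eta> \<in> dual_space. \<forall>\<phi>\<in>B. \<bar>\<eta> \<phi> - \<omega> (\<phi> :: schwartz)\<bar> < \<epsilon>}"
proof -
  obtain F :: "nat \<Rightarrow> nat \<Rightarrow> nat \<Rightarrow> schwartz set" where finF: "\<And>N k j. finite (F N k j)"
    and F: "\<And>N k j \<phi>. snorm (Suc N) \<phi> \<le> real k \<Longrightarrow> \<exists>f\<in>F N k j. snorm N (\<phi> - f) < 1 / Suc j"
    using schwartz_nets by blast
  define D where "D = (\<Union>N k j. F N k j)"
  have cD: "countable D" unfolding D_def by (intro countable_UN countableI_type countable_finite[OF finF])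
  have dense: "\<exists>f\<in>D. snorm N (\<phi> - f) < \<epsilon>" if "\<epsilon> > 0" for N \<phi> \<epsilon>
  proof -
    obtain j where j: "1 / Suc j < \<epsilon>" using \<open>\<epsilon> > 0\<close> reals_Archimedean
      by (metis inverse_eq_divide)
    obtain k where "snorm (Suc N) \<phi> \<le> real k" using real_arch_simple by blast
    then obtain f where "f \<in> F N k j" "snorm N (\<phi> - f) < 1 / Suc j" using F by blast
    with j show ?thesis by (intro bexI[of _ f]) (auto simp: D_def)
  qed
  have eq: "equicont N = {\<omega> \<in> dual_space. \<forall>f\<in>D. \<bar>\<omega> f\<bar> \<le> real N * snorm N f}" for N
    by (rule equicont_dense[OF dense])
  note [measurable] = measurable_cylinder_eval
  have "{\<omega> \<in> space cylinder_algebra. \<forall>f\<in>D. \<bar>\<omega> f\<bar> \<le> real N * snorm N f} \<in> sets cylinder_algebra" for N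
    by (rule sets.sets_Collect_countable_All'[OF _ cD]) measurable
  then have meas_eq: "equicont N \<in> sets cylinder_algebra" for N
    by (simp add: eq)
  define cell where "cell N l = equicont N \<inter>
      {\<omega> \<in> space cylinder_algebra. \<forall>(f, a, b)\<in>set l. real_of_rat a < \<omega> f \<and> \<omega> f < real_of_rat b}"
    for N and l :: "(schwartz \<times> rat \<times> rat) list"
  have cell_meas: "cell N l \<in> sets cylinder_algebra" for N l
    unfolding cell_def
  proof (rule sets.Int[OF meas_eq sets.sets_Collect_countable_All'[OF _ countable_finite[OF finite_set]]])
    fix i :: "schwartz \<times> rat \<times> rat"
    obtain f a b where i: "i = (f, a, b)" by (cases i)
    show "{\<omega> \<in> space cylinder_algebra. case i of (f, a, b) \<Rightarrow> real_of_rat a < \<omega> f \<and> \<omega> f < real_of_rat b}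
        \<in> sets cylinder_algebra"
      unfolding i prod.case by measurable
  qed
  \<comment> \<open>Countable, since the points range over the countable set \<open>D\<close>, the
    interval ends over the rationals, and only finite lists of constraints occur.\<close>
  define \<C> where "\<C> = (\<lambda>(N, l). cell N l) ` (UNIV \<times> lists (D \<times> UNIV \<times> UNIV))"
  show thesis
  proof (rule that)
    show "countable \<C>" unfolding \<C>_def
      by (intro countable_image countable_SIGMA countable_lists cD) auto
    show "\<C> \<subseteq> sets cylinder_algebra" using cell_meas by (auto simp: \<C>_def)
    fix \<omega> :: "schwartz \<Rightarrow> real" and B :: "schwartz set" and \<epsilon> :: real
    assume \<omega>: "\<omega> \<in> dual_space" and B: "tvs_bounded B" and e: "\<epsilon> > 0"
    \<comment> \<open>\<open>N\<close> is fixed by \<omega> before \<open>B\<close> is measured: the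
      net of \<open>B\<close> must be fine in \<open>snorm N\<close>, which takes a bound on
      \<open>B\<close> in \<open>snorm (Suc N)\<close>.\<close>
    obtain N where N: "\<omega> \<in> equicont N" using dual_space_equicont \<omega> by blast
    obtain k0 where k0: "\<And>\<phi>. \<phi> \<in> B \<Longrightarrow> snorm (Suc N) \<phi> \<le> k0" using tvs_boundedE[OF B] by metis
    obtain k where k: "k0 \<le> real k" using real_arch_simple by blast
    \<comment> \<open>With this mesh, both \<eta> and \<omega> change by less than
      \<open>\<epsilon> / 4\<close> between a point of \<open>B\<close> and its neighbour in the
      net; the rational intervals contribute another \<open>\<epsilon> / 4\<close>.\<close>
    have "\<epsilon> / (4 * (real N + 1)) > 0" using e by simp
    then obtain j where j: "1 / Suc j < \<epsilon> / (4 * (real N + 1))"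
      using reals_Archimedean by (metis inverse_eq_divide)
    have "\<exists>a b. \<omega> f - \<epsilon> / 4 < real_of_rat a \<and> real_of_rat a < \<omega> f \<and> \<omega> f < real_of_rat b \<and>
        real_of_rat b < \<omega> f + \<epsilon> / 4" for f
      using of_rat_dense[of "\<omega> f - \<epsilon> / 4" "\<omega> f"] of_rat_dense[of "\<omega> f" "\<omega> f + \<epsilon> / 4"] e by auto
    then obtain a b where ab: "\<And>f. \<omega> f - \<epsilon> / 4 < real_of_rat (a f)" "\<And>f. real_of_rat (a f) < \<omega> f"
      "\<And>f. \<omega> f < real_of_rat (b f)" "\<And>f. real_of_rat (b f) < \<omega> f + \<epsilon> / 4"
      by metis
    obtain fs where fs: "set fs = F N k j" using finite_list[OF finF] by blast
    define l where "l = map (\<lambda>f. (f, a f, b f)) fs"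
    have cancel: "r * (\<epsilon> / (4 * r)) = \<epsilon> / 4" if "r > 0" for r using that by simp
    show "\<exists>C\<in>\<C>. \<omega> \<in> C \<and> C \<subseteq> {\<eta> \<in> dual_space. \<forall>\<phi>\<in>B. \<bar>\<eta> \<phi> - \<omega> \<phi>\<bar> < \<epsilon>}"
    proof (intro bexI conjI subsetI)
      have "l \<in> lists (D \<times> UNIV \<times> UNIV)" using fs by (auto simp: l_def D_def) blast
      then show "cell N l \<in> \<C>" by (auto simp: \<C>_def)
      show "\<omega> \<in> cell N l" using N \<omega> ab by (auto simp: cell_def l_def)
      fix \<eta> assume \<eta>: "\<eta> \<in> cell N l"
      have d: "\<eta> \<in> dual_space" using \<eta> by (simp add: cell_def)
      have "\<bar>\<eta> \<phi> - \<omega> \<phi>\<bar> < \<epsilon>" if "\<phi> \<in> B" for \<phi>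
      proof -
        obtain f where f: "f \<in> F N k j" "snorm N (\<phi> - f) < 1 / Suc j"
          using F[of N \<phi> k j] k0[OF \<open>\<phi> \<in> B\<close>] k by force
        have "real N * snorm N (\<phi> - f) \<le> (real N + 1) * (1 / Suc j)"
          using f by (intro mult_mono) auto
        also have "\<dots> < (real N + 1) * (\<epsilon> / (4 * (real N + 1)))"
          using j by (intro mult_strict_left_mono) auto
        also have "\<dots> = \<epsilon> / 4" by (rule cancel) simp
        finally have small: "real N * snorm N (\<phi> - f) < \<epsilon> / 4" .
        have "\<bar>\<eta> (\<phi> - f)\<bar> < \<epsilon> / 4" "\<bar>\<omega> (\<phi> - f)\<bar> < \<epsilon> / 4"
          by (rule order_le_less_trans[OF _ small]; use \<eta> N in \<open>simp add: cell_def equicont_def\<close>)+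
        moreover have "\<bar>\<eta> f - \<omega> f\<bar> < \<epsilon> / 4"
        proof -
          have "real_of_rat (a f) < \<eta> f" "\<eta> f < real_of_rat (b f)"
            using \<eta> f fs by (auto simp: cell_def l_def)
          with ab(1,4)[of f] show ?thesis by linarith
        qed
        ultimately show ?thesis
          using linear_diff[OF dual_space_linear[OF d], of \<phi> f]
            linear_diff[OF dual_space_linear[OF \<omega>], of \<phi> f] e by linarith
      qed
      then show "\<eta> \<in> {\<eta> \<in> dual_space. \<forall>\<phi>\<in>B. \<bar>\<eta> \<phi> - \<omega> \<phi>\<bar> < \<epsilon>}" using d by simp
    qed
  qed
qed

section \<open>Uniqueness of characteristic functionals\<close>

text \<open>Positive weights can be normalised to probability densities, which brings the statement
  under the uniqueness theorem for characteristic functions of real laws. The range from 1 to 3 fits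
  weights of the form \<open>2 + Re F\<close> with F of norm at most 1.\<close>

lemma weighted_law_unique_pos:
  fixes X u :: "'a \<Rightarrow> real" and Y v :: "'b \<Rightarrow> real"
  assumes "prob_space M" "prob_space N"
    and [measurable]: "X \<in> borel_measurable M" "u \<in> borel_measurable M"
      "Y \<in> borel_measurable N" "v \<in> borel_measurable N" "A \<in> sets borel"
    and u: "\<And>x. 1 \<le> u x" "\<And>x. u x \<le> 3" and v: "\<And>y. 1 \<le> v y" "\<And>y. v y \<le> 3"
    and char_eq: "\<And>t. (CLINT x|M. u x *\<^sub>R iexp (t * X x)) = (CLINT y|N. v y *\<^sub>R iexp (t * Y y))"
  shows "(LINT x|M. u x * indicator A (X x)) = (LINT y|N. v y * indicator A (Y y))"
proof -
  define m where "m = (LINT x|M. u x)"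
  \<comment> \<open>At \<open>t = 0\<close> the hypothesis compares the total masses, so one
    constant \<open>m\<close> normalises both sides.\<close>
  have "(LINT x|M. u x) = (LINT y|N. v y)"
    using char_eq[of 0] by (simp add: scaleR_conv_of_real)
  then have m': "m = (LINT y|N. v y)" by (simp add: m_def)
  have law: "prob_space (density K (\<lambda>x. ennreal (w x / m))) \<and>
      char (distr (density K (\<lambda>x. ennreal (w x / m))) borel Z) t =
        (CLINT x|K. w x *\<^sub>R iexp (t * Z x)) / of_real m \<and>
      measure (distr (density K (\<lambda>x. ennreal (w x / m))) borel Z) A =
        (LINT x|K. w x * indicator A (Z x)) / m \<and> m > 0"
    if "prob_space K" and [measurable]: "Z \<in> borel_measurable K" "w \<in> borel_measurable K"
      and w: "\<And>x. 1 \<le> w x" "\<And>x. w x \<le> 3" and m: "m = (LINT x|K. w x)"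
    for K :: "'k measure" and Z w t
  proof -
    interpret K: prob_space K by fact
    let ?D = "density K (\<lambda>x. ennreal (w x / m))"
    have "\<bar>w x\<bar> \<le> 3" for x using w(1)[of x] w(2)[of x] by linarith
    then have int: "integrable K w"
      by (intro K.integrable_const_bound[of _ 3]) (auto intro!: AE_I2)
    have "m \<ge> 1"
      unfolding m using K.integral_ge_const[OF int, of 1] w by auto
    then have m0: "m > 0" by simp
    have pos: "0 \<le> w x / m" for x using w(1)[of x] m0 by simp
    have "emeasure ?D (space ?D) = (\<integral>\<^sup>+x. ennreal (w x / m) \<partial>K)"
      by (simp add: emeasure_density)
    also have "\<dots> = ennreal (LINT x|K. w x / m)"
      using int pos by (intro nn_integral_eq_integral) auto
    also have "\<dots> = 1" using m0 m by simp
    finally have P: "prob_space ?D" by (rule prob_spaceI)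
    have "char (distr ?D borel Z) t = (CLINT x|?D. iexp (t * Z x))"
      unfolding char_def by (subst integral_distr) auto
    also have "\<dots> = (CLINT x|K. (w x / m) *\<^sub>R iexp (t * Z x))"
      using pos by (subst integral_density) auto
    also have "\<dots> = (CLINT x|K. (w x *\<^sub>R iexp (t * Z x)) / of_real m)"
      by (simp add: scaleR_conv_of_real)
    also have "\<dots> = (CLINT x|K. w x *\<^sub>R iexp (t * Z x)) / of_real m"
      by simp
    finally have c: "char (distr ?D borel Z) t = \<dots>" .
    interpret D: prob_space ?D by (rule P)
    have "measure (distr ?D borel Z) A = (LINT x|distr ?D borel Z. indicator A x)"
      by simp
    also have "\<dots> = (LINT x|?D. indicator A (Z x))"
      by (subst integral_distr) auto
    also have "\<dots> = (LINT x|K. w x / m * indicator A (Z x))"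
      using pos by (subst integral_density) auto
    also have "\<dots> = (LINT x|K. w x * indicator A (Z x)) / m"
      by (subst integral_divide_zero[symmetric]) (simp add: field_simps)
    finally show ?thesis using P c m0 by blast
  qed
  note lM = law[OF assms(1) assms(3,4) u m_def]
  note lN = law[OF assms(2) assms(5,6) v m']
  have "distr (density M (\<lambda>x. ennreal (u x / m))) borel X =
        distr (density N (\<lambda>x. ennreal (v x / m))) borel Y"
  proof (rule Levy_uniqueness)
    show "real_distribution (distr (density M (\<lambda>x. ennreal (u x / m))) borel X)"
      using lM by (intro prob_space.real_distribution_distr) auto
    show "real_distribution (distr (density N (\<lambda>x. ennreal (v x / m))) borel Y)"
      using lN by (intro prob_space.real_distribution_distr) auto
    show "char (distr (density M (\<lambda>x. ennreal (u x / m))) borel X) =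
          char (distr (density N (\<lambda>x. ennreal (v x / m))) borel Y)"
      using lM lN char_eq by auto
  qed
  then show ?thesis using lM lN by (metis divide_cancel_right less_irrefl)
qed

text \<open>With weights \<open>W \<omega> = indicator C \<omega> * iexp (\<omega> \<psi>)\<close> for cylinder sets \<open>C\<close>, this reduces the
  uniqueness of characteristic functionals to the one-dimensional theorem, one factor at a time.\<close>

lemma weighted_law_unique:
  fixes X :: "'a \<Rightarrow> real" and Y :: "'b \<Rightarrow> real" and W :: "'a \<Rightarrow> complex" and V :: "'b \<Rightarrow> complex"
  assumes "prob_space M" "prob_space N"
    and [measurable]: "X \<in> borel_measurable M" "W \<in> borel_measurable M"
      "Y \<in> borel_measurable N" "V \<in> borel_measurable N" "A \<in> sets borel"
    and W: "\<And>x. norm (W x) \<le> 1" and V: "\<And>y. norm (V y) \<le> 1"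
    and char: "\<And>t. (CLINT x|M. iexp (t * X x)) = (CLINT y|N. iexp (t * Y y))"
    and charW: "\<And>t. (CLINT x|M. W x * iexp (t * X x)) = (CLINT y|N. V y * iexp (t * Y y))"
  shows "(CLINT x|M. W x * indicator A (X x)) = (CLINT y|N. V y * indicator A (Y y))"
proof -
  interpret M: prob_space M by fact
  interpret N: prob_space N by fact
  have intM: "integrable M (\<lambda>x. F x * iexp (t * X x))" "integrable M (\<lambda>x. F x * indicator A (X x))"
      "integrable M F"
    if [measurable]: "F \<in> borel_measurable M" and "\<And>x. norm (F x) \<le> 1" for F :: "'a \<Rightarrow> complex" and t
    using that(2) by (auto intro!: M.integrable_const_bound[of _ 1] AE_I2 simp: norm_mult indicator_def)
  have intN: "integrable N (\<lambda>x. F x * iexp (t * Y x))" "integrable N (\<lambda>x. F x * indicator A (Y x))"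
      "integrable N F"
    if [measurable]: "F \<in> borel_measurable N" and "\<And>x. norm (F x) \<le> 1" for F :: "'b \<Rightarrow> complex" and t
    using that(2) by (auto intro!: N.integrable_const_bound[of _ 1] AE_I2 simp: norm_mult indicator_def)
  have real_part: "(LINT x|M. Re (F x) * indicator A (X x)) = (LINT y|N. Re (G y) * indicator A (Y y))"
    if [measurable]: "F \<in> borel_measurable M" "G \<in> borel_measurable N"
      and F: "\<And>x. norm (F x) \<le> 1" and G: "\<And>y. norm (G y) \<le> 1"
      and FG: "\<And>t. (CLINT x|M. F x * iexp (t * X x)) = (CLINT y|N. G y * iexp (t * Y y))"
    for F G
  proof -
    have F': "\<bar>Re (F x)\<bar> \<le> 1" for x using abs_Re_le_cmod[of "F x"] F[of x] by linarith
    have G': "\<bar>Re (G y)\<bar> \<le> 1" for y using abs_Re_le_cmod[of "G y"] G[of y] by linarith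
    \<comment> \<open>Conjugation reverses the sign of \<open>t\<close>; hence the transform
      weighted by \<open>Re F\<close> is determined by the transform weighted by \<open>F\<close> at
      \<open>t\<close> and \<open>- t\<close>.\<close>
    have reM: "(CLINT x|M. of_real (Re (F x)) * iexp (t * X x)) =
        ((CLINT x|M. F x * iexp (t * X x)) + cnj (CLINT x|M. F x * iexp (- t * X x))) / 2" for t
    proof -
      have "(CLINT x|M. of_real (Re (F x)) * iexp (t * X x)) =
        (CLINT x|M. (F x * iexp (t * X x) + cnj (F x * iexp (- t * X x))) / 2)"
        by (intro Bochner_Integration.integral_cong refl)
           (simp add: exp_cnj complex_add_cnj flip: distrib_right)
      also have "\<dots> = ((CLINT x|M. F x * iexp (t * X x)) + (CLINT x|M. cnj (F x * iexp (- t * X x)))) / 2"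
        using intM(1)[OF that(1) F, of t] iffD2[OF complex_integrable_cnj intM(1)[OF that(1) F, of "- t"]]
        by (simp only: integral_divide_zero Bochner_Integration.integral_add)
      finally show ?thesis by (simp only: Bochner_Integration.integral_cnj)
    qed
    have reN: "(CLINT x|N. of_real (Re (G x)) * iexp (t * Y x)) =
        ((CLINT x|N. G x * iexp (t * Y x)) + cnj (CLINT x|N. G x * iexp (- t * Y x))) / 2" for t
    proof -
      have "(CLINT x|N. of_real (Re (G x)) * iexp (t * Y x)) =
        (CLINT x|N. (G x * iexp (t * Y x) + cnj (G x * iexp (- t * Y x))) / 2)"
        by (intro Bochner_Integration.integral_cong refl)
           (simp add: exp_cnj complex_add_cnj flip: distrib_right)
      also have "\<dots> = ((CLINT x|N. G x * iexp (t * Y x)) + (CLINT x|N. cnj (G x * iexp (- t * Y x)))) / 2"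
        using intN(1)[OF that(2) G, of t] iffD2[OF complex_integrable_cnj intN(1)[OF that(2) G, of "- t"]]
        by (simp only: integral_divide_zero Bochner_Integration.integral_add)
      finally show ?thesis by (simp only: Bochner_Integration.integral_cnj)
    qed
    have re_eq: "(CLINT x|M. of_real (Re (F x)) * iexp (t * X x)) =
        (CLINT x|N. of_real (Re (G x)) * iexp (t * Y x))" for t
      unfolding reM reN FG ..
    \<comment> \<open>Adding 2 makes the weight positive. Its contribution is removed afterwards by
      the case of constant weight 1.\<close>
    have "(LINT x|M. (2 + Re (F x)) * indicator A (X x)) = (LINT y|N. (2 + Re (G y)) * indicator A (Y y))"
    proof (rule weighted_law_unique_pos[OF assms(1,2)])
      show "1 \<le> 2 + Re (F x)" "2 + Re (F x) \<le> 3" for x using F'[of x] by linarith+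
      show "1 \<le> 2 + Re (G y)" "2 + Re (G y) \<le> 3" for y using G'[of y] by linarith+
      fix t
      have "(CLINT x|M. (2 + Re (F x)) *\<^sub>R iexp (t * X x)) =
          2 * (CLINT x|M. 1 * iexp (t * X x)) + (CLINT x|M. of_real (Re (F x)) * iexp (t * X x))"
        unfolding scaleR_conv_of_real of_real_add distrib_right
        by (subst Bochner_Integration.integral_add) (use intM(1)[of "\<lambda>_. 1" t] intM(1)[of "\<lambda>x. of_real (Re (F x))" t] F' in \<open>auto simp: mult.assoc\<close>)
      also have "\<dots> = 2 * (CLINT x|N. 1 * iexp (t * Y x)) + (CLINT x|N. of_real (Re (G x)) * iexp (t * Y x))"
        using char re_eq by simp
      also have "\<dots> = (CLINT x|N. (2 + Re (G x)) *\<^sub>R iexp (t * Y x))"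
        unfolding scaleR_conv_of_real of_real_add distrib_right
        by (subst Bochner_Integration.integral_add) (use intN(1)[of "\<lambda>_. 1" t] intN(1)[of "\<lambda>x. of_real (Re (G x))" t] G' in \<open>auto simp: mult.assoc\<close>)
      finally show "(CLINT x|M. (2 + Re (F x)) *\<^sub>R iexp (t * X x)) = (CLINT x|N. (2 + Re (G x)) *\<^sub>R iexp (t * Y x))" .
    qed measurable
    moreover have "(LINT x|M. (1::real) * indicator A (X x)) = (LINT y|N. (1::real) * indicator A (Y y))"
      by (rule weighted_law_unique_pos[OF assms(1,2), where u = "\<lambda>_. 1" and v = "\<lambda>_. 1"]) (use char in auto)
    moreover have "(LINT x|M. (2 + Re (F x)) * indicator A (X x)) =
        2 * (LINT x|M. (1::real) * indicator A (X x)) + (LINT x|M. Re (F x) * indicator A (X x))"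
      unfolding distrib_right
      by (subst Bochner_Integration.integral_add)
         (use F' in \<open>auto intro!: M.integrable_const_bound[of _ 2] AE_I2 simp: indicator_def intro: order_trans[of _ 1]\<close>)
    moreover have "(LINT x|N. (2 + Re (G x)) * indicator A (Y x)) =
        2 * (LINT x|N. (1::real) * indicator A (Y x)) + (LINT x|N. Re (G x) * indicator A (Y x))"
      unfolding distrib_right
      by (subst Bochner_Integration.integral_add)
         (use G' in \<open>auto intro!: N.integrable_const_bound[of _ 2] AE_I2 simp: indicator_def intro: order_trans[of _ 1]\<close>)
    ultimately show ?thesis by linarith
  qed
  have re: "(LINT x|M. Re (W x) * indicator A (X x)) = (LINT y|N. Re (V y) * indicator A (Y y))"
    by (rule real_part[OF _ _ W V charW]) measurable
  \<comment> \<open>Multiplication by \<open>- \<i>\<close> turns the imaginary part into the real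
    part.\<close>
  have "(LINT x|M. Re (- \<i> * W x) * indicator A (X x)) = (LINT y|N. Re (- \<i> * V y) * indicator A (Y y))"
    using W V charW by (intro real_part) (auto simp: norm_mult mult.assoc)
  then have im: "(LINT x|M. Im (W x) * indicator A (X x)) = (LINT y|N. Im (V y) * indicator A (Y y))"
    by simp
  have ind: "Re (z * indicator A r) = Re z * indicator A r" "Im (z * indicator A r) = Im z * indicator A r"
    for z and r :: real by (auto simp: indicator_def)
  have intW: "integrable M (\<lambda>x. W x * indicator A (X x))"
    and intV: "integrable N (\<lambda>y. V y * indicator A (Y y))"
    by (auto intro!: intM(2) intN(2) W V)
  show ?thesis
    using re im by (intro complex_eqI) (simp_all only: ind flip: integral_Re[OF intW] integral_Re[OF intV]
        integral_Im[OF intW] integral_Im[OF intV])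
qed

text \<open>Lists allow induction on the number of constraints, and concatenation of lists is
  intersection of sets, which gives a generator closed under intersection.\<close>

definition cylinder_set :: "('a::{real_vector,topological_space} \<times> real set) list \<Rightarrow> ('a \<Rightarrow> real) set" where
  "cylinder_set l = {\<omega> \<in> dual_space. \<forall>(\<phi>, A)\<in>set l. \<omega> \<phi> \<in> A}"

lemma cylinder_set_Nil: "cylinder_set [] = dual_space"
  by (simp add: cylinder_set_def)

lemma cylinder_set_Cons: "cylinder_set ((\<phi>, A) # l) = {\<omega> \<in> dual_space. \<omega> \<phi> \<in> A} \<inter> cylinder_set l"
  by (auto simp: cylinder_set_def)

lemma cylinder_set_append: "cylinder_set (l @ l') = cylinder_set l \<inter> cylinder_set l'"
  by (auto simp: cylinder_set_def)

lemma sets_cylinder_set: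
  assumes "\<forall>(\<phi>, A)\<in>set l. A \<in> sets borel"
  shows "cylinder_set l \<in> sets cylinder_algebra"
  using assms
proof (induction l)
  case Nil
  show ?case using sets.top[of cylinder_algebra] by (simp add: cylinder_set_Nil)
next
  case (Cons p l)
  obtain \<phi> A where p: "p = (\<phi>, A)" by (cases p)
  have [measurable]: "A \<in> sets borel" using Cons.prems by (simp add: p)
  note [measurable] = measurable_cylinder_eval
  have "{\<omega> \<in> space cylinder_algebra. \<omega> \<phi> \<in> A} \<in> sets cylinder_algebra" by measurable
  then show ?case using Cons by (auto simp: p cylinder_set_Cons)
qed

lemma sets_cylinder_algebra_eq:
  "sets (cylinder_algebra :: ('a::{real_vector,topological_space} \<Rightarrow> real) measure) =
     sigma_sets dual_space (cylinder_set ` {l. \<forall>(\<phi>, A)\<in>set l. A \<in> sets borel})"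
    (is "_ = sigma_sets _ ?E")
proof (rule antisym)
  have "sigma_sets dual_space {{\<omega> \<in> dual_space. \<omega> \<phi> \<in> A} |(\<phi>::'a) A. A \<in> sets borel} \<subseteq> sigma_sets dual_space ?E"
  proof (rule sigma_sets_mono', safe)
    fix \<phi> :: 'a and A :: "real set" assume "A \<in> sets borel"
    moreover have "{\<omega> \<in> dual_space. \<omega> \<phi> \<in> A} = cylinder_set [(\<phi>, A)]"
      by (auto simp: cylinder_set_def)
    ultimately show "{\<omega> \<in> dual_space. \<omega> \<phi> \<in> A} \<in> ?E" by auto
  qed
  then show "sets cylinder_algebra \<subseteq> sigma_sets dual_space ?E"
    unfolding cylinder_algebra_def by (subst sets_measure_of) auto
  have "?E \<subseteq> sets cylinder_algebra" using sets_cylinder_set by blast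
  then show "sigma_sets dual_space ?E \<subseteq> sets cylinder_algebra"
    using sets.sigma_sets_subset[of ?E cylinder_algebra] by simp
qed

theorem cylinder_measure_unique:
  fixes M N :: "('a::{real_vector,topological_space} \<Rightarrow> real) measure"
  assumes "prob_space M" "prob_space N"
    and setsM: "sets M = sets cylinder_algebra" and setsN: "sets N = sets cylinder_algebra"
    and char: "\<And>\<phi>. (CLINT \<omega>|M. iexp (\<omega> \<phi>)) = (CLINT \<omega>|N. iexp (\<omega> \<phi>))"
  shows "M = N"
proof -
  interpret M: prob_space M by fact
  interpret N: prob_space N by fact
  have spM: "space M = dual_space" using sets_eq_imp_space_eq[OF setsM] by simp
  have spN: "space N = dual_space" using sets_eq_imp_space_eq[OF setsN] by simp
  have evM [measurable]: "(\<lambda>\<omega>. \<omega> \<phi>) \<in> borel_measurable M" for \<phi>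
    using measurable_cylinder_eval[of \<phi>] measurable_cong_sets[OF setsM refl] by blast
  have evN [measurable]: "(\<lambda>\<omega>. \<omega> \<phi>) \<in> borel_measurable N" for \<phi>
    using measurable_cylinder_eval[of \<phi>] measurable_cong_sets[OF setsN refl] by blast
  \<comment> \<open>The free \<psi> is what makes the induction work: a further factor
    \<open>iexp (t * \<omega> \<phi>)\<close> is absorbed by replacing \<psi> with
    \<open>\<psi> + t *\<^sub>R \<phi>\<close>, so the transform in \<open>t\<close> is covered by
    the induction hypothesis.\<close>
  have key: "(CLINT \<omega>|M. indicator (cylinder_set l) \<omega> * iexp (\<omega> \<psi>)) =
      (CLINT \<omega>|N. indicator (cylinder_set l) \<omega> * iexp (\<omega> \<psi>))"
    if "\<forall>(\<phi>, A)\<in>set l. A \<in> sets borel" for l \<psi>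
    using that
  proof (induction l arbitrary: \<psi>)
    case Nil
    have "(CLINT \<omega>|K. indicator (cylinder_set []) \<omega> * iexp (\<omega> \<psi>)) = (CLINT \<omega>|K. iexp (\<omega> \<psi>))"
      if "space K = dual_space" for K :: "('a \<Rightarrow> real) measure"
      by (rule Bochner_Integration.integral_cong) (auto simp: cylinder_set_Nil that)
    then show ?case using char spM spN by simp
  next
    case (Cons p l)
    obtain \<phi> A where p: "p = (\<phi>, A)" by (cases p)
    have A: "A \<in> sets borel" and l: "\<forall>(\<phi>, A)\<in>set l. A \<in> sets borel" using Cons.prems by (auto simp: p)
    have [measurable]: "cylinder_set l \<in> sets M" "cylinder_set l \<in> sets N"
      using sets_cylinder_set[OF l] setsM setsN by auto
    let ?W = "\<lambda>\<omega>. indicator (cylinder_set l) \<omega> * iexp (\<omega> \<psi>)"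
    have shift: "(CLINT \<omega>|K. ?W \<omega> * iexp (t * \<omega> \<phi>)) =
        (CLINT \<omega>|K. indicator (cylinder_set l) \<omega> * iexp (\<omega> (\<psi> + t *\<^sub>R \<phi>)))"
      if "space K = dual_space" for K t
    proof (rule Bochner_Integration.integral_cong[OF refl])
      fix \<omega> assume "\<omega> \<in> space K"
      then have "linear \<omega>" using that by (simp add: dual_space_def)
      then show "?W \<omega> * iexp (t * \<omega> \<phi>) = indicator (cylinder_set l) \<omega> * iexp (\<omega> (\<psi> + t *\<^sub>R \<phi>))"
        by (simp add: linear_add linear_scale distrib_left exp_add mult_ac)
    qed
    have "(CLINT \<omega>|M. ?W \<omega> * indicator A (\<omega> \<phi>)) = (CLINT \<omega>|N. ?W \<omega> * indicator A (\<omega> \<phi>))"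
    proof (rule weighted_law_unique[OF assms(1,2)])
      show "(CLINT \<omega>|M. ?W \<omega> * iexp (t * \<omega> \<phi>)) = (CLINT \<omega>|N. ?W \<omega> * iexp (t * \<omega> \<phi>))" for t
        unfolding shift[OF spM] shift[OF spN] by (rule Cons.IH[OF l])
      have "(CLINT \<omega>|K. iexp (t * \<omega> \<phi>)) = (CLINT \<omega>|K. iexp (\<omega> (t *\<^sub>R \<phi>)))"
        if "space K = dual_space" for K t
        by (rule Bochner_Integration.integral_cong)
           (auto simp: that dual_space_def linear_scale)
      then show "(CLINT \<omega>|M. iexp (t * \<omega> \<phi>)) = (CLINT \<omega>|N. iexp (t * \<omega> \<phi>))" for t
        using char spM spN by simp
    qed (use A in \<open>auto simp: norm_mult indicator_def\<close>)
    moreover have "(CLINT \<omega>|K. indicator (cylinder_set (p # l)) \<omega> * iexp (\<omega> \<psi>)) =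
        (CLINT \<omega>|K. ?W \<omega> * indicator A (\<omega> \<phi>))"
      if "space K = dual_space" for K
      by (rule Bochner_Integration.integral_cong)
         (auto simp: that p cylinder_set_Cons indicator_def)
    ultimately show ?case using spM spN by simp
  qed
  have meas: "measure M (cylinder_set l) = measure N (cylinder_set l)"
    if l: "\<forall>(\<phi>, A)\<in>set l. A \<in> sets borel" for l
  proof -
    have sets: "cylinder_set l \<in> sets M" "cylinder_set l \<in> sets N"
      using sets_cylinder_set[OF l] setsM setsN by auto
    have lin0: "\<omega> 0 = 0" if "\<omega> \<in> dual_space" for \<omega> :: "'a \<Rightarrow> real"
      using that by (auto simp: dual_space_def linear_0)
    \<comment> \<open>The choice \<open>\<psi> = 0\<close> switches the exponential off and leaves
      the measure of the cylinder set.\<close>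
    have eq: "(CLINT \<omega>|K. indicator (cylinder_set l) \<omega> * iexp (\<omega> 0)) = of_real (measure K (cylinder_set l))"
      if "space K = dual_space" "cylinder_set l \<in> sets K" "prob_space K" for K
    proof -
      interpret K: prob_space K by fact
      have "(CLINT \<omega>|K. indicator (cylinder_set l) \<omega> * iexp (\<omega> 0)) =
          (CLINT \<omega>|K. of_real (indicator (cylinder_set l) \<omega>))"
        by (rule Bochner_Integration.integral_cong) (auto simp: that lin0 indicator_def)
      also have "\<dots> = of_real (LINT \<omega>|K. indicator (cylinder_set l) \<omega>)"
        by (rule integral_complex_of_real)
      also have "(LINT \<omega>|K. indicator (cylinder_set l) \<omega>) = measure K (cylinder_set l \<inter> space K)"
        by simp
      also have "cylinder_set l \<inter> space K = cylinder_set l"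
        using sets.sets_into_space[OF that(2)] by blast
      finally show ?thesis .
    qed
    show ?thesis using key[OF l, of 0] eq[OF spM] eq[OF spN] sets assms(1,2) by simp
  qed
  show ?thesis
  proof (rule measure_eqI_generator_eq)
    let ?E = "cylinder_set ` {l. \<forall>(\<phi>::'a, A)\<in>set l. A \<in> sets borel}"
    show "Int_stable ?E"
    proof (rule Int_stableI)
      fix a b assume "a \<in> ?E" "b \<in> ?E"
      then obtain l l' where "a = cylinder_set l" "b = cylinder_set l'"
        "\<forall>(\<phi>, A)\<in>set l. A \<in> sets borel" "\<forall>(\<phi>, A)\<in>set l'. A \<in> sets borel" by auto
      then show "a \<inter> b \<in> ?E"
        by (intro image_eqI[of _ _ "l @ l'"]) (auto simp: cylinder_set_append)
    qed
    show "?E \<subseteq> Pow dual_space" by (auto simp: cylinder_set_def)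
    show "sets M = sigma_sets dual_space ?E" "sets N = sigma_sets dual_space ?E"
      by (simp_all add: setsM setsN sets_cylinder_algebra_eq)
    show "emeasure M X = emeasure N X" if "X \<in> ?E" for X
      using that meas by (auto simp: M.emeasure_eq_measure N.emeasure_eq_measure)
    show "range (\<lambda>_::nat. dual_space) \<subseteq> ?E"
      by (auto intro!: image_eqI[of _ _ "[]"] simp: cylinder_set_Nil)
    show "(\<Union>i::nat. dual_space) = dual_space" by simp
    show "emeasure M dual_space \<noteq> \<infinity>" by simp
  qed
qed

text \<open>For linear \<omega> this is the composition of \<omega> with the Householder map that
  sends \<phi> to \<open>\<phi> - (2 * sinner u \<phi> / sinner u u) *\<^sub>R u\<close>. Written
  out, it is a combination of \<omega> and \<open>sinner u\<close>, which makes membership in the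
  dual evident.\<close>

definition reflect :: "schwartz \<Rightarrow> (schwartz \<Rightarrow> real) \<Rightarrow> (schwartz \<Rightarrow> real)" where
  "reflect u \<omega> = (\<lambda>\<phi>. \<omega> \<phi> - 2 * \<omega> u / sinner u u * sinner u \<phi>)"

lemma reflect_in_dual: "\<omega> \<in> dual_space \<Longrightarrow> reflect u \<omega> \<in> dual_space"
  using dual_space_lincomb[OF _ sinner_in_dual[of u], of \<omega> 1 "- (2 * \<omega> u / sinner u u)"]
  by (simp add: reflect_def)

lemma reflect_reflect: "sinner u u \<noteq> 0 \<Longrightarrow> reflect u (reflect u \<omega>) = \<omega>"
  by (rule ext) (simp add: reflect_def)

lemma measurable_reflect: "reflect u \<in> measurable cylinder_algebra cylinder_algebra"
  unfolding cylinder_algebra_def[where 'a = schwartz]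
proof (rule measurable_measure_of)
  show "reflect u \<in> space (sigma dual_space {{\<omega> \<in> dual_space. \<omega> \<phi> \<in> A} |\<phi> A. A \<in> sets borel}) \<rightarrow> dual_space"
    unfolding cylinder_algebra_def[symmetric] using reflect_in_dual by auto
  fix Y :: "(schwartz \<Rightarrow> real) set"
  assume "Y \<in> {{\<omega> \<in> dual_space. \<omega> \<phi> \<in> A} |\<phi> A. A \<in> sets borel}"
  then obtain \<phi> A where Y: "Y = {\<omega> \<in> dual_space. \<omega> \<phi> \<in> A}" and [measurable]: "A \<in> sets borel" by blast
  note [measurable] = measurable_cylinder_eval
  have "{\<omega> \<in> space cylinder_algebra. reflect u \<omega> \<phi> \<in> A} \<in> sets cylinder_algebra"
    unfolding reflect_def by measurable
  moreover have "reflect u -` Y \<inter> dual_space = {\<omega> \<in> space cylinder_algebra. reflect u \<omega> \<phi> \<in> A}"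
    using reflect_in_dual by (auto simp: Y)
  ultimately show "reflect u -` Y \<inter> space (sigma dual_space {{\<omega> \<in> dual_space. \<omega> \<phi> \<in> A} |\<phi> A. A \<in> sets borel})
      \<in> sets (sigma dual_space {{\<omega> \<in> dual_space. \<omega> \<phi> \<in> A} |\<phi> A. A \<in> sets borel})"
    unfolding cylinder_algebra_def[symmetric] by simp
qed auto

lemma distr_reflect:
  assumes ml: "is_mittag_leffler_measure \<beta> \<mu>" and u: "sinner u u \<noteq> 0"
  shows "distr \<mu> cylinder_algebra (reflect u) = \<mu>"
proof (rule cylinder_measure_unique)
  have P: "prob_space \<mu>" and sp: "space \<mu> = dual_space" and sets: "sets \<mu> = sets cylinder_algebra"
    and char: "\<And>\<phi>. (CLINT \<omega>|\<mu>. iexp (\<omega> \<phi>)) =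
      mittag_leffler \<beta> (complex_of_real (- (1/2) * sinner \<phi> \<phi>))"
    using ml by (auto simp: is_mittag_leffler_measure_def sinner_def power2_eq_square)
  interpret prob_space \<mu> by fact
  have meas: "reflect u \<in> measurable \<mu> cylinder_algebra"
    using measurable_reflect measurable_cong_sets[OF sets refl] by blast
  show "prob_space (distr \<mu> cylinder_algebra (reflect u))"
    using meas by (rule prob_space_distr)
  show "prob_space \<mu>" "sets \<mu> = sets cylinder_algebra" by fact+
  show "sets (distr \<mu> cylinder_algebra (reflect u)) = sets cylinder_algebra" by simp
  fix \<phi>
  note [measurable] = measurable_cylinder_eval
  let ?c = "2 * sinner u \<phi> / sinner u u"
  have "(CLINT \<omega>|distr \<mu> cylinder_algebra (reflect u). iexp (\<omega> \<phi>)) = (CLINT \<omega>|\<mu>. iexp (reflect u \<omega> \<phi>))"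
    by (rule integral_distr[OF meas]) measurable
  also have "\<dots> = (CLINT \<omega>|\<mu>. iexp (\<omega> (\<phi> - ?c *\<^sub>R u)))"
  proof (rule Bochner_Integration.integral_cong[OF refl])
    fix \<omega> assume "\<omega> \<in> space \<mu>"
    then have "linear \<omega>" by (simp add: sp dual_space_def)
    then have "\<omega> (\<phi> - ?c *\<^sub>R u) = reflect u \<omega> \<phi>"
      by (simp add: linear_diff linear_scale reflect_def)
    then show "iexp (reflect u \<omega> \<phi>) = iexp (\<omega> (\<phi> - ?c *\<^sub>R u))" by simp
  qed
  also have "\<dots> = mittag_leffler \<beta> (complex_of_real (- (1/2) * sinner (\<phi> - ?c *\<^sub>R u) (\<phi> - ?c *\<^sub>R u)))"
    by (rule char)
  also have "sinner (\<phi> - ?c *\<^sub>R u) (\<phi> - ?c *\<^sub>R u) = sinner \<phi> \<phi>"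
    using u by (simp add: sinner_simps sinner_commute[of \<phi> u] algebra_simps)
  also have "mittag_leffler \<beta> (complex_of_real (- (1/2) * sinner \<phi> \<phi>)) = (CLINT \<omega>|\<mu>. iexp (\<omega> \<phi>))"
    by (rule char[symmetric])
  finally show "(CLINT \<omega>|distr \<mu> cylinder_algebra (reflect u). iexp (\<omega> \<phi>)) = (CLINT \<omega>|\<mu>. iexp (\<omega> \<phi>))" .
qed

section \<open>Points charged by the measure\<close>

definition dual_nbhd :: "('a::{real_vector,topological_space} \<Rightarrow> real) \<Rightarrow> 'a set \<Rightarrow> real \<Rightarrow> ('a \<Rightarrow> real) set" where
  "dual_nbhd \<omega> B \<epsilon> = {\<eta> \<in> dual_space. \<forall>\<phi>\<in>B. \<bar>\<eta> \<phi> - \<omega> \<phi>\<bar> < \<epsilon>}"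

text \<open>Stated through measurable subsets of neighbourhoods, so that measurability of
  neighbourhoods is not an issue.\<close>

definition charged :: "(schwartz \<Rightarrow> real) measure \<Rightarrow> (schwartz \<Rightarrow> real) \<Rightarrow> bool" where
  "charged \<mu> \<omega> \<longleftrightarrow> \<omega> \<in> dual_space \<and> (\<forall>B \<epsilon>. tvs_bounded B \<longrightarrow> \<epsilon> > 0 \<longrightarrow>
     (\<exists>A\<in>sets cylinder_algebra. A \<subseteq> dual_nbhd \<omega> B \<epsilon> \<and> emeasure \<mu> A > 0))"

lemma charged_dual: "charged \<mu> \<omega> \<Longrightarrow> \<omega> \<in> dual_space"
  by (simp add: charged_def)

text \<open>A point outside all null members of the network is charged, because each of its
  neighbourhoods contains a member around it. The null members are countably many, so their union is
  null.\<close>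

lemma AE_charged:
  assumes sets: "sets \<mu> = sets cylinder_algebra"
  shows "AE \<omega> in \<mu>. charged \<mu> \<omega>"
proof -
  have sp: "space \<mu> = dual_space" using sets_eq_imp_space_eq[OF sets] by simp
  obtain \<C> where \<C>: "countable \<C>" "\<C> \<subseteq> sets cylinder_algebra"
    and nw: "\<And>\<omega> B \<epsilon>. \<lbrakk>\<omega> \<in> dual_space; tvs_bounded B; \<epsilon> > 0\<rbrakk> \<Longrightarrow>
       \<exists>C\<in>\<C>. \<omega> \<in> C \<and> C \<subseteq> {\<eta> \<in> dual_space. \<forall>\<phi>\<in>B. \<bar>\<eta> \<phi> - \<omega> (\<phi> :: schwartz)\<bar> < \<epsilon>}"
    using countable_network by blast
  define Z where "Z = \<Union>{C \<in> \<C>. emeasure \<mu> C = 0}"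
  have "Z \<in> null_sets \<mu>"
    unfolding Z_def using \<C> sets by (intro null_sets_UN'[of _ "\<lambda>x. x", simplified]) (auto simp: null_sets_def)
  moreover have "charged \<mu> \<omega>" if "\<omega> \<in> space \<mu>" "\<omega> \<notin> Z" for \<omega>
    unfolding charged_def
  proof (intro conjI allI impI)
    show \<omega>: "\<omega> \<in> dual_space" using that sp by simp
    fix B :: "schwartz set" and \<epsilon> :: real assume "tvs_bounded B" "\<epsilon> > 0"
    then obtain C where C: "C \<in> \<C>" "\<omega> \<in> C" "C \<subseteq> dual_nbhd \<omega> B \<epsilon>"
      using nw[OF \<omega>] unfolding dual_nbhd_def by meson
    then have "emeasure \<mu> C \<noteq> 0" using that by (auto simp: Z_def)
    then show "\<exists>A\<in>sets cylinder_algebra. A \<subseteq> dual_nbhd \<omega> B \<epsilon> \<and> emeasure \<mu> A > 0"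
      using C \<C> by (intro bexI[of _ C]) (auto simp: zero_less_iff_neq_zero)
  qed
  ultimately show ?thesis by (intro AE_I'[of Z]) auto
qed

lemma charged_limit:
  assumes "\<omega> \<in> dual_space"
    and approx: "\<And>B \<epsilon>. \<lbrakk>tvs_bounded B; \<epsilon> > 0\<rbrakk> \<Longrightarrow> \<exists>\<omega>'. charged \<mu> \<omega>' \<and> \<omega>' \<in> dual_nbhd \<omega> B \<epsilon>"
  shows "charged \<mu> \<omega>"
  unfolding charged_def
proof (intro conjI allI impI)
  fix B :: "schwartz set" and \<epsilon> :: real assume B: "tvs_bounded B" and e: "\<epsilon> > 0"
  obtain \<omega>' where \<omega>': "charged \<mu> \<omega>'" "\<omega>' \<in> dual_nbhd \<omega> B (\<epsilon> / 2)" using approx[OF B, of "\<epsilon> / 2"] e by auto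
  then obtain A where A: "A \<in> sets cylinder_algebra" "A \<subseteq> dual_nbhd \<omega>' B (\<epsilon> / 2)" "emeasure \<mu> A > 0"
    using B e unfolding charged_def by (meson half_gt_zero)
  have "dual_nbhd \<omega>' B (\<epsilon> / 2) \<subseteq> dual_nbhd \<omega> B \<epsilon>"
  proof
    fix \<eta> assume \<eta>: "\<eta> \<in> dual_nbhd \<omega>' B (\<epsilon> / 2)"
    have "\<bar>\<eta> \<phi> - \<omega> \<phi>\<bar> < \<epsilon>" if "\<phi> \<in> B" for \<phi>
    proof -
      have "\<bar>\<eta> \<phi> - \<omega>' \<phi>\<bar> < \<epsilon> / 2" "\<bar>\<omega>' \<phi> - \<omega> \<phi>\<bar> < \<epsilon> / 2"
        using \<eta> \<omega>'(2) that by (auto simp: dual_nbhd_def)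
      then show ?thesis by linarith
    qed
    then show "\<eta> \<in> dual_nbhd \<omega> B \<epsilon>" using \<eta> by (simp add: dual_nbhd_def)
  qed
  with A show "\<exists>A\<in>sets cylinder_algebra. A \<subseteq> dual_nbhd \<omega> B \<epsilon> \<and> emeasure \<mu> A > 0" by blast
qed fact

text \<open>Since \<open>reflect u\<close> is an involution, the preimage under it of the
  \<epsilon>-neighbourhood of \<omega> for \<open>T\<close>
  B\<open>is contained in the \<epsilon>-neighbourhood of\<close>reflect u
  \<omega>\<open>for\<close>B\<open>, and invariance preserves the measure. The set\<close>T
  \<open>B\<close> stays bounded because \<open>T\<close> alters \<phi> by a multiple of the fixed
  function \<open>u\<close>, with a coefficient controlled by the L^2 norm.\<close>

lemma charged_reflect:
  assumes ml: "is_mittag_leffler_measure \<beta> \<mu>" and u: "sinner u u \<noteq> 0" and ch: "charged \<mu> \<omega>"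
  shows "charged \<mu> (reflect u \<omega>)"
  unfolding charged_def
proof (intro conjI allI impI)
  show "reflect u \<omega> \<in> dual_space" using ch by (intro reflect_in_dual charged_dual)
  fix B :: "schwartz set" and \<epsilon> :: real assume B: "tvs_bounded B" and e: "\<epsilon> > 0"
  have sp: "space \<mu> = dual_space" and sets: "sets \<mu> = sets cylinder_algebra"
    using ml by (auto simp: is_mittag_leffler_measure_def)
  define T where "T \<phi> = \<phi> - (2 * sinner u \<phi> / sinner u u) *\<^sub>R u" for \<phi>
  have T: "\<eta> (T \<phi>) = reflect u \<eta> \<phi>" if "\<eta> \<in> dual_space" for \<eta> \<phi>
    using dual_space_linear[OF that] by (simp add: T_def reflect_def linear_diff linear_scale)
  have "tvs_bounded (T ` B)"
    unfolding tvs_bounded_snorm_iff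
  proof
    fix N
    obtain k where k: "k > 0" "\<And>\<phi>. \<phi> \<in> B \<Longrightarrow> snorm N \<phi> \<le> k" using tvs_boundedE[OF B] by metis
    obtain l where l: "l > 0" "\<And>\<phi>. \<phi> \<in> B \<Longrightarrow> l2norm \<phi> \<le> l" using tvs_bounded_l2normE[OF B] by metis
    have "snorm N (T \<phi>) \<le> k + 2 * (l2norm u * l) / sinner u u * snorm N u" if "\<phi> \<in> B" for \<phi>
    proof -
      have "\<bar>sinner u \<phi>\<bar> \<le> l2norm u * l"
        using abs_sinner_le[of u \<phi>] mult_left_mono[OF l(2)[OF that], of "l2norm u"] by simp
      then have "\<bar>2 * sinner u \<phi> / sinner u u\<bar> \<le> 2 * (l2norm u * l) / sinner u u"
        by (simp add: abs_mult divide_right_mono)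
      then have "\<bar>2 * sinner u \<phi> / sinner u u\<bar> * snorm N u \<le> 2 * (l2norm u * l) / sinner u u * snorm N u"
        by (intro mult_right_mono) auto
      moreover have "snorm N (T \<phi>) \<le> snorm N \<phi> + \<bar>2 * sinner u \<phi> / sinner u u\<bar> * snorm N u"
        unfolding T_def snorm_scaleR[symmetric] by (rule snorm_triangle_diff)
      ultimately show ?thesis using k(2)[OF that] by linarith
    qed
    then show "\<exists>k. \<forall>\<phi>\<in>T ` B. snorm N \<phi> \<le> k" by blast
  qed
  then obtain A where A: "A \<in> sets cylinder_algebra" "A \<subseteq> dual_nbhd \<omega> (T ` B) \<epsilon>" "emeasure \<mu> A > 0"
    using ch e unfolding charged_def by meson
  have meas: "reflect u \<in> measurable \<mu> cylinder_algebra"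
    using measurable_reflect measurable_cong_sets[OF sets refl] by blast
  have "emeasure \<mu> A = emeasure (distr \<mu> cylinder_algebra (reflect u)) A"
    using distr_reflect[OF ml u] by simp
  also have "\<dots> = emeasure \<mu> (reflect u -` A \<inter> space \<mu>)"
    using meas A by (intro emeasure_distr) auto
  finally have "emeasure \<mu> (reflect u -` A \<inter> space \<mu>) > 0" using A by simp
  moreover have "reflect u -` A \<inter> space \<mu> \<in> sets cylinder_algebra"
    using measurable_sets[OF meas A(1)] sets by simp
  moreover have "reflect u -` A \<inter> space \<mu> \<subseteq> dual_nbhd (reflect u \<omega>) B \<epsilon>"
  proof
    fix \<eta> assume "\<eta> \<in> reflect u -` A \<inter> space \<mu>"
    then have \<eta>: "\<eta> \<in> dual_space" "reflect u \<eta> \<in> dual_nbhd \<omega> (T ` B) \<epsilon>" using A sp by auto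
    have "\<bar>\<eta> \<phi> - reflect u \<omega> \<phi>\<bar> < \<epsilon>" if "\<phi> \<in> B" for \<phi>
    proof -
      have "\<bar>reflect u \<eta> (T \<phi>) - \<omega> (T \<phi>)\<bar> < \<epsilon>" using \<eta>(2) that by (auto simp: dual_nbhd_def)
      then show ?thesis
        using T[OF reflect_in_dual[OF \<eta>(1)]] T[OF charged_dual[OF ch]] reflect_reflect[OF u] by simp
    qed
    then show "\<eta> \<in> dual_nbhd (reflect u \<omega>) B \<epsilon>" using \<eta> by (simp add: dual_nbhd_def)
  qed
  ultimately show "\<exists>A\<in>sets cylinder_algebra. A \<subseteq> dual_nbhd (reflect u \<omega>) B \<epsilon> \<and> emeasure \<mu> A > 0" by blast
qed

text \<open>Stated on the unit sphere, so that the negation directly supplies unit vectors with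
  arbitrarily large values.\<close>

definition l2_bounded :: "(schwartz \<Rightarrow> real) \<Rightarrow> bool" where
  "l2_bounded \<omega> \<longleftrightarrow> (\<exists>R. \<forall>\<phi>. sinner \<phi> \<phi> = 1 \<longrightarrow> \<bar>\<omega> \<phi>\<bar> \<le> R)"

text \<open>If \<open>\<omega>\<close> is unbounded on the \<open>L\<^sup>2\<close> unit sphere, a rotation by a tiny angle in the plane
  of \<open>v\<close> and a unit vector \<open>u\<close> with \<open>\<omega> u\<close> huge approximates the translation by \<open>v\<close>. The
  rotation is the product of the reflections in \<open>u\<close> and in \<open>u + v / (2 \<omega> u)\<close>.\<close>

lemma charged_translate:
  assumes ml: "is_mittag_leffler_measure \<beta> \<mu>" and ch: "charged \<mu> \<omega>" and unb: "\<not> l2_bounded \<omega>"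
  shows "charged \<mu> (\<lambda>\<phi>. \<omega> \<phi> + sinner v \<phi>)"
proof (rule charged_limit)
  have \<omega>: "\<omega> \<in> dual_space" "linear \<omega>"
    using charged_dual[OF ch] by (auto simp: dual_space_linear)
  show "(\<lambda>\<phi>. \<omega> \<phi> + sinner v \<phi>) \<in> dual_space"
    using dual_space_lincomb[OF \<omega>(1) sinner_in_dual[of v], of 1 1] by simp
  fix B :: "schwartz set" and \<epsilon> :: real assume B: "tvs_bounded B" and e: "\<epsilon> > 0"
  obtain k where k: "k > 0" "\<And>\<phi>. \<phi> \<in> B \<Longrightarrow> l2norm \<phi> \<le> k" using tvs_bounded_l2normE[OF B] by metis
  define z where "z = \<omega> v"
  define n where "n = sinner v v"
  define c where "c = \<bar>n + 2 * z\<bar>"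
  \<comment> \<open>The deviation on \<open>B\<close> will be at most \<open>s * (K - 1)\<close>,
    which falls below \<epsilon> as soon as \<open>s * K < \<epsilon>\<close>.\<close>
  define K where "K = 2 * c * k * (1 + l2norm v) + 1"
  have K: "K > 0" unfolding K_def c_def using k by (intro add_nonneg_pos mult_nonneg_nonneg) auto
  \<comment> \<open>The thresholds give, in this order, \<open>s * K < \<epsilon>\<close>,
    \<open>s < 1\<close>, and \<open>s * l2norm v \<le> 1 / 8\<close>; the last keeps the squared
    norm \<open>q\<close> of the second mirror vector at least 1/2.\<close>
  define R0 where "R0 = max (K / \<epsilon>) (max 1 (4 * l2norm v + 4))"
  obtain u0 where u0: "sinner u0 u0 = 1" "\<bar>\<omega> u0\<bar> > R0"
    using unb unfolding l2_bounded_def by (meson not_le)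
  \<comment> \<open>The sign makes \<open>\<omega> u\<close> positive without leaving the unit
    sphere.\<close>
  define u where "u = sgn (\<omega> u0) *\<^sub>R u0"
  have "R0 \<ge> 1" unfolding R0_def le_max_iff_disj by simp
  then have sg: "sgn (\<omega> u0) * sgn (\<omega> u0) = 1" "\<omega> u = \<bar>\<omega> u0\<bar>"
    using u0 \<omega>(2) by (auto simp: u_def linear_scale sgn_if)
  have u: "sinner u u = 1" using u0 sg by (simp add: u_def sinner_scaleR_left sinner_scaleR_right)
  define R where "R = \<omega> u"
  have R: "R > K / \<epsilon>" "R > 1" "R > 4 * l2norm v + 4"
    using u0(2) unfolding R_def sg R0_def max_less_iff_conj by blast+
  \<comment> \<open>Two reflections rotate by twice the angle between their mirror vectors, hence
    the 2: with \<open>2 * R * s = 1\<close> the functional \<open>sinner v\<close> is added with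
    coefficient 1 up to the small error \<open>b\<close>.\<close>
  define s where "s = 1 / (2 * R)"
  have Rs: "2 * R * s = 1" using R by (simp add: s_def)
  have s: "s > 0" "s < 1" "s * K < \<epsilon>" "s * l2norm v \<le> 1 / 8"
  proof -
    show "s > 0" "s < 1" using R by (auto simp: s_def)
    have "K < R * \<epsilon>" using R(1) e by (simp add: field_simps)
    also have "\<dots> \<le> 2 * R * \<epsilon>" using R e by simp
    finally show "s * K < \<epsilon>" using R by (simp add: s_def field_simps)
    show "s * l2norm v \<le> 1 / 8" using R by (simp add: s_def field_simps)
  qed
  define w where "w = u + s *\<^sub>R v"
  define p where "p = sinner u v"
  have p: "\<bar>p\<bar> \<le> l2norm v"
    using abs_sinner_le[of u v] u by (simp add: p_def l2norm_def)
  define q where "q = sinner w w"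
  have q_eq: "q = 1 + 2 * s * p + s\<^sup>2 * n"
    by (simp add: q_def w_def sinner_simps u p_def n_def sinner_commute[of v u] power2_eq_square
        distrib_left mult.assoc)
  have "\<bar>s * p\<bar> \<le> s * l2norm v" using p s by (simp add: abs_mult)
  then have "\<bar>s * p\<bar> \<le> 1 / 8" using s by linarith
  moreover have "s\<^sup>2 * n \<ge> 0" by (simp add: n_def)
  ultimately have q: "q \<ge> 1 / 2" unfolding q_eq by linarith
  \<comment> \<open>\<open>a\<close> and \<open>b\<close> are the exact error coefficients:
    \<open>\<omega>2\<close> minus \<omega> and \<open>sinner v\<close> equals
    \<open>a * sinner u + b * sinner v\<close>. The contributions of order \<open>R\<close> and of
    order 1 cancel, leaving orders \<open>s\<close> and \<open>s\<^sup>2\<close>.\<close>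
  define a where "a = - s * (n + 2 * z) / q"
  define b where "b = - s\<^sup>2 * (n + 2 * z) / q"
  have aq: "a * q = - s * (n + 2 * z)" and bq: "b * q = - s\<^sup>2 * (n + 2 * z)"
    using q by (simp_all add: a_def b_def)
  define \<omega>1 where "\<omega>1 = reflect u \<omega>"
  define \<omega>2 where "\<omega>2 = reflect w \<omega>1"
  have "charged \<mu> \<omega>2"
    unfolding \<omega>2_def \<omega>1_def using u q by (intro charged_reflect[OF ml] ch) (auto simp: q_def)
  moreover have "\<omega>2 \<in> dual_nbhd (\<lambda>\<phi>. \<omega> \<phi> + sinner v \<phi>) B \<epsilon>"
    unfolding dual_nbhd_def
  proof (intro CollectI conjI ballI)
    show "\<omega>2 \<in> dual_space" unfolding \<omega>2_def \<omega>1_def using \<omega> by (intro reflect_in_dual)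
    fix \<phi> assume \<phi>: "\<phi> \<in> B"
    have \<omega>1: "\<omega>1 \<psi> = \<omega> \<psi> - 2 * R * sinner u \<psi>" for \<psi>
      by (simp add: \<omega>1_def reflect_def u R_def)
    have "\<omega>1 w = R + s * z - 2 * R * (1 + s * p)"
      unfolding \<omega>1 using \<omega>(2)
      by (simp add: w_def linear_add linear_scale sinner_simps u p_def R_def z_def)
    also have "\<dots> = - R + s * z - p * (2 * R * s)" by (simp add: algebra_simps)
    finally have \<omega>1w: "\<omega>1 w = - R + s * z - p" by (simp add: Rs)
    have "a * q = - 2 * R * q - 2 * \<omega>1 w"
    proof -
      have "- 2 * R * q - 2 * \<omega>1 w = - 2 * p * (2 * R * s) - s * n * (2 * R * s) - 2 * s * z + 2 * p"
        unfolding \<omega>1w q_eq by (simp add: algebra_simps power2_eq_square)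
      also have "\<dots> = a * q" unfolding Rs aq by (simp add: algebra_simps)
      finally show ?thesis ..
    qed
    then have a_eq: "a = - 2 * R - 2 * \<omega>1 w / q" using q by (simp add: field_simps)
    have "b * q = - 2 * s * \<omega>1 w - q"
    proof -
      have "- 2 * s * \<omega>1 w - q = 2 * R * s - 2 * s\<^sup>2 * z - 1 - s\<^sup>2 * n"
        unfolding \<omega>1w q_eq by (simp add: algebra_simps power2_eq_square)
      also have "\<dots> = b * q" unfolding Rs bq by (simp add: algebra_simps)
      finally show ?thesis ..
    qed
    then have b_eq: "b = - 2 * \<omega>1 w / q * s - 1" using q by (simp add: field_simps)
    have "\<omega>2 \<phi> = \<omega> \<phi> - 2 * R * sinner u \<phi> - 2 * \<omega>1 w / q * (sinner u \<phi> + s * sinner v \<phi>)"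
      by (simp add: \<omega>2_def reflect_def[of w] \<omega>1[of \<phi>] q_def[symmetric]) (simp add: w_def sinner_simps)
    then have "\<omega>2 \<phi> - (\<omega> \<phi> + sinner v \<phi>) = a * sinner u \<phi> + b * sinner v \<phi>"
      unfolding a_eq b_eq by (simp add: algebra_simps)
    also have "\<bar>\<dots>\<bar> \<le> \<bar>a\<bar> * \<bar>sinner u \<phi>\<bar> + \<bar>b\<bar> * \<bar>sinner v \<phi>\<bar>"
      by (metis abs_mult abs_triangle_ineq)
    also have "\<dots> \<le> (2 * s * c) * k + (2 * s * c) * (l2norm v * k)"
    proof (intro add_mono mult_mono)
      have "\<bar>a\<bar> = s * c / q" using s q by (simp add: a_def c_def abs_mult)
      also have "\<dots> \<le> s * c / (1 / 2)" using s q by (intro divide_left_mono) (auto simp: c_def)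
      finally show a: "\<bar>a\<bar> \<le> 2 * s * c" by simp
      have "\<bar>b\<bar> = s * \<bar>a\<bar>" using s q by (simp add: b_def a_def abs_mult power2_eq_square)
      also have "\<dots> \<le> 1 * \<bar>a\<bar>" using s by (intro mult_right_mono) auto
      finally show "\<bar>b\<bar> \<le> 2 * s * c" using a by simp
      have "\<bar>sinner u \<phi>\<bar> \<le> l2norm \<phi>" using abs_sinner_le[of u \<phi>] u by (simp add: l2norm_def)
      then show "\<bar>sinner u \<phi>\<bar> \<le> k" using k(2)[OF \<phi>] by linarith
      show "\<bar>sinner v \<phi>\<bar> \<le> l2norm v * k"
        by (rule order_trans[OF abs_sinner_le mult_left_mono[OF k(2)[OF \<phi>]]]) simp
    qed (use s in \<open>auto simp: c_def\<close>)
    also have "\<dots> = s * (K - 1)" by (simp add: K_def algebra_simps)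
    also have "\<dots> < \<epsilon>" using s by (simp add: algebra_simps)
    finally show "\<bar>\<omega>2 \<phi> - (\<omega> \<phi> + sinner v \<phi>)\<bar> < \<epsilon>" .
  qed
  ultimately show "\<exists>\<omega>'. charged \<mu> \<omega>' \<and> \<omega>' \<in> dual_nbhd (\<lambda>\<phi>. \<omega> \<phi> + sinner v \<phi>) B \<epsilon>" by blast
qed

section \<open>Gaussians and functionals unbounded in the mean square norm\<close>

lemma exp_ge_power_divide_fact:
  assumes "(x::real) \<ge> 0"
  shows "x ^ m / fact m \<le> exp x"
proof -
  have "(\<Sum>n\<in>{m}. x ^ n /\<^sub>R fact n) \<le> (\<Sum>n. x ^ n /\<^sub>R fact n)"
    using assms by (intro sum_le_suminf summable_exp_generic) auto
  then show ?thesis by (simp add: exp_def divide_inverse mult.commute)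
qed

text \<open>A single term of the exponential series bounds the even powers; all powers follow
  because the power m of \<bar>y\<bar> is at most 1 plus its square.\<close>

lemma bounded_power_mult_exp:
  assumes "a > (0::real)"
  shows "bounded (range (\<lambda>y::real. y ^ m * exp (- a * y\<^sup>2)))"
proof -
  have 1: "y ^ (2 * m) * exp (- a * y\<^sup>2) \<le> fact m / a ^ m" for y :: real
  proof -
    have "(a * y\<^sup>2) ^ m / fact m \<le> exp (a * y\<^sup>2)"
      using exp_ge_power_divide_fact[of "a * y\<^sup>2" m] assms by simp
    then show ?thesis
      using assms by (simp add: exp_minus field_simps power_mult_distrib power_mult[symmetric])
  qed
  have "\<bar>y ^ m * exp (- a * y\<^sup>2)\<bar> \<le> 1 + fact m / a ^ m" for y :: real
  proof -
    have "\<bar>y\<bar> ^ m \<le> 1 + (\<bar>y\<bar> ^ m)\<^sup>2"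
      using zero_le_power2[of "\<bar>y\<bar> ^ m - 1"] zero_le_power_abs[of y m]
      unfolding power2_diff power_one mult_1_right by linarith
    then have "\<bar>y\<bar> ^ m \<le> 1 + y ^ (2 * m)"
      by (simp add: power_mult[symmetric] power_even_abs mult.commute[of m])
    then have "\<bar>y\<bar> ^ m * exp (- a * y\<^sup>2) \<le> (1 + y ^ (2 * m)) * exp (- a * y\<^sup>2)"
      by (intro mult_right_mono) auto
    also have "\<dots> = exp (- a * y\<^sup>2) + y ^ (2 * m) * exp (- a * y\<^sup>2)" by (simp add: distrib_right)
    also have "\<dots> \<le> 1 + fact m / a ^ m" using assms by (intro add_mono 1) simp
    finally show ?thesis by (simp add: abs_mult power_abs)
  qed
  then show ?thesis by (auto simp: bounded_iff intro!: exI[of _ "1 + fact m / a ^ m"])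
qed

lemma bounded_poly_mult_exp:
  assumes "a > (0::real)"
  shows "bounded (range (\<lambda>x::real. poly p x * exp (- a * (x - b)\<^sup>2)))"
proof -
  \<comment> \<open>The additional factor \<open>y ^ m\<close> strengthens the induction, since the
    tail of a polynomial occurs multiplied by \<open>y\<close>.\<close>
  have *: "bounded (range (\<lambda>y::real. y ^ m * poly q y * exp (- a * y\<^sup>2)))" for m q
  proof (induction q arbitrary: m)
    case 0
    show ?case by (simp add: image_constant_conv)
  next
    case (pCons c q)
    have "bounded (range (\<lambda>y::real. c * (y ^ m * exp (- a * y\<^sup>2)) + y ^ Suc m * poly q y * exp (- a * y\<^sup>2)))"
      using bounded_scaling[OF bounded_power_mult_exp[OF assms, of m], of c]
      by (intro bounded_plus_comp pCons.IH) (simp add: image_image)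
    then show ?case by (simp add: algebra_simps)
  qed
  have "range (\<lambda>x::real. poly p x * exp (- a * (x - b)\<^sup>2)) \<subseteq>
      range (\<lambda>y::real. y ^ 0 * poly (pcompose p [:b, 1:]) y * exp (- a * y\<^sup>2))"
  proof safe
    fix x :: real
    show "poly p x * exp (- a * (x - b)\<^sup>2) \<in> range (\<lambda>y::real. y ^ 0 * poly (pcompose p [:b, 1:]) y * exp (- a * y\<^sup>2))"
      by (rule image_eqI[of _ _ "x - b"]) (auto simp: poly_pcompose)
  qed
  then show ?thesis using * bounded_subset by blast
qed

text \<open>Polynomial multiples of a fixed Gaussian are closed under differentiation and under
  multiplication by powers of x, so one boundedness statement covers all the seminorms.\<close>

lemma poly_exp_schwartz:
  assumes "a > (0::real)"
  shows "(\<lambda>x. poly p x * exp (- a * (x - b)\<^sup>2)) \<in> schwartz_functions"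
proof -
  let ?G = "\<lambda>p x. poly p x * exp (- a * (x - b)\<^sup>2)"
  have der: "(?G p has_real_derivative ?G (pderiv p + p * [:2 * a * b, - 2 * a:]) x) (at x)" for p x
    by (auto intro!: derivative_eq_intros simp: algebra_simps)
  have "\<exists>q. (deriv ^^ n) (?G p) = ?G q" for n
  proof (induction n)
    case (Suc n)
    then obtain q where "(deriv ^^ n) (?G p) = ?G q" by blast
    then have "(deriv ^^ Suc n) (?G p) = ?G (pderiv q + q * [:2 * a * b, - 2 * a:])"
      using DERIV_imp_deriv[OF der[of q]] by auto
    then show ?case by blast
  qed auto
  then obtain q where q: "\<And>n. (deriv ^^ n) (?G p) = ?G (q n)" by metis
  have "bounded (range (\<lambda>x. x ^ m * ?G (q n) x))" for m n
    using bounded_poly_mult_exp[OF assms, of "monom 1 m * q n" b] by (simp add: poly_monom mult.assoc)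
  moreover have "?G (q n) differentiable (at x)" for n x
    using der[of "q n" x] real_differentiable_def by blast
  ultimately show ?thesis 
    unfolding schwartz_functions_def mem_Collect_eq q by blast
qed

text \<open>Normalised as a probability density because narrow Gaussians will approximate point
  evaluations; translates of width 1 also provide the almost orthogonal sequence.\<close>

definition gauss :: "real \<Rightarrow> real \<Rightarrow> schwartz" where
  "gauss \<sigma> b = Schwartz (normal_density b \<sigma>)"

lemma schwartz_fun_gauss:
  assumes "\<sigma> > 0"
  shows "schwartz_fun (gauss \<sigma> b) = normal_density b \<sigma>"
proof -
  have "normal_density b \<sigma> = (\<lambda>x. poly [:1 / sqrt (2 * pi * \<sigma>\<^sup>2):] x * exp (- (1 / (2 * \<sigma>\<^sup>2)) * (x - b)\<^sup>2))"
    by (auto simp: normal_density_def)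
  then have "normal_density b \<sigma> \<in> schwartz_functions"
    using poly_exp_schwartz[of "1 / (2 * \<sigma>\<^sup>2)" "[:1 / sqrt (2 * pi * \<sigma>\<^sup>2):]" b] assms by simp
  then show ?thesis by (simp add: gauss_def Schwartz_inverse)
qed

text \<open>Completing the square turns the product of the densities into a constant times a normal
  density centred at the midpoint, with variance 1/2 and integral 1.\<close>

lemma sinner_gauss:
  "sinner (gauss 1 a) (gauss 1 b) = exp (- (a - b)\<^sup>2 / 4) / sqrt (4 * pi)"
proof -
  have "normal_density a 1 x * normal_density b 1 x =
      exp (- (a - b)\<^sup>2 / 4) / sqrt (4 * pi) * normal_density ((a + b) / 2) (1 / sqrt 2) x" for x
  proof -
    have "- (x - a)\<^sup>2 / 2 + - (x - b)\<^sup>2 / 2 = - (a - b)\<^sup>2 / 4 + - (x - (a + b) / 2)\<^sup>2"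
      by (simp add: power2_eq_square field_simps)
    then have "exp (- (x - a)\<^sup>2 / 2) * exp (- (x - b)\<^sup>2 / 2) = exp (- (a - b)\<^sup>2 / 4) * exp (- (x - (a + b) / 2)\<^sup>2)"
      by (simp only: exp_add[symmetric])
    then have *: "normal_density a 1 x * normal_density b 1 x =
        exp (- (a - b)\<^sup>2 / 4) * exp (- (x - (a + b) / 2)\<^sup>2) / (2 * pi)"
      by (simp add: normal_density_def)
    have "normal_density ((a + b) / 2) (1 / sqrt 2) x = exp (- (x - (a + b) / 2)\<^sup>2) / sqrt pi"
      by (simp add: normal_density_def power_divide)
    moreover have "sqrt (4 * pi) * sqrt pi = 2 * pi"
      by (simp add: real_sqrt_mult)
    ultimately show ?thesis unfolding * by (metis times_divide_times_eq)
  qed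
  then have "sinner (gauss 1 a) (gauss 1 b) =
      (LINT x|lborel. exp (- (a - b)\<^sup>2 / 4) / sqrt (4 * pi) * normal_density ((a + b) / 2) (1 / sqrt 2) x)"
    by (simp add: sinner_def schwartz_fun_gauss)
  also have "\<dots> = exp (- (a - b)\<^sup>2 / 4) / sqrt (4 * pi)"
    by (subst integral_mult_right_zero) simp
  finally show ?thesis .
qed

section \<open>Decay of mean-square bounded functionals along separated Gaussians\<close>

lemma l2_bounded_bound:
  assumes "l2_bounded \<omega>" "linear \<omega>"
  obtains R where "R \<ge> 0" "\<And>\<phi>. \<bar>\<omega> \<phi>\<bar> \<le> R * l2norm \<phi>"
proof -
  obtain R where R: "\<And>\<phi>. sinner \<phi> \<phi> = 1 \<Longrightarrow> \<bar>\<omega> \<phi>\<bar> \<le> R"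
    using assms by (auto simp: l2_bounded_def)
  \<comment> \<open>Some unit vector must be exhibited: it shows \<open>R \<ge> 0\<close> and serves
    to treat vectors of norm 0.\<close>
  have g: "sinner (gauss 1 0) (gauss 1 0) > 0" by (simp add: sinner_gauss)
  define e where "e = (1 / l2norm (gauss 1 0)) *\<^sub>R gauss 1 0"
  have e: "sinner e e = 1"
    using g by (simp add: e_def sinner_simps l2norm_def)
  have R0: "R \<ge> 0" using R[OF e] by linarith
  have "\<bar>\<omega> \<phi>\<bar> \<le> R * l2norm \<phi>" for \<phi>
  proof (cases "l2norm \<phi> = 0")
    case True
    then have \<phi>: "sinner \<phi> \<phi> = 0" using l2norm_power2[of \<phi>] by simp
    then have "sinner e \<phi> = 0" using sinner_Cauchy_Schwarz[of e \<phi>] by simp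
    \<comment> \<open>The whole line through \<open>e\<close> in the direction of a null vector lies
      on the unit sphere; an affine function bounded on a line is constant, so \<omega> vanishes at
      \<phi>.\<close>
    then have "sinner (e + t *\<^sub>R \<phi>) (e + t *\<^sub>R \<phi>) = 1" for t
      using e \<phi> by (simp add: sinner_simps sinner_commute[of \<phi> e])
    then have bd: "\<bar>\<omega> e + t * \<omega> \<phi>\<bar> \<le> R" for t
      using R[of "e + t *\<^sub>R \<phi>"] assms(2) by (simp add: linear_add linear_scale)
    have "\<omega> \<phi> = 0"
    proof (rule ccontr)
      assume "\<omega> \<phi> \<noteq> 0"
      then show False using bd[of "(R + 1 - \<omega> e) / \<omega> \<phi>"] by simp
    qed
    then show ?thesis using True by simp
  next
    case False
    have "sinner \<phi> \<phi> = l2norm \<phi> * l2norm \<phi>" by (simp add: l2norm_power2[symmetric] power2_eq_square)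
    then have "sinner ((1 / l2norm \<phi>) *\<^sub>R \<phi>) ((1 / l2norm \<phi>) *\<^sub>R \<phi>) = 1"
      using False by (simp add: sinner_scaleR_left sinner_scaleR_right)
    from R[OF this] show ?thesis
      using assms(2) False l2norm_nonneg[of \<phi>] by (simp add: linear_scale abs_mult field_simps)
  qed
  with R0 show thesis using that by blast
qed

text \<open>The centres \<open>2 * k\<^sup>2\<close> are so sparse that the row sums of the Gram matrix are bounded.\<close>

definition gauss_seq :: "nat \<Rightarrow> schwartz" where
  "gauss_seq k = gauss 1 (2 * (real k)\<^sup>2)"

lemma sinner_gauss_seq_same: "sinner (gauss_seq k) (gauss_seq k) = 1 / sqrt (4 * pi)"
  by (simp add: gauss_seq_def sinner_gauss)

text \<open>For distinct indices the exponent is the square of (j - k)(j + k), hence at least k. The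
  bound is not symmetric: what counts is a majorant that is summable in \<open>k\<close>, uniformly
  in \<open>j\<close>.\<close>

lemma sinner_gauss_seq_bound:
  "0 \<le> sinner (gauss_seq j) (gauss_seq k)"
  "sinner (gauss_seq j) (gauss_seq k) \<le> (if j = k then 1 else 0) + exp (-1) ^ k"
proof -
  show "0 \<le> sinner (gauss_seq j) (gauss_seq k)"
    by (simp add: gauss_seq_def sinner_gauss)
  have "sqrt 1 \<le> sqrt (4 * pi)" using pi_gt3 by (intro real_sqrt_le_mono) simp
  then have le: "sinner (gauss_seq j) (gauss_seq k) \<le> exp (- (2 * (real j)\<^sup>2 - 2 * (real k)\<^sup>2)\<^sup>2 / 4)"
    by (simp add: gauss_seq_def sinner_gauss divide_le_eq mult_le_cancel_left1)
  show "sinner (gauss_seq j) (gauss_seq k) \<le> (if j = k then 1 else 0) + exp (-1) ^ k"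
  proof (cases "j = k")
    case True
    then show ?thesis using le by (auto intro: order_trans)
  next
    case False
    have "(2 * (real j)\<^sup>2 - 2 * (real k)\<^sup>2)\<^sup>2 / 4 = (real j - real k)\<^sup>2 * (real j + real k)\<^sup>2"
      by (simp add: power2_eq_square field_simps)
    moreover have "1 \<le> (real j - real k)\<^sup>2"
    proof -
      have "1 \<le> \<bar>real j - real k\<bar>" using False by linarith
      then show ?thesis using power_mono[of 1 "\<bar>real j - real k\<bar>" 2] by simp
    qed
    moreover have "real k \<le> (real j + real k)\<^sup>2"
    proof -
      have "real k \<le> (real k)\<^sup>2" by (cases k) (auto simp: power2_eq_square)
      also have "\<dots> \<le> (real j + real k)\<^sup>2" by (intro power_mono) auto
      finally show ?thesis .
    qed
    ultimately have "real k \<le> (2 * (real j)\<^sup>2 - 2 * (real k)\<^sup>2)\<^sup>2 / 4"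
      using mult_mono[of 1 "(real j - real k)\<^sup>2" "real k" "(real j + real k)\<^sup>2"] by simp
    then have "exp (- (2 * (real j)\<^sup>2 - 2 * (real k)\<^sup>2)\<^sup>2 / 4) \<le> exp (- real k)" by simp
    also have "exp (- real k) = exp (-1) ^ k" by (simp add: exp_of_nat_mult[symmetric])
    finally show ?thesis using le False by simp
  qed
qed

lemma sinner_sum_left: "sinner (\<Sum>i\<in>A. f i) \<psi> = (\<Sum>i\<in>A. sinner (f i) \<psi>)"
  using linear_sum[OF linear_sinner, of \<psi> f A] by (simp add: sinner_commute)

lemma sinner_sum_right: "sinner \<psi> (\<Sum>i\<in>A. f i) = (\<Sum>i\<in>A. sinner \<psi> (f i))"
  by (rule linear_sum[OF linear_sinner])

text \<open>A Bessel inequality for an almost orthogonal system: bounded row sums of the Gram matrix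
  make the squares of the values summable. \<open>C\<close> adds the diagonal bound 1 to the sum of
  the geometric series.\<close>

lemma l2_bounded_gauss_seq:
  assumes "l2_bounded \<omega>" "linear \<omega>"
  shows "(\<lambda>k. \<omega> (gauss_seq k)) \<longlonglongrightarrow> 0"
proof -
  obtain R where R: "R \<ge> 0" "\<And>\<phi>. \<bar>\<omega> \<phi>\<bar> \<le> R * l2norm \<phi>" using l2_bounded_bound[OF assms] by blast
  define C where "C = 1 + 1 / (1 - exp (-1 :: real))"
  have C: "C \<ge> 0" by (simp add: C_def)
  have bound: "(\<Sum>k<n. (\<omega> (gauss_seq k))\<^sup>2) \<le> R\<^sup>2 * C" for n
  proof -
    define a where "a k = \<omega> (gauss_seq k)" for k
    define g where "g j k = sinner (gauss_seq j) (gauss_seq k)" for j k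
    define S where "S = (\<Sum>k<n. (a k)\<^sup>2)"
    \<comment> \<open>With its own values as coefficients, \<omega> takes the value \<open>S\<close>
      at this \<phi>, while the squared norm of \<phi> is at most \<open>C * S\<close>; comparing
      the two bounds \<open>S\<close>.\<close>
    define \<phi> where "\<phi> = (\<Sum>k<n. a k *\<^sub>R gauss_seq k)"
    have S0: "S \<ge> 0" by (simp add: S_def sum_nonneg)
    have row: "(\<Sum>k<n. g j k) \<le> C" if "j < n" for j
    proof -
      have "(\<Sum>k<n. g j k) \<le> (\<Sum>k<n. (if j = k then 1 else 0) + exp (-1) ^ k)"
        unfolding g_def by (intro sum_mono sinner_gauss_seq_bound)
      also have "\<dots> = 1 + (\<Sum>k<n. exp (-1) ^ k)" using that by (simp add: sum.distrib)
      also have "(\<Sum>k<n. exp (-1 :: real) ^ k) \<le> (\<Sum>k. exp (-1) ^ k)"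
        by (intro sum_le_suminf summable_geometric) auto
      also have "\<dots> = 1 / (1 - exp (-1))" by (rule suminf_geometric) simp
      finally show ?thesis by (simp add: C_def)
    qed
    have "sinner \<phi> \<phi> = (\<Sum>j<n. \<Sum>k<n. a j * a k * g j k)"
      by (simp add: \<phi>_def sinner_sum_left sinner_sum_right sinner_simps sum_distrib_left g_def mult_ac)
        (simp add: sinner_commute)
    \<comment> \<open>Schur's test for a symmetric matrix with nonnegative entries: each product is
      split by the arithmetic-geometric mean inequality, and both halves reduce to row sums.\<close>
    also have "\<dots> \<le> (\<Sum>j<n. \<Sum>k<n. ((a j)\<^sup>2 / 2 + (a k)\<^sup>2 / 2) * g j k)"
    proof (intro sum_mono mult_right_mono)
      fix j k
      show "a j * a k \<le> (a j)\<^sup>2 / 2 + (a k)\<^sup>2 / 2"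
        using zero_le_power2[of "a j - a k"] by (simp add: power2_diff)
      show "0 \<le> g j k" unfolding g_def by (rule sinner_gauss_seq_bound)
    qed
    also have "\<dots> = (\<Sum>j<n. \<Sum>k<n. (a j)\<^sup>2 / 2 * g j k) + (\<Sum>j<n. \<Sum>k<n. (a k)\<^sup>2 / 2 * g j k)"
      by (simp add: distrib_right sum.distrib)
    also have "(\<Sum>j<n. \<Sum>k<n. (a k)\<^sup>2 / 2 * g j k) = (\<Sum>j<n. \<Sum>k<n. (a j)\<^sup>2 / 2 * g j k)"
      by (subst sum.swap) (simp add: g_def sinner_commute)
    also have "(\<Sum>j<n. \<Sum>k<n. (a j)\<^sup>2 / 2 * g j k) + (\<Sum>j<n. \<Sum>k<n. (a j)\<^sup>2 / 2 * g j k) =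
        (\<Sum>j<n. (a j)\<^sup>2 * (\<Sum>k<n. g j k))"
      by (simp add: sum.distrib[symmetric] sum_distrib_left sum_distrib_right mult.commute)
    also have "\<dots> \<le> (\<Sum>j<n. (a j)\<^sup>2 * C)"
      by (intro sum_mono mult_left_mono row) auto
    also have "\<dots> = C * S" by (simp add: S_def sum_distrib_left mult.commute)
    finally have l2: "(l2norm \<phi>)\<^sup>2 \<le> C * S" by (simp add: l2norm_power2)
    have "\<omega> \<phi> = S"
      using assms(2) by (simp add: \<phi>_def linear_sum linear_scale S_def a_def power2_eq_square)
    then have "S \<le> R * l2norm \<phi>" using R(2)[of \<phi>] by linarith
    then have "S\<^sup>2 \<le> (R * l2norm \<phi>)\<^sup>2" using S0 by (intro power_mono)
    also have "\<dots> \<le> R\<^sup>2 * (C * S)" unfolding power_mult_distrib using l2 by (intro mult_left_mono) auto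
    finally have "S * S \<le> (R\<^sup>2 * C) * S" by (simp add: power2_eq_square mult_ac)
    then have "S \<le> R\<^sup>2 * C"
      using S0 C by (cases "S = 0") (auto simp: mult_le_cancel_right)
    then show ?thesis by (simp add: S_def a_def)
  qed
  have "(\<Sum>k\<le>n. (\<omega> (gauss_seq k))\<^sup>2) \<le> R\<^sup>2 * C" for n
    using bound[of "Suc n"] by (simp only: lessThan_Suc_atMost)
  then have "summable (\<lambda>k. (\<omega> (gauss_seq k))\<^sup>2)"
    by (intro bounded_imp_summable[of _ "R\<^sup>2 * C"]) auto
  then have "(\<lambda>k. (\<omega> (gauss_seq k))\<^sup>2) \<longlonglongrightarrow> 0" by (rule summable_LIMSEQ_zero)
  then have "(\<lambda>k. sqrt ((\<omega> (gauss_seq k))\<^sup>2)) \<longlonglongrightarrow> sqrt 0" by (rule tendsto_real_sqrt)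
  then show ?thesis by (simp add: tendsto_rabs_zero_iff)
qed

text \<open>The minimum on \<open>[1, 2]\<close> is positive, and the functional equation shows that
  a unit step to the right does not decrease the value once the left point is at least 1. This
  bounds the Mittag-Leffler coefficients and gives convergence in the unit disc.\<close>

lemma Gamma_real_lower_bound:
  obtains c :: real where "c > 0" "\<And>x. x \<ge> 1 \<Longrightarrow> c \<le> Gamma x"
proof -
  have cont: "continuous_on {1..2::real} Gamma"
    by (intro continuous_on_Gamma continuous_on_id) (auto dest: nonpos_Ints_nonpos)
  obtain y where y: "y \<in> {1..2}" "\<And>x. x \<in> {1..2} \<Longrightarrow> Gamma y \<le> Gamma (x::real)"
    using continuous_attains_inf[OF compact_Icc _ cont] by auto
  have pos: "Gamma y > 0" using y by (intro Gamma_real_pos) auto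
  have *: "Gamma y \<le> Gamma x" if "1 \<le> x" "x \<le> real n + 2" for x n
    using that
  proof (induction n arbitrary: x)
    case 0
    then show ?case by (intro y) auto
  next
    case (Suc n)
    show ?case
    proof (cases "x \<le> 2")
      case False
      then have "Gamma y \<le> Gamma (x - 1)" using Suc.prems by (intro Suc.IH) auto
      also have "\<dots> \<le> (x - 1) * Gamma (x - 1)"
      proof -
        have "Gamma (x - 1) > 0" using False by (intro Gamma_real_pos) auto
        then have "1 * Gamma (x - 1) \<le> (x - 1) * Gamma (x - 1)"
          using False by (intro mult_right_mono) auto
        then show ?thesis by simp
      qed
      also have "\<dots> = Gamma x"
      proof -
        have "x - 1 \<notin> \<int>\<^sub>\<le>\<^sub>0" using False nonpos_Ints_nonpos[of "x - 1"] by auto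
        then show ?thesis using Gamma_plus1[of "x - 1"] by simp
      qed
      finally show ?thesis .
    qed (use Suc.prems y in auto)
  qed
  have "Gamma y \<le> Gamma x" if "x \<ge> 1" for x
  proof -
    obtain n where "x \<le> real n" using real_arch_simple by blast
    then show ?thesis using that by (intro *[of x n]) auto
  qed
  with pos show thesis using that by blast
qed

text \<open>The coefficient of order 1 is the reciprocal of \<open>Gamma (\<beta> + 1)\<close> and
  so nonzero. If the function were 1 on the negative axis, the quotient \<open>h\<close> would
  vanish along a sequence tending to 0, although its limit there is this coefficient.\<close>

lemma mittag_leffler_nonconstant:
  assumes "0 < \<beta>"
  shows "\<exists>t>0. mittag_leffler \<beta> (complex_of_real (- t)) \<noteq> 1"
proof (rule ccontr)
  assume "\<not> ?thesis"
  then have one: "mittag_leffler \<beta> (complex_of_real (- t)) = 1" if "t > 0" for t using that by blast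
  define a :: "nat \<Rightarrow> complex" where "a n = 1 / complex_of_real (Gamma (\<beta> * real n + 1))" for n
  obtain c where c: "c > 0" "\<And>x. x \<ge> 1 \<Longrightarrow> c \<le> Gamma (x::real)" using Gamma_real_lower_bound by blast
  have "norm (a n) \<le> 1 / c" for n
  proof -
    have "c \<le> Gamma (\<beta> * real n + 1)" using assms by (intro c) simp
    then show ?thesis using c(1) by (simp add: a_def norm_divide frac_le)
  qed
  then have sum: "summable (\<lambda>n. a n * z ^ n)" "summable (\<lambda>n. a (Suc n) * z ^ n)"
    if "norm z < 1" for z
  proof -
    have "norm (a n * z ^ m) \<le> 1 / c * norm z ^ m" for n m
      unfolding norm_mult norm_power by (intro mult_right_mono \<open>\<And>n. norm (a n) \<le> 1 / c\<close>) simp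
    moreover have g: "summable (\<lambda>n. 1 / c * norm z ^ n)"
      using that by (intro summable_mult summable_geometric) simp
    ultimately show "summable (\<lambda>n. a n * z ^ n)" "summable (\<lambda>n. a (Suc n) * z ^ n)"
      by (blast intro: summable_comparison_test'[OF g, of 0])+
  qed
  define h where "h z = (\<Sum>n. a (Suc n) * z ^ n)" for z
  have lim: "(h \<longlongrightarrow> a (Suc 0)) (at 0)"
    by (rule powser_limit_0[of 1]) (auto simp: h_def intro!: summable_sums sum)
  have split: "mittag_leffler \<beta> z = 1 + z * h z" if "norm z < 1" for z
  proof -
    have "mittag_leffler \<beta> z = (\<Sum>n. a n * z ^ n)" by (simp add: mittag_leffler_def a_def)
    also have "\<dots> = a 0 * z ^ 0 + (\<Sum>n. a (Suc n) * z ^ Suc n)"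
      using suminf_split_head[OF sum(1)[OF that]] by simp
    also have "(\<Sum>n. a (Suc n) * z ^ Suc n) = z * h z"
      unfolding h_def suminf_mult[OF sum(2)[OF that], symmetric] by (simp add: mult_ac)
    finally show ?thesis by (simp add: a_def)
  qed
  \<comment> \<open>The shift by 2 keeps every point inside the open unit disc, where the series is
    split.\<close>
  define x where "x n = complex_of_real (- (1 / real (n + 2)))" for n
  have "h (x n) = 0" for n
  proof -
    have "norm (x n) < 1" unfolding x_def norm_of_real by simp
    moreover have "mittag_leffler \<beta> (x n) = 1" unfolding x_def by (rule one) simp
    moreover have "x n \<noteq> 0" unfolding x_def of_real_eq_0_iff by simp
    ultimately show ?thesis using split[of "x n"] by simp
  qed
  moreover have "filterlim x (at 0) sequentially"
    unfolding filterlim_at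
  proof
    have "(\<lambda>n. - (1 / real (n + 2))) \<longlonglongrightarrow> 0"
      using tendsto_minus[OF LIMSEQ_ignore_initial_segment[OF lim_1_over_n, of 2]] by simp
    from tendsto_of_real[OF this, where 'a = complex] show "x \<longlonglongrightarrow> 0"
      unfolding x_def of_real_0 .
    show "\<forall>\<^sub>F n in sequentially. x n \<in> UNIV \<and> x n \<noteq> 0"
      unfolding x_def of_real_eq_0_iff by simp
  qed
  ultimately have "(\<lambda>n. 0) \<longlonglongrightarrow> a (Suc 0)"
    using filterlim_compose[OF lim] by fastforce
  then have "a (Suc 0) = 0" by (simp add: LIMSEQ_const_iff)
  moreover have "Gamma (\<beta> + 1) > 0" using assms by (intro Gamma_real_pos) simp
  ultimately show False by (simp add: a_def)
qed

lemma ex_charged_not_l2_bounded: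
  assumes ml: "is_mittag_leffler_measure \<beta> \<mu>" and "0 < \<beta>"
  shows "\<exists>\<omega>. charged \<mu> \<omega> \<and> \<not> l2_bounded \<omega>"
proof (rule ccontr)
  assume neg: "\<not> ?thesis"
  have P: "prob_space \<mu>" and sp: "space \<mu> = dual_space" and sets: "sets \<mu> = sets cylinder_algebra"
    and char: "\<And>\<phi>. (CLINT \<omega>|\<mu>. iexp (\<omega> \<phi>)) =
      mittag_leffler \<beta> (complex_of_real (- (1/2) * sinner \<phi> \<phi>))"
    using ml by (auto simp: is_mittag_leffler_measure_def sinner_def power2_eq_square)
  interpret prob_space \<mu> by fact
  have [measurable]: "(\<lambda>\<omega>. \<omega> \<phi>) \<in> borel_measurable \<mu>" for \<phi>
    using measurable_cylinder_eval[of \<phi>] measurable_cong_sets[OF sets refl] by blast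
  obtain t where t: "t > 0" "mittag_leffler \<beta> (complex_of_real (- t)) \<noteq> 1"
    using mittag_leffler_nonconstant[OF \<open>0 < \<beta>\<close>] by blast
  \<comment> \<open>Scaled so that every \<open>\<phi> k\<close> has squared norm
    \<open>2 * t\<close>: the characteristic functional then takes the same value, different from 1,
    at all of them.\<close>
  define r where "r = sqrt (2 * t * sqrt (4 * pi))"
  have r: "r\<^sup>2 = 2 * t * sqrt (4 * pi)" using t by (simp add: r_def)
  define \<phi> where "\<phi> k = r *\<^sub>R gauss_seq k" for k
  have "sinner (\<phi> k) (\<phi> k) = r\<^sup>2 * (1 / sqrt (4 * pi))" for k
    by (simp add: \<phi>_def sinner_simps sinner_gauss_seq_same power2_eq_square)
  then have \<phi>: "sinner (\<phi> k) (\<phi> k) = 2 * t" for k unfolding r by simp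
  \<comment> \<open>Under the negated claim almost every point is L^2-bounded, so the integrands
    tend to 1 almost surely. The integrals do not depend on \<open>k\<close>, which gives the
    contradiction.\<close>
  have "(\<lambda>k. CLINT \<omega>|\<mu>. iexp (\<omega> (\<phi> k))) \<longlonglongrightarrow> (CLINT \<omega>|\<mu>. 1)"
  proof (rule integral_dominated_convergence[where w = "\<lambda>_. 1"])
    show "AE \<omega> in \<mu>. (\<lambda>k. iexp (\<omega> (\<phi> k))) \<longlonglongrightarrow> 1"
      using AE_charged[OF sets]
    proof eventually_elim
      case (elim \<omega>)
      then have lin: "linear \<omega>" by (intro dual_space_linear charged_dual)
      have "(\<lambda>k. \<omega> (gauss_seq k)) \<longlonglongrightarrow> 0" using neg elim lin by (intro l2_bounded_gauss_seq) auto
      then have "(\<lambda>k. \<omega> (\<phi> k)) \<longlonglongrightarrow> 0"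
        using lin tendsto_mult_right_zero[of _ _ r] by (simp add: \<phi>_def linear_scale)
      then have "(\<lambda>k. iexp (\<omega> (\<phi> k))) \<longlonglongrightarrow> iexp 0" by (intro tendsto_intros)
      then show ?case by simp
    qed
  qed auto
  then have "(\<lambda>k::nat. mittag_leffler \<beta> (complex_of_real (- t))) \<longlonglongrightarrow> 1"
    unfolding char \<phi> by (simp add: prob_space)
  then show False using t by (simp add: LIMSEQ_const_iff)
qed

section \<open>Density of the test functions in the strong dual\<close>

definition approximable :: "(schwartz \<Rightarrow> real) \<Rightarrow> bool" where
  "approximable \<omega> \<longleftrightarrow> (\<forall>B \<epsilon>. tvs_bounded B \<longrightarrow> \<epsilon> > 0 \<longrightarrow> (\<exists>v. \<forall>\<phi>\<in>B. \<bar>\<omega> \<phi> - sinner v \<phi>\<bar> < \<epsilon>))"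

lemma approximable_limit:
  assumes "\<And>B \<epsilon>. tvs_bounded B \<Longrightarrow> \<epsilon> > 0 \<Longrightarrow> \<exists>\<eta>. approximable \<eta> \<and> (\<forall>\<phi>\<in>B. \<bar>\<omega> \<phi> - \<eta> \<phi>\<bar> < \<epsilon>)"
  shows "approximable \<omega>"
  unfolding approximable_def
proof (intro allI impI)
  fix B :: "schwartz set" and \<epsilon> :: real assume B: "tvs_bounded B" and e: "\<epsilon> > 0"
  obtain \<eta> where \<eta>: "approximable \<eta>" "\<And>\<phi>. \<phi> \<in> B \<Longrightarrow> \<bar>\<omega> \<phi> - \<eta> \<phi>\<bar> < \<epsilon> / 2"
    using assms[OF B, of "\<epsilon> / 2"] e by auto
  obtain v where v: "\<And>\<phi>. \<phi> \<in> B \<Longrightarrow> \<bar>\<eta> \<phi> - sinner v \<phi>\<bar> < \<epsilon> / 2"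
    using \<eta>(1) B e unfolding approximable_def by (meson half_gt_zero)
  have "\<bar>\<omega> \<phi> - sinner v \<phi>\<bar> < \<epsilon>" if "\<phi> \<in> B" for \<phi>
    using \<eta>(2)[OF that] v[OF that] by linarith
  then show "\<exists>v. \<forall>\<phi>\<in>B. \<bar>\<omega> \<phi> - sinner v \<phi>\<bar> < \<epsilon>" by blast
qed

lemma approximable_sinner: "approximable (sinner v)"
  unfolding approximable_def by (auto intro!: exI[of _ v])

lemma approximable_add:
  assumes "approximable \<omega>" "approximable \<eta>"
  shows "approximable (\<lambda>\<phi>. \<omega> \<phi> + \<eta> \<phi>)"
  unfolding approximable_def
proof (intro allI impI)
  fix B :: "schwartz set" and \<epsilon> :: real assume B: "tvs_bounded B" "\<epsilon> > 0"
  obtain v where v: "\<And>\<phi>. \<phi> \<in> B \<Longrightarrow> \<bar>\<omega> \<phi> - sinner v \<phi>\<bar> < \<epsilon> / 2"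
    using assms(1) B unfolding approximable_def by (meson half_gt_zero)
  obtain w where w: "\<And>\<phi>. \<phi> \<in> B \<Longrightarrow> \<bar>\<eta> \<phi> - sinner w \<phi>\<bar> < \<epsilon> / 2"
    using assms(2) B unfolding approximable_def by (meson half_gt_zero)
  have "\<bar>\<omega> \<phi> + \<eta> \<phi> - sinner (v + w) \<phi>\<bar> < \<epsilon>" if "\<phi> \<in> B" for \<phi>
    using v[OF that] w[OF that] unfolding sinner_add_left by linarith
  then show "\<exists>v. \<forall>\<phi>\<in>B. \<bar>\<omega> \<phi> + \<eta> \<phi> - sinner v \<phi>\<bar> < \<epsilon>" by blast
qed

lemma approximable_scale:
  assumes "approximable \<omega>"
  shows "approximable (\<lambda>\<phi>. c * \<omega> \<phi>)"
  unfolding approximable_def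
proof (intro allI impI)
  fix B :: "schwartz set" and \<epsilon> :: real assume B: "tvs_bounded B" and e: "\<epsilon> > 0"
  have "\<epsilon> / (\<bar>c\<bar> + 1) > 0" using e by simp
  then obtain v where v: "\<And>\<phi>. \<phi> \<in> B \<Longrightarrow> \<bar>\<omega> \<phi> - sinner v \<phi>\<bar> < \<epsilon> / (\<bar>c\<bar> + 1)"
    using assms B unfolding approximable_def by meson
  have "\<bar>c * \<omega> \<phi> - sinner (c *\<^sub>R v) \<phi>\<bar> < \<epsilon>" if "\<phi> \<in> B" for \<phi>
  proof -
    have "\<bar>c * \<omega> \<phi> - sinner (c *\<^sub>R v) \<phi>\<bar> = \<bar>c\<bar> * \<bar>\<omega> \<phi> - sinner v \<phi>\<bar>"
      by (simp add: sinner_scaleR_left abs_mult right_diff_distrib[symmetric])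
    also have "\<dots> \<le> (\<bar>c\<bar> + 1) * \<bar>\<omega> \<phi> - sinner v \<phi>\<bar>" by (intro mult_right_mono) auto
    also have "\<dots> < \<epsilon>"
    proof -
      have "\<bar>c\<bar> + 1 > 0" by simp
      from pos_less_divide_eq[OF this] v[OF that] show ?thesis by (simp add: mult.commute)
    qed
    finally show ?thesis .
  qed
  then show "\<exists>v. \<forall>\<phi>\<in>B. \<bar>c * \<omega> \<phi> - sinner v \<phi>\<bar> < \<epsilon>" by blast
qed

lemma approximable_sum:
  assumes "finite G" "\<And>g. g \<in> G \<Longrightarrow> approximable (\<omega> g)"
  shows "approximable (\<lambda>\<phi>. \<Sum>g\<in>G. \<omega> g \<phi>)"
  using assms
proof (induction G rule: finite_induct)
  case empty
  show ?case using approximable_scale[OF approximable_sinner, of 0] by simp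
next
  case (insert g G)
  then show ?case using approximable_add[of "\<omega> g" "\<lambda>\<phi>. \<Sum>g\<in>G. \<omega> g \<phi>"] by simp
qed

text \<open>The Gaussian averages \<phi> around \<open>x\<close>: \<open>snorm 1 \<phi>\<close> is a
  Lipschitz constant of \<phi>, and \<open>\<sigma> * sqrt (2 / pi)\<close> is the mean absolute
  deviation of the normal law.\<close>

lemma abs_sinner_gauss_diff_le:
  assumes \<sigma>: "\<sigma> > 0"
  shows "\<bar>schwartz_fun \<phi> x - sinner (gauss \<sigma> x) \<phi>\<bar> \<le> \<sigma> * sqrt (2 / pi) * snorm 1 \<phi>"
proof -
  let ?nd = "normal_density x \<sigma>"
  have i1: "integrable lborel (\<lambda>y. ?nd y * schwartz_fun \<phi> y)"
    using integrable_schwartz_mult[of "gauss \<sigma> x" \<phi>] by (simp add: schwartz_fun_gauss[OF \<sigma>])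
  have i2: "integrable lborel (\<lambda>y. ?nd y * schwartz_fun \<phi> x)"
    using integrable_normal_density[OF \<sigma>, of x] by simp
  have "schwartz_fun \<phi> x - sinner (gauss \<sigma> x) \<phi> = (LINT y|lborel. ?nd y * schwartz_fun \<phi> x) - (LINT y|lborel. ?nd y * schwartz_fun \<phi> y)"
    using integral_normal_density[OF \<sigma>, of x] by (simp add: sinner_def schwartz_fun_gauss[OF \<sigma>])
  also have "\<dots> = (LINT y|lborel. ?nd y * (schwartz_fun \<phi> x - schwartz_fun \<phi> y))"
    using i1 i2 by (simp add: right_diff_distrib)
  also have "\<bar>\<dots>\<bar> \<le> (LINT y|lborel. \<bar>?nd y * (schwartz_fun \<phi> x - schwartz_fun \<phi> y)\<bar>)"
    by (rule integral_abs_bound)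
  also have "\<dots> \<le> (LINT y|lborel. ?nd y * \<bar>y - x\<bar> * snorm 1 \<phi>)"
  proof (rule integral_mono)
    show "integrable lborel (\<lambda>y. \<bar>?nd y * (schwartz_fun \<phi> x - schwartz_fun \<phi> y)\<bar>)"
      using i1 i2 by (intro integrable_abs) (simp add: right_diff_distrib)
    show "integrable lborel (\<lambda>y. ?nd y * \<bar>y - x\<bar> * snorm 1 \<phi>)"
      using integrable_normal_moment_abs[OF \<sigma>, of x 1] by simp
    fix y
    have "\<bar>schwartz_fun \<phi> x - schwartz_fun \<phi> y\<bar> \<le> \<bar>y - x\<bar> * snorm 1 \<phi>"
      using sderiv_lipschitz[of 0 1 \<phi> x y] by (simp add: sderiv_0 mult.commute abs_minus_commute)
    then show "\<bar>?nd y * (schwartz_fun \<phi> x - schwartz_fun \<phi> y)\<bar> \<le> ?nd y * \<bar>y - x\<bar> * snorm 1 \<phi>"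
      by (simp add: abs_mult mult.assoc mult_left_mono)
  qed
  also have "\<dots> = \<sigma> * sqrt (2 / pi) * snorm 1 \<phi>"
    using integral_normal_moment_abs_odd[OF \<sigma>, of x 0] by simp
  finally show ?thesis .
qed

text \<open>Point evaluations are limits of narrow Gaussians, and higher derivatives are limits of
  difference quotients of lower ones. Both limits are uniform on bounded sets, because one further
  derivative is bounded there.\<close>

lemma approximable_sderiv: "approximable (\<lambda>\<phi>. sderiv n \<phi> x)"
proof (induction n arbitrary: x)
  case 0
  show ?case
  proof (rule approximable_limit)
    fix B :: "schwartz set" and \<epsilon> :: real assume B: "tvs_bounded B" and e: "\<epsilon> > 0"
    obtain k where k: "k > 0" "\<And>\<phi>. \<phi> \<in> B \<Longrightarrow> snorm 1 \<phi> \<le> k" using tvs_boundedE[OF B] by metis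
    define \<sigma> where "\<sigma> = \<epsilon> / (2 * k * sqrt (2 / pi))"
    have \<sigma>: "\<sigma> > 0" using e k by (simp add: \<sigma>_def)
    have "\<bar>sderiv 0 \<phi> x - sinner (gauss \<sigma> x) \<phi>\<bar> < \<epsilon>" if "\<phi> \<in> B" for \<phi>
    proof -
      have "\<bar>sderiv 0 \<phi> x - sinner (gauss \<sigma> x) \<phi>\<bar> \<le> \<sigma> * sqrt (2 / pi) * snorm 1 \<phi>"
        unfolding sderiv_0 by (rule abs_sinner_gauss_diff_le[OF \<sigma>])
      also have "\<dots> \<le> \<sigma> * sqrt (2 / pi) * k" using \<sigma> k(2)[OF that] by (intro mult_left_mono) auto
      also have "\<dots> = \<epsilon> / 2" using k by (simp add: \<sigma>_def)
      finally show ?thesis using e by linarith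
    qed
    then show "\<exists>\<eta>. approximable \<eta> \<and> (\<forall>\<phi>\<in>B. \<bar>sderiv 0 \<phi> x - \<eta> \<phi>\<bar> < \<epsilon>)"
      using approximable_sinner by blast
  qed
next
  case (Suc n)
  show ?case
  proof (rule approximable_limit)
    fix B :: "schwartz set" and \<epsilon> :: real assume B: "tvs_bounded B" and e: "\<epsilon> > 0"
    let ?M = "Suc (Suc n)"
    obtain k where k: "k > 0" "\<And>\<phi>. \<phi> \<in> B \<Longrightarrow> snorm ?M \<phi> \<le> k" using tvs_boundedE[OF B] by metis
    define h where "h = \<epsilon> / (2 * k)"
    have h: "h > 0" using e k by (simp add: h_def)
    define \<eta> where "\<eta> \<phi> = (1 / h) * sderiv n \<phi> (x + h) + (- 1 / h) * sderiv n \<phi> x" for \<phi>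
    have "approximable \<eta>"
      unfolding \<eta>_def by (intro approximable_add approximable_scale Suc.IH)
    moreover have "\<bar>sderiv (Suc n) \<phi> x - \<eta> \<phi>\<bar> < \<epsilon>" if "\<phi> \<in> B" for \<phi>
    proof -
      obtain \<xi> where \<xi>: "x < \<xi>" "\<xi> < x + h" "sderiv n \<phi> (x + h) - sderiv n \<phi> x = (x + h - x) * sderiv (Suc n) \<phi> \<xi>"
        using MVT2[of x "x + h" "sderiv n \<phi>" "sderiv (Suc n) \<phi>"] h has_real_derivative_sderiv by auto
      then have "\<eta> \<phi> = sderiv (Suc n) \<phi> \<xi>" using h by (simp add: \<eta>_def field_simps)
      then have "\<bar>sderiv (Suc n) \<phi> x - \<eta> \<phi>\<bar> \<le> snorm ?M \<phi> * \<bar>x - \<xi>\<bar>"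
        using sderiv_lipschitz[of "Suc n" ?M \<phi> x \<xi>] by simp
      also have "\<dots> \<le> k * h" using k(2)[OF that] k(1) \<xi> by (intro mult_mono) auto
      also have "\<dots> = \<epsilon> / 2" using k by (simp add: h_def)
      finally show ?thesis using e by linarith
    qed
    ultimately show "\<exists>\<eta>. approximable \<eta> \<and> (\<forall>\<phi>\<in>B. \<bar>sderiv (Suc n) \<phi> x - \<eta> \<phi>\<bar> < \<epsilon>)" by blast
  qed
qed

text \<open>A Hahn-Banach argument in a single direction. On the hyperplane \<open>g = 1\<close>
  every value of \<open>\<omega> - s\<close> lies below every value of \<open>\<omega> + s\<close>,
  so a constant \<open>c\<close> fits in between; homogeneity extends the estimate to all \<phi>
  with nonzero \<open>g \<phi>\<close>.\<close>

lemma split_functional: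
  fixes \<omega> g s :: "'a::real_vector \<Rightarrow> real"
  assumes \<omega>: "linear \<omega>" and g: "linear g"
    and s_add: "\<And>\<phi> \<psi>. s (\<phi> + \<psi>) \<le> s \<phi> + s \<psi>" and s_scale: "\<And>c \<phi>. s (c *\<^sub>R \<phi>) = \<bar>c\<bar> * s \<phi>"
    and bound: "\<And>\<phi>. \<bar>\<omega> \<phi>\<bar> \<le> s \<phi> + M * \<bar>g \<phi>\<bar>"
  shows "\<exists>c. \<forall>\<phi>. \<bar>\<omega> \<phi> - c * g \<phi>\<bar> \<le> s \<phi>"
proof (cases "\<exists>\<phi>. g \<phi> \<noteq> 0")
  case False
  then show ?thesis using bound by (intro exI[of _ 0]) auto
next
  case True
  then obtain \<phi>0 where "g \<phi>0 \<noteq> 0" by blast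
  define e where "e = (1 / g \<phi>0) *\<^sub>R \<phi>0"
  have e: "g e = 1" using \<open>g \<phi>0 \<noteq> 0\<close> g by (simp add: e_def linear_scale)
  have gap: "\<omega> \<psi> - s \<psi> \<le> \<omega> \<phi> + s \<phi>" if "g \<phi> = 1" "g \<psi> = 1" for \<phi> \<psi>
  proof -
    \<comment> \<open>The difference lies in the kernel of \<open>g\<close>, where the term with
      \<open>M\<close> disappears from the bound.\<close>
    have "\<omega> \<psi> - \<omega> \<phi> \<le> s (\<psi> - \<phi>)"
      using bound[of "\<psi> - \<phi>"] that \<omega> g by (simp add: linear_diff)
    also have "\<dots> \<le> s \<psi> + s \<phi>"
      using s_add[of \<psi> "-1 *\<^sub>R \<phi>"] s_scale[of "-1" \<phi>] by simp
    finally show ?thesis by linarith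
  qed
  define A where "A = (\<lambda>\<psi>. \<omega> \<psi> - s \<psi>) ` {\<psi>. g \<psi> = 1}"
  have A: "A \<noteq> {}" "bdd_above A"
    using e gap[OF e] by (auto simp: A_def bdd_above_def)
  define c where "c = Sup A"
  have c1: "\<bar>\<omega> \<phi> - c\<bar> \<le> s \<phi>" if "g \<phi> = 1" for \<phi>
  proof -
    have "\<omega> \<phi> - s \<phi> \<le> c" unfolding c_def using that A by (intro cSup_upper) (auto simp: A_def)
    moreover have "c \<le> \<omega> \<phi> + s \<phi>"
      unfolding c_def using A(1) by (rule cSup_least) (use gap that in \<open>auto simp: A_def\<close>)
    ultimately show ?thesis by linarith
  qed
  have "\<bar>\<omega> \<phi> - c * g \<phi>\<bar> \<le> s \<phi>" for \<phi>
  proof (cases "g \<phi> = 0")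
    case True
    then show ?thesis using bound[of \<phi>] by simp
  next
    case False
    have "\<bar>\<omega> ((1 / g \<phi>) *\<^sub>R \<phi>) - c\<bar> \<le> s ((1 / g \<phi>) *\<^sub>R \<phi>)"
      using False g by (intro c1) (simp add: linear_scale)
    then have "\<bar>g \<phi>\<bar> * \<bar>\<omega> \<phi> / g \<phi> - c\<bar> \<le> \<bar>g \<phi>\<bar> * (\<bar>1 / g \<phi>\<bar> * s \<phi>)"
      using \<omega> by (intro mult_left_mono) (simp_all add: linear_scale s_scale)
    then show ?thesis
      using False by (simp add: abs_mult[symmetric] right_diff_distrib mult.assoc[symmetric] mult.commute)
  qed
  then show ?thesis by blast
qed

lemma split_functionals:
  fixes \<omega> s :: "'a::real_vector \<Rightarrow> real" and g :: "'i \<Rightarrow> 'a \<Rightarrow> real"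
  assumes "finite G" "linear \<omega>" and g: "\<And>i. i \<in> G \<Longrightarrow> linear (g i)"
    and s_add: "\<And>\<phi> \<psi>. s (\<phi> + \<psi>) \<le> s \<phi> + s \<psi>" and s_scale: "\<And>c \<phi>. s (c *\<^sub>R \<phi>) = \<bar>c\<bar> * s \<phi>"
    and "M \<ge> 0" and bound: "\<And>\<phi>. \<bar>\<omega> \<phi>\<bar> \<le> s \<phi> + M * (\<Sum>i\<in>G. \<bar>g i \<phi>\<bar>)"
  shows "\<exists>c. \<forall>\<phi>. \<bar>\<omega> \<phi> - (\<Sum>i\<in>G. c i * g i \<phi>)\<bar> \<le> s \<phi>"
  using assms(1-3) bound
proof (induction G arbitrary: \<omega> rule: finite_induct)
  case empty
  then show ?case by simp
next
  case (insert j G)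
  have lin: "linear (g i)" if "i \<in> G" for i using insert.prems(2)[of i] that by simp
  have linj: "linear (g j)" by (rule insert.prems(2)) simp
  \<comment> \<open>The functionals that are still to be split off are counted as part of the
    seminorm, so that the step for \<open>g j\<close> is an instance of the case of one
    functional.\<close>
  define s' where "s' \<phi> = s \<phi> + M * (\<Sum>i\<in>G. \<bar>g i \<phi>\<bar>)" for \<phi>
  have "\<exists>c. \<forall>\<phi>. \<bar>\<omega> \<phi> - c * g j \<phi>\<bar> \<le> s' \<phi>"
  proof (rule split_functional[OF insert.prems(1) linj])
    show "\<bar>\<omega> \<phi>\<bar> \<le> s' \<phi> + M * \<bar>g j \<phi>\<bar>" for \<phi>
      using insert.prems(3)[of \<phi>] insert.hyps by (simp add: s'_def algebra_simps)
    show "s' (\<phi> + \<psi>) \<le> s' \<phi> + s' \<psi>" for \<phi> \<psi>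
    proof -
      have "(\<Sum>i\<in>G. \<bar>g i (\<phi> + \<psi>)\<bar>) \<le> (\<Sum>i\<in>G. \<bar>g i \<phi>\<bar> + \<bar>g i \<psi>\<bar>)"
        using lin by (intro sum_mono) (simp add: linear_add)
      then have "M * (\<Sum>i\<in>G. \<bar>g i (\<phi> + \<psi>)\<bar>) \<le> M * (\<Sum>i\<in>G. \<bar>g i \<phi>\<bar> + \<bar>g i \<psi>\<bar>)"
        using \<open>M \<ge> 0\<close> by (rule mult_left_mono)
      then show ?thesis using s_add[of \<phi> \<psi>] by (simp add: s'_def sum.distrib distrib_left)
    qed
    show "s' (c *\<^sub>R \<phi>) = \<bar>c\<bar> * s' \<phi>" for c \<phi>
    proof -
      have "(\<Sum>i\<in>G. \<bar>g i (c *\<^sub>R \<phi>)\<bar>) = \<bar>c\<bar> * (\<Sum>i\<in>G. \<bar>g i \<phi>\<bar>)"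
        unfolding sum_distrib_left using lin by (intro sum.cong) (simp_all add: linear_scale abs_mult)
      then show ?thesis by (simp add: s'_def s_scale algebra_simps)
    qed
  qed
  then obtain c where c: "\<And>\<phi>. \<bar>\<omega> \<phi> - c * g j \<phi>\<bar> \<le> s' \<phi>" by blast
  have "linear (\<lambda>\<phi>. \<omega> \<phi> - c * g j \<phi>)"
    using insert.prems(1) linj by (auto intro!: linearI simp: linear_add linear_scale algebra_simps)
  then have "\<exists>d. \<forall>\<phi>. \<bar>(\<omega> \<phi> - c * g j \<phi>) - (\<Sum>i\<in>G. d i * g i \<phi>)\<bar> \<le> s \<phi>"
    by (rule insert.IH) (use lin c in \<open>auto simp: s'_def\<close>)
  then obtain d where d: "\<And>\<phi>. \<bar>(\<omega> \<phi> - c * g j \<phi>) - (\<Sum>i\<in>G. d i * g i \<phi>)\<bar> \<le> s \<phi>" by blast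
  have "(\<Sum>i\<in>insert j G. (d(j := c)) i * g i \<phi>) = c * g j \<phi> + (\<Sum>i\<in>G. d i * g i \<phi>)" for \<phi>
  proof -
    have "(\<Sum>i\<in>G. (d(j := c)) i * g i \<phi>) = (\<Sum>i\<in>G. d i * g i \<phi>)"
      using insert.hyps by (intro sum.cong) auto
    then show ?thesis using insert.hyps by simp
  qed
  with d show ?case by (intro exI[of _ "d(j := c)"]) (simp add: diff_diff_eq)
qed

text \<open>Inserted into the continuity bound of \<omega>, the Ehrling inequality leaves a seminorm
  that is small on \<open>B\<close> plus finitely many derivative values. Splitting off a
  combination of the latter leaves a remainder bounded by the small seminorm alone.\<close>

theorem approximable_dual:
  assumes "\<omega> \<in> dual_space"
  shows "approximable \<omega>"
proof (rule approximable_limit)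
  fix B :: "schwartz set" and \<epsilon> :: real assume B: "tvs_bounded B" and e: "\<epsilon> > 0"
  obtain N C where C: "C > 0" "\<And>\<phi>. \<bar>\<omega> \<phi>\<bar> \<le> C * snorm N \<phi>" using dual_space_snormE[OF assms] by blast
  obtain k where k: "k > 0" "\<And>\<phi>. \<phi> \<in> B \<Longrightarrow> snorm (Suc N) \<phi> \<le> k" using tvs_boundedE[OF B] by metis
  \<comment> \<open>After multiplication by \<open>C\<close>, and with \<open>snorm (Suc N)\<close>
    at most \<open>k\<close> on \<open>B\<close>, the first Ehrling term becomes
    \<open>\<epsilon> / 2\<close>.\<close>
  have "\<epsilon> / (2 * C * k) > 0" using e C k by simp
  then obtain G M where G: "finite (G :: (nat \<times> real) set)" "M > 0"
    and E: "\<And>\<phi>. snorm N \<phi> \<le> \<epsilon> / (2 * C * k) * snorm (Suc N) \<phi> + M * (\<Sum>(n, x)\<in>G. \<bar>sderiv n \<phi> x\<bar>)"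
    using ehrling by metis
  define g where "g i \<phi> = sderiv (fst i) \<phi> (snd i)" for i \<phi>
  define s where "s \<phi> = \<epsilon> / (2 * k) * snorm (Suc N) \<phi>" for \<phi>
  have "\<exists>c. \<forall>\<phi>. \<bar>\<omega> \<phi> - (\<Sum>i\<in>G. c i * g i \<phi>)\<bar> \<le> s \<phi>"
  proof (rule split_functionals)
    show "finite G" "linear \<omega>" using G dual_space_linear[OF assms] by auto
    show "linear (g i)" for i by (auto intro!: linearI simp: g_def sderiv_add sderiv_scaleR)
    show "s (\<phi> + \<psi>) \<le> s \<phi> + s \<psi>" for \<phi> \<psi>
      unfolding s_def distrib_left[symmetric] using e k by (intro mult_left_mono snorm_triangle) auto
    show "s (c *\<^sub>R \<phi>) = \<bar>c\<bar> * s \<phi>" for c \<phi> by (simp add: s_def snorm_scaleR)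
    show "C * M \<ge> 0" using C G by simp
    fix \<phi>
    have "\<bar>\<omega> \<phi>\<bar> \<le> C * (\<epsilon> / (2 * C * k) * snorm (Suc N) \<phi> + M * (\<Sum>(n, x)\<in>G. \<bar>sderiv n \<phi> x\<bar>))"
      using C(1) by (intro order_trans[OF C(2)] mult_left_mono E) auto
    also have "\<dots> = s \<phi> + C * M * (\<Sum>i\<in>G. \<bar>g i \<phi>\<bar>)"
      using C(1) by (simp add: s_def g_def distrib_left case_prod_unfold)
    finally show "\<bar>\<omega> \<phi>\<bar> \<le> s \<phi> + C * M * (\<Sum>i\<in>G. \<bar>g i \<phi>\<bar>)" .
  qed
  then obtain c where c: "\<And>\<phi>. \<bar>\<omega> \<phi> - (\<Sum>i\<in>G. c i * g i \<phi>)\<bar> \<le> s \<phi>" by blast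
  have "approximable (\<lambda>\<phi>. \<Sum>i\<in>G. c i * g i \<phi>)"
    unfolding g_def using G by (intro approximable_sum approximable_scale approximable_sderiv)
  moreover have "\<bar>\<omega> \<phi> - (\<Sum>i\<in>G. c i * g i \<phi>)\<bar> < \<epsilon>" if "\<phi> \<in> B" for \<phi>
  proof -
    have "s \<phi> \<le> \<epsilon> / (2 * k) * k" unfolding s_def using e k that by (intro mult_left_mono) auto
    also have "\<dots> = \<epsilon> / 2" using k by simp
    finally show ?thesis using c[of \<phi>] e by linarith
  qed
  ultimately show "\<exists>\<eta>. approximable \<eta> \<and> (\<forall>\<phi>\<in>B. \<bar>\<omega> \<phi> - \<eta> \<phi>\<bar> < \<epsilon>)" by blast
qed

theorem all_charged:
  assumes ml: "is_mittag_leffler_measure \<beta> \<mu>" and "0 < \<beta>" and \<omega>: "\<omega> \<in> dual_space"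
  shows "charged \<mu> \<omega>"
proof (rule charged_limit[OF \<omega>])
  fix B :: "schwartz set" and \<epsilon> :: real assume B: "tvs_bounded B" and e: "\<epsilon> > 0"
  obtain \<eta> where \<eta>: "charged \<mu> \<eta>" "\<not> l2_bounded \<eta>"
    using ex_charged_not_l2_bounded[OF ml \<open>0 < \<beta>\<close>] by blast
  \<comment> \<open>Density is applied to the difference, so that translating the charged point
    \<eta> ends near \<omega>.\<close>
  have "(\<lambda>\<phi>. \<omega> \<phi> - \<eta> \<phi>) \<in> dual_space"
    using dual_space_lincomb[OF \<omega> charged_dual[OF \<eta>(1)], of 1 "-1"] by simp
  then obtain v where v: "\<And>\<phi>. \<phi> \<in> B \<Longrightarrow> \<bar>\<omega> \<phi> - \<eta> \<phi> - sinner v \<phi>\<bar> < \<epsilon>"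
    using approximable_dual B e unfolding approximable_def by meson
  have ch: "charged \<mu> (\<lambda>\<phi>. \<eta> \<phi> + sinner v \<phi>)" by (rule charged_translate[OF ml \<eta>])
  moreover have "(\<lambda>\<phi>. \<eta> \<phi> + sinner v \<phi>) \<in> dual_nbhd \<omega> B \<epsilon>"
    using charged_dual[OF ch] v by (auto simp: dual_nbhd_def abs_minus_commute diff_diff_eq)
  ultimately show "\<exists>\<omega>'. charged \<mu> \<omega>' \<and> \<omega>' \<in> dual_nbhd \<omega> B \<epsilon>" by blast
qed

section \<open>Finite products\<close>

lemma tvs_bounded_component:
  assumes "tvs_bounded (B :: (schwartz ^ 'd::finite) set)"
  shows "tvs_bounded ((\<lambda>\<phi>. \<phi> $ k) ` B)"
  unfolding tvs_bounded_def
proof (intro allI impI)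
  fix V :: "schwartz set" assume V: "open V" "0 \<in> V"
  have "open ((\<lambda>\<phi>. \<phi> $ k) -` V)"
    by (rule open_vimage[OF V(1)]) (intro continuous_intros)
  moreover have "0 \<in> (\<lambda>\<phi>. \<phi> $ k) -` V" using V by simp
  ultimately obtain r where r: "r > 0" "\<forall>t\<ge>r. B \<subseteq> (*\<^sub>R) t ` ((\<lambda>\<phi>. \<phi> $ k) -` V)"
    using assms unfolding tvs_bounded_def by blast
  have "(\<lambda>\<phi>. \<phi> $ k) ` B \<subseteq> (*\<^sub>R) t ` V" if "t \<ge> r" for t
  proof
    fix \<psi> assume "\<psi> \<in> (\<lambda>\<phi>. \<phi> $ k) ` B"
    then obtain \<theta> where \<theta>: "\<theta> \<in> B" "\<psi> = \<theta> $ k" by blast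
    have "\<theta> \<in> (*\<^sub>R) t ` ((\<lambda>\<phi>. \<phi> $ k) -` V)" using r(2) \<open>t \<ge> r\<close> \<theta>(1) by blast
    then obtain \<phi> where \<phi>: "\<theta> = t *\<^sub>R \<phi>" "\<phi> $ k \<in> V" by blast
    show "\<psi> \<in> (*\<^sub>R) t ` V" unfolding \<theta>(2) \<phi>(1) vector_scaleR_component
      using \<phi>(2) by (rule imageI)
  qed
  with r show "\<exists>r>0. \<forall>t\<ge>r. (\<lambda>\<phi>. \<phi> $ k) ` B \<subseteq> (*\<^sub>R) t ` V" by blast
qed

lemma dual_of_tuple_nbhd:
  fixes U :: "(schwartz ^ 'd::finite \<Rightarrow> real) set"
  assumes U: "openin strong_topology U" and \<omega>: "dual_of_tuple \<omega> \<in> U"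
  obtains B \<epsilon> where "\<epsilon> > 0" "\<And>k. tvs_bounded (B k)"
    "\<And>\<eta>. (\<And>k. \<eta> k \<in> dual_nbhd (\<omega> k) (B k) \<epsilon>) \<Longrightarrow> dual_of_tuple \<eta> \<in> U"
proof -
  obtain B \<epsilon> where B: "\<epsilon> > 0" "tvs_bounded B"
    "{\<eta> \<in> dual_space. \<forall>\<phi>\<in>B. \<bar>\<eta> \<phi> - dual_of_tuple \<omega> \<phi>\<bar> < \<epsilon>} \<subseteq> U"
    using U \<omega> unfolding openin_strong_topology by meson
  show thesis
  proof (rule that)
    \<comment> \<open>The functional on the direct sum is a sum over \<open>CARD('d)\<close>
      components, each of which receives an equal share of the error.\<close>
    let ?e = "\<epsilon> / real CARD('d)"
    show "?e > 0" using B by simp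
    show "tvs_bounded ((\<lambda>\<phi>. \<phi> $ k) ` B)" for k by (rule tvs_bounded_component[OF B(2)])
    fix \<eta> :: "'d \<Rightarrow> schwartz \<Rightarrow> real"
    assume \<eta>: "\<And>k. \<eta> k \<in> dual_nbhd (\<omega> k) ((\<lambda>\<phi>. \<phi> $ k) ` B) ?e"
    have "dual_of_tuple \<eta> \<in> dual_space" using \<eta> by (intro dual_of_tuple_in_dual) (simp add: dual_nbhd_def)
    moreover have "\<bar>dual_of_tuple \<eta> \<phi> - dual_of_tuple \<omega> \<phi>\<bar> < \<epsilon>" if "\<phi> \<in> B" for \<phi>
    proof -
      have "\<bar>dual_of_tuple \<eta> \<phi> - dual_of_tuple \<omega> \<phi>\<bar> \<le> (\<Sum>k\<in>UNIV. \<bar>\<eta> k (\<phi> $ k) - \<omega> k (\<phi> $ k)\<bar>)"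
        unfolding dual_of_tuple_def sum_subtractf[symmetric] by (rule sum_abs)
      also have "\<dots> < (\<Sum>k\<in>(UNIV :: 'd set). ?e)"
        using \<eta> that by (intro sum_strict_mono) (auto simp: dual_nbhd_def)
      also have "\<dots> = \<epsilon>" by simp
      finally show ?thesis .
    qed
    ultimately show "dual_of_tuple \<eta> \<in> U" using B(3) by blast
  qed
qed

lemma dual_of_tuple_axis:
  assumes "\<And>j. \<omega> j \<in> dual_space"
  shows "dual_of_tuple \<omega> (axis k \<psi>) = \<omega> k \<psi>"
proof -
  have "\<omega> j (axis k \<psi> $ j) = (if j = k then \<omega> k \<psi> else 0)" for j
    using linear_0[OF dual_space_linear[OF assms]] by (auto simp: axis_def)
  then show ?thesis by (simp add: dual_of_tuple_def)
qed

lemma dual_of_tuple_surj: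
  fixes \<eta> :: "schwartz ^ 'd::finite \<Rightarrow> real"
  assumes "\<eta> \<in> dual_space"
  obtains \<omega> where "\<And>k. \<omega> k \<in> dual_space" "\<eta> = dual_of_tuple \<omega>"
proof -
  have "dual_of_tuple ` ((UNIV :: 'd set) \<rightarrow> dual_space) = dual_space"
    by (rule bij_betw_imp_surj_on[OF bij_betw_dual_of_tuple])
  then have "\<eta> \<in> dual_of_tuple ` ((UNIV :: 'd set) \<rightarrow> dual_space)"
    using assms by blast
  then obtain \<omega> where "\<omega> \<in> (UNIV :: 'd set) \<rightarrow> dual_space" "\<eta> = dual_of_tuple \<omega>" by blast
  then show thesis using that[of \<omega>] by (simp add: Pi_iff)
qed

text \<open>These maps are the components of the inverse of \<open>dual_of_tuple\<close>; through
  them products of measurable sets become measurable in the dual of the direct sum.\<close>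

lemma measurable_component_functional:
  "(\<lambda>\<eta> \<psi>. \<eta> (axis k \<psi>)) \<in> measurable
     (cylinder_algebra :: (schwartz ^ 'd::finite \<Rightarrow> real) measure) cylinder_algebra"
proof -
  let ?c = "\<lambda>(\<eta> :: schwartz ^ 'd \<Rightarrow> real) \<psi>. \<eta> (axis k \<psi>)"
  have dual: "?c \<eta> \<in> dual_space" if "\<eta> \<in> dual_space" for \<eta>
  proof -
    obtain \<omega> where \<omega>: "\<And>k. \<omega> k \<in> dual_space" "\<eta> = dual_of_tuple \<omega>"
      using dual_of_tuple_surj[OF \<open>\<eta> \<in> dual_space\<close>] by blast
    then have "?c \<eta> = \<omega> k" by (auto simp: dual_of_tuple_axis)
    then show ?thesis using \<omega> by simp
  qed
  show ?thesis
    unfolding cylinder_algebra_def[where 'a = schwartz]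
  proof (rule measurable_measure_of)
    show "?c \<in> space cylinder_algebra \<rightarrow> dual_space" using dual by simp
    fix Y :: "(schwartz \<Rightarrow> real) set"
    assume "Y \<in> {{\<omega> \<in> dual_space. \<omega> \<phi> \<in> A} |\<phi> A. A \<in> sets borel}"
    then obtain \<phi> A where Y: "Y = {\<omega> \<in> dual_space. \<omega> \<phi> \<in> A}" and A: "A \<in> sets borel" by blast
    have "?c -` Y \<inter> space cylinder_algebra = (\<lambda>\<eta>. \<eta> (axis k \<phi>)) -` A \<inter> space cylinder_algebra"
      using dual by (auto simp: Y)
    then show "?c -` Y \<inter> space cylinder_algebra \<in> sets cylinder_algebra"
      using measurable_sets[OF measurable_cylinder_eval A, of "axis k \<phi>"] by simp
  qed auto
qed

text \<open>An open set is the union of the boxes of network members that it contains, and there are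
  countably many such boxes because the number of factors is finite. The measurability matters for
  the final inequality, as \<open>emeasure\<close> is 0 on sets outside the sigma-algebra.\<close>

lemma strong_open_measurable:
  fixes U :: "(schwartz ^ 'd::finite \<Rightarrow> real) set"
  assumes U: "openin strong_topology U"
  shows "U \<in> sets cylinder_algebra"
proof -
  obtain \<C> where \<C>: "countable \<C>" "\<C> \<subseteq> sets cylinder_algebra"
    and nw: "\<And>\<omega> B \<epsilon>. \<lbrakk>\<omega> \<in> dual_space; tvs_bounded B; \<epsilon> > 0\<rbrakk> \<Longrightarrow>
       \<exists>C\<in>\<C>. \<omega> \<in> C \<and> C \<subseteq> {\<eta> \<in> dual_space. \<forall>\<phi>\<in>B. \<bar>\<eta> \<phi> - \<omega> (\<phi> :: schwartz)\<bar> < \<epsilon>}"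
    using countable_network by blast
  define box where "box C = {\<eta> \<in> dual_space. \<forall>k. (\<lambda>\<psi>. \<eta> (axis k \<psi>)) \<in> C k}"
    for C :: "'d \<Rightarrow> (schwartz \<Rightarrow> real) set"
  have box_meas: "box C \<in> sets cylinder_algebra" if "\<And>k. C k \<in> \<C>" for C
  proof -
    have "box C = (\<Inter>k. (\<lambda>\<eta> \<psi>. \<eta> (axis k \<psi>)) -` C k \<inter> space cylinder_algebra)"
      by (auto simp: box_def)
    also have "\<dots> \<in> sets cylinder_algebra"
      using that \<C>(2) by (intro sets.finite_INT measurable_sets[OF measurable_component_functional]) auto
    finally show ?thesis .
  qed
  define F where "F = {C \<in> UNIV \<rightarrow>\<^sub>E \<C>. box C \<subseteq> U}"
  have "countable (UNIV \<rightarrow>\<^sub>E \<C> :: ('d \<Rightarrow> (schwartz \<Rightarrow> real) set) set)"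
    using \<C>(1) by (intro countable_PiE) auto
  then have "countable F" by (rule countable_subset[rotated]) (auto simp: F_def)
  moreover have "U = (\<Union>C\<in>F. box C)"
  proof (intro equalityI subsetI)
    fix \<eta> assume \<eta>: "\<eta> \<in> U"
    then have "\<eta> \<in> dual_space" using U by (auto simp: openin_strong_topology)
    then obtain \<omega> where \<omega>: "\<And>k. \<omega> k \<in> dual_space" "\<eta> = dual_of_tuple \<omega>"
      using dual_of_tuple_surj by blast
    obtain B \<epsilon> where B: "\<epsilon> > 0" "\<And>k. tvs_bounded (B k)"
      "\<And>\<eta>. (\<And>k. \<eta> k \<in> dual_nbhd (\<omega> k) (B k) \<epsilon>) \<Longrightarrow> dual_of_tuple \<eta> \<in> U"
      using dual_of_tuple_nbhd[OF U \<eta>[unfolded \<omega>(2)]] by metis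
    have "\<exists>C\<in>\<C>. \<omega> k \<in> C \<and> C \<subseteq> dual_nbhd (\<omega> k) (B k) \<epsilon>" for k
      unfolding dual_nbhd_def by (rule nw[OF \<omega>(1) B(2) B(1)])
    then obtain C where C: "\<And>k. C k \<in> \<C>" "\<And>k. \<omega> k \<in> C k" "\<And>k. C k \<subseteq> dual_nbhd (\<omega> k) (B k) \<epsilon>"
      by metis
    have "box C \<subseteq> U"
    proof
      fix \<theta> assume \<theta>: "\<theta> \<in> box C"
      then obtain \<rho> where \<rho>: "\<And>k. \<rho> k \<in> dual_space" "\<theta> = dual_of_tuple \<rho>"
        using dual_of_tuple_surj by (auto simp: box_def)
      have "\<rho> k \<in> C k" for k using \<theta> by (auto simp: box_def \<rho> dual_of_tuple_axis)
      then show "\<theta> \<in> U" unfolding \<rho>(2) using C(3) by (intro B(3)) blast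
    qed
    moreover have "\<eta> \<in> box C"
      using \<open>\<eta> \<in> dual_space\<close> C(2) by (simp add: box_def \<omega> dual_of_tuple_axis)
    ultimately show "\<eta> \<in> (\<Union>C\<in>F. box C)" using C(1) by (auto simp: F_def)
  qed (auto simp: F_def)
  moreover have "box C \<in> sets cylinder_algebra" if "C \<in> F" for C
    using that by (intro box_meas) (auto simp: F_def PiE_iff)
  ultimately show ?thesis by (auto intro: sets.countable_UN')
qed

theorem proposition3p6:
  fixes \<beta> :: real
    and \<mu> :: "(schwartz \<Rightarrow> real) measure"
    and U :: "(schwartz ^ 'd::finite \<Rightarrow> real) set"
  assumes "0 < \<beta>" and "\<beta> \<le> 1"
    and "is_mittag_leffler_measure \<beta> \<mu>"
    and "openin strong_topology U" and "U \<noteq> {}"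
  shows "emeasure (product_dual_measure \<mu>) U > 0"
proof -
  have P: "prob_space \<mu>" and sp: "space \<mu> = dual_space" and sets: "sets \<mu> = sets cylinder_algebra"
    using assms(3) by (auto simp: is_mittag_leffler_measure_def)
  obtain \<eta> where \<eta>: "\<eta> \<in> U" using assms(5) by blast
  then have "\<eta> \<in> dual_space" using assms(4) by (auto simp: openin_strong_topology)
  then obtain \<omega> where \<omega>: "\<And>k. \<omega> k \<in> dual_space" "\<eta> = dual_of_tuple \<omega>"
    using dual_of_tuple_surj by blast
  obtain B \<epsilon> where B: "\<epsilon> > 0" "\<And>k. tvs_bounded (B k)"
    "\<And>\<eta>. (\<And>k. \<eta> k \<in> dual_nbhd (\<omega> k) (B k) \<epsilon>) \<Longrightarrow> dual_of_tuple \<eta> \<in> U"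
    using dual_of_tuple_nbhd[OF assms(4) \<eta>[unfolded \<omega>(2)]] by metis
  have "\<exists>A\<in>sets cylinder_algebra. A \<subseteq> dual_nbhd (\<omega> k) (B k) \<epsilon> \<and> emeasure \<mu> A > 0" for k
    using all_charged[OF assms(3,1) \<omega>(1)] B(1,2) unfolding charged_def by blast
  then obtain A where A: "\<And>k. A k \<in> sets \<mu>" "\<And>k. A k \<subseteq> dual_nbhd (\<omega> k) (B k) \<epsilon>"
    "\<And>k. emeasure \<mu> (A k) > 0"
    unfolding sets by metis
  let ?P = "Pi\<^sub>M (UNIV :: 'd set) (\<lambda>_. \<mu>)"
  interpret prob_space \<mu> by fact
  interpret product_sigma_finite "\<lambda>_ :: 'd. \<mu>"
    by (intro product_sigma_finite.intro) (rule sigma_finite_measure_axioms)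
  have meas: "(dual_of_tuple :: ('d \<Rightarrow> schwartz \<Rightarrow> real) \<Rightarrow> _) \<in> measurable ?P cylinder_algebra"
    by (rule dual_of_tuple_measurable[OF sets])
  have Um: "U \<in> sets cylinder_algebra" by (rule strong_open_measurable[OF assms(4)])
  \<comment> \<open>A neighbourhood in the direct sum contains the image of a product of
    neighbourhoods, so charged sets chosen in each factor give a rectangle of positive measure
    inside the preimage of \<open>U\<close>.\<close>
  have "0 < (\<Prod>k\<in>(UNIV :: 'd set). emeasure \<mu> (A k))"
    using A(3) by (simp add: zero_less_iff_neq_zero)
  also have "\<dots> = emeasure ?P (Pi\<^sub>E UNIV A)"
    using A(1) by (intro emeasure_PiM[symmetric]) auto
  also have "\<dots> \<le> emeasure ?P (dual_of_tuple -` U \<inter> space ?P)"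
  proof (rule emeasure_mono)
    show "Pi\<^sub>E UNIV A \<subseteq> dual_of_tuple -` U \<inter> space ?P"
      using A(2) sets.sets_into_space[OF A(1)] by (fastforce simp: space_PiM PiE_iff intro!: B(3))
    show "dual_of_tuple -` U \<inter> space ?P \<in> sets ?P" by (rule measurable_sets[OF meas Um])
  qed
  also have "\<dots> = emeasure (product_dual_measure \<mu>) U"
    unfolding product_dual_measure_def by (rule emeasure_distr[OF meas Um, symmetric])
  finally show ?thesis .
qed

end
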